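(* Suppose that all the eigenvalues of the boundary value problem $$-y''+q(x)y=\lambda y\ (0<x<1),\qquad y(0)\cos\beta=y'(0)\sin\beta,\qquad (a\lambda+b)y(1)=(c\lambda+d)y'(1)$$ are real and that, except for one triple eigenvalue $\lambda_k=\lambda_{k+1}=\lambda_{k+2}$, all of them are simple. Let $y_n=y(\cdot,\lambda_n)$ for $n\neq k+1,k+2$ be the eigenfunctions, and let $y_{k+1}=\tilde y_{k+1}+Cy_k$ and $y_{k+2}=\tilde y_{k+2}+C\tilde y_{k+1}+Dy_k$ with $C,D\in\mathbb{R}$ be the first and second associated functions. Then the system $$\{y_n\}\quad (n=0,1,\ldots;\ n\neq k)$$ is minimal in $L_2(0,1)$ if and only if $$D\neq C^2+\frac{\omega^{IV}(\lambda_k)}{4\,\omega'''(\lambda_k)}\left(C+\frac{\omega^{IV}(\lambda_k)}{4\,\omega'''(\lambda_k)}\right)-\frac{\omega^{V}(\lambda_k)}{20\,\omega'''(\lambda_k)}.$$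
   Context: Here $q:[0,1]\to\mathbb{R}$ is continuous, $0\le\beta<\pi$, and $a,b,c,d\in\mathbb{R}$ satisfy $ad-bc<0$. For $\lambda\in\mathbb{C}$ let $y(x,\lambda)$ be the solution of $-y''+q(x)y=\lambda y$ on $[0,1]$ with $y(0,\lambda)=\sin\beta$, $y'(0,\lambda)=\cos\beta$ (prime on $y$ means $d/dx$), and define the characteristic function $$\omega(\lambda)=(a\lambda+b)y(1,\lambda)-(c\lambda+d)y'(1,\lambda).$$ Primes and roman superscripts on $\omega$ denote derivatives in $\lambda$. The eigenvalues are the zeros of $\omega$, counted with algebraic multiplicity (the order as a zero of $\omega$). They form an infinite sequence $\{\lambda_n\}_{n\ge0}$ indexed by non-decreasing real parts, whose only accumulation point is $+\infty$. If $\lambda_k=\lambda_{k+1}=\lambda_{k+2}$ is a triple eigenvalue, with eigenfunction $y_k=y(\cdot,\lambda_k)$, a first associated function $y_{k+1}$ of $y_k$ is a solution of $-y_{k+1}''+qy_{k+1}=\lambda_ky_{k+1}+y_k$, $y_{k+1}(0)\cos\beta=y_{k+1}'(0)\sin\beta$, $(a\lambda_k+b)y_{k+1}(1)+ay_k(1)=(c\lambda_k+d)y_{k+1}'(1)+cy_k'(1)$. A second associated function $y_{k+2}$, belonging to $y_{k+1}$, is a solution of $-y_{k+2}''+qy_{k+2}=\lambda_ky_{k+2}+y_{k+1}$, $y_{k+2}(0)\cos\beta=y_{k+2}'(0)\sin\beta$, $(a\lambda_k+b)y_{k+2}(1)+ay_{k+1}(1)=(c\lambda_k+d)y_{k+2}'(1)+cy_{k+1}'(1)$.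 Put $\tilde y_{k+1}(x)=\frac{\partial y}{\partial\lambda}(x,\lambda_k)$ and $\tilde y_{k+2}(x)=\frac12\frac{\partial^2y}{\partial\lambda^2}(x,\lambda_k)$. These are particular associated functions, and in general $y_{k+1}=\tilde y_{k+1}+Cy_k$, $y_{k+2}=\tilde y_{k+2}+C\tilde y_{k+1}+Dy_k$ for some constants $C,D$. A system in $L_2(0,1)$ is minimal if none of its elements lies in the closed linear span of the others. *)

theory Defs
  imports "HOL-Complex_Analysis.Complex_Analysis"
begin

section \<open>The differential equation\<close>

text \<open>Derivative in the space variable, one-sided at the end points of \<open>[0,1]\<close>.\<close>

definition dx :: "(real \<Rightarrow> complex) \<Rightarrow> real \<Rightarrow> complex" where
  "dx u x = vector_derivative u (at x within {0..1})"

definition sl_solution :: "(real \<Rightarrow> real) \<Rightarrow> complex \<Rightarrow> (real \<Rightarrow> complex) \<Rightarrow> bool" where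
  "sl_solution q \<mu> u \<longleftrightarrow>
     (\<forall>x\<in>{0..1}. u differentiable (at x within {0..1}) \<and>
                 dx u differentiable (at x within {0..1}) \<and>
                 - dx (dx u) x + of_real (q x) * u x = \<mu> * u x)"

text \<open>
  The initial value problem determines \<open>y x \<mu>\<close> uniquely for \<open>x \<in> [0,1]\<close>; the values for
  \<open>x\<close> outside \<open>[0,1]\<close> are unconstrained and never used.
\<close>

definition sl_family ::
    "(real \<Rightarrow> real) \<Rightarrow> real \<Rightarrow> (real \<Rightarrow> complex \<Rightarrow> complex) \<Rightarrow> bool" where
  "sl_family q \<beta> y \<longleftrightarrow>
     (\<forall>\<mu>. sl_solution q \<mu> (\<lambda>x. y x \<mu>) \<and>
          y 0 \<mu> = of_real (sin \<beta>) \<and> dx (\<lambda>x. y x \<mu>) 0 = of_real (cos \<beta>))"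

definition char_fun ::
    "real \<Rightarrow> real \<Rightarrow> real \<Rightarrow> real \<Rightarrow> (real \<Rightarrow> complex \<Rightarrow> complex) \<Rightarrow> complex \<Rightarrow> complex" where
  "char_fun a b c d y \<mu> =
     (of_real a * \<mu> + of_real b) * y 1 \<mu> - (of_real c * \<mu> + of_real d) * dx (\<lambda>x. y x \<mu>) 1"

section \<open>Eigenvalues and root functions\<close>

text \<open>
  \<open>lam\<close> lists exactly the zeros of \<open>\<omega>\<close>, each as often as its order as a zero, by
  non-decreasing real part.
\<close>

definition eigenvalue_sequence :: "(complex \<Rightarrow> complex) \<Rightarrow> (nat \<Rightarrow> complex) \<Rightarrow> bool" where
  "eigenvalue_sequence \<omega> lam \<longleftrightarrow>
     mono (\<lambda>n. Re (lam n)) \<and>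
     (\<forall>z. finite {n. lam n = z} \<and>
          int (card {n. lam n = z}) = (if \<omega> z = 0 then zorder \<omega> z else 0))"

text \<open>
  The particular first and second associated functions at an eigenvalue \<open>\<mu>\<close> are the Taylor
  coefficients of \<open>y x\<close> at \<open>\<mu>\<close>.
\<close>

definition assoc1_tilde :: "(real \<Rightarrow> complex \<Rightarrow> complex) \<Rightarrow> complex \<Rightarrow> real \<Rightarrow> complex" where
  "assoc1_tilde y \<mu> x = deriv (y x) \<mu>"

definition assoc2_tilde :: "(real \<Rightarrow> complex \<Rightarrow> complex) \<Rightarrow> complex \<Rightarrow> real \<Rightarrow> complex" where
  "assoc2_tilde y \<mu> x = (deriv ^^ 2) (y x) \<mu> / 2"

text \<open>
  Root functions when \<open>lam k = lam (k+1) = lam (k+2)\<close> is the only multiple eigenvalue; \<open>C\<close>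
  and \<open>D\<close> parametrise the choice of the associated functions.
\<close>

definition root_function ::
    "(real \<Rightarrow> complex \<Rightarrow> complex) \<Rightarrow> (nat \<Rightarrow> complex) \<Rightarrow> nat \<Rightarrow> real \<Rightarrow> real \<Rightarrow> nat \<Rightarrow> real \<Rightarrow> complex" where
  "root_function y lam k C D n x =
     (if n = k + 1 then
        assoc1_tilde y (lam k) x + of_real C * y x (lam k)
      else if n = k + 2 then
        assoc2_tilde y (lam k) x + of_real C * assoc1_tilde y (lam k) x + of_real D * y x (lam k)
      else y x (lam n))"

section \<open>Minimality in \<open>L\<^sub>2(0,1)\<close>\<close>

text \<open>
  Elements of the complex space \<open>L\<^sub>2(0,1)\<close> are represented by functions; only their values on
  the open interval matter, and all notions below respect equality almost everywhere.
\<close>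

definition in_L2 :: "(real \<Rightarrow> complex) \<Rightarrow> bool" where
  "in_L2 f \<longleftrightarrow> f \<in> borel_measurable (lebesgue_on {0<..<1}) \<and>
               integrable (lebesgue_on {0<..<1}) (\<lambda>x. (cmod (f x))\<^sup>2)"

definition L2_norm :: "(real \<Rightarrow> complex) \<Rightarrow> real" where
  "L2_norm f = sqrt (LINT x|lebesgue_on {0<..<1}. (cmod (f x))\<^sup>2)"

definition lin_span :: "'i set \<Rightarrow> ('i \<Rightarrow> real \<Rightarrow> complex) \<Rightarrow> (real \<Rightarrow> complex) set" where
  "lin_span I f = {g. \<exists>J r. finite J \<and> J \<subseteq> I \<and> g = (\<lambda>x. \<Sum>j\<in>J. r j * f j x)}"

definition closed_lin_span :: "'i set \<Rightarrow> ('i \<Rightarrow> real \<Rightarrow> complex) \<Rightarrow> (real \<Rightarrow> complex) set" where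
  "closed_lin_span I f =
     {h. in_L2 h \<and> (\<forall>\<epsilon>>0. \<exists>g\<in>lin_span I f. L2_norm (\<lambda>x. h x - g x) < \<epsilon>)}"

definition minimal_system :: "'i set \<Rightarrow> ('i \<Rightarrow> real \<Rightarrow> complex) \<Rightarrow> bool" where
  "minimal_system I f \<longleftrightarrow>
     (\<forall>i\<in>I. in_L2 (f i)) \<and> (\<forall>i\<in>I. f i \<notin> closed_lin_span (I - {i}) f)"

end

theory Submission
  imports Defs
begin

text \<open>
  Write \<open>m u = a u(1) - c u'(1)\<close>, \<open>n u = b u(1) - d u'(1)\<close> and \<open>\<sigma> = b c - a d > 0\<close>. In
  \<open>L\<^sub>2(0,1) \<oplus> \<complex>\<close> the problem is that of the operator \<open>A (u, m u) = (- u'' + q u, - n u)\<close>,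
  symmetric for the form \<open>\<sigma> \<integral> f g - s t\<close> with one negative square. The Taylor coefficients
  \<open>Y\<^sub>0, Y\<^sub>1, Y\<^sub>2\<close> of \<open>(y, m y)\<close> at the triple eigenvalue form a Jordan chain whose Gram matrix
  is read off the Taylor coefficients of \<open>\<omega>\<close>. Let \<open>V\<close> be the combination of \<open>Y\<^sub>0, Y\<^sub>1, Y\<^sub>2\<close>
  orthogonal to all root vectors except the one removed; its scalar component vanishes exactly
  when \<open>D\<close> equals the stated value.

  If it does not vanish, subtracting multiples of \<open>V\<close> from the vectors dual to the root vectors
  makes their scalar components zero, and their \<open>L\<^sub>2\<close> components are biorthogonal to the system.

  If it vanishes, then \<open>V\<close> itself annihilates the system, and a functional that isolates one
  \<open>y\<^sub>j\<close> could be corrected to a pair orthogonal to all root vectors with nonzero scalar component.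
  The root vectors are complete, so there is no such pair: on the orthogonal complement of the
  neutral vector \<open>Y\<^sub>0\<close> the form is positive semidefinite, so for \<open>W\<close> orthogonal to all root
  vectors the orbit \<open>(A - \<lambda>)\<^sup>-\<^sup>1 W\<close>, defined for every real \<open>\<lambda>\<close>, yields a positive semidefinite
  kernel \<open>(G \<lambda> - G \<nu>) / (\<lambda> - \<nu>)\<close> on the whole real line, and such a kernel is constant.
\<close>

section \<open>The initial value problem\<close>

text \<open>A pair with scalar component zero pairs with a root vector as \<sigma> times an
  \<open>L2\<close> inner product; this is how the form sees \<open>L2\<close>. The root vectors
  live in a space with one dimension more than \<open>L2\<close>, so one function has to go, and the
  scalar component of the pair \<open>V\<close> annihilating the rest decides. If it vanishes, the
  remaining functions miss a direction of \<open>L2\<close>; completeness of the root vectors in the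
  larger space then turns this deficit into a failure of minimality.

  A functional isolating one \<open>y_j\<close> need not be given by a continuous function, whereas
  the equation is solved here for continuous sources. It is therefore replaced by a mean-square
  Cauchy sequence, which the resolvent makes uniformly convergent.

  Real eigenvalues make all Taylor coefficients real, so a real bilinear form suffices, and
  completeness is obtained from real parameters alone, without eigenvalue asymptotics. The constants
  \<open>4\<close> and \<open>20\<close> of the criterion are \<open>4! / 3!\<close> and
  \<open>5! / 3!\<close>: it is a statement about Taylor coefficients of \<omega>.\<close>

definition prim :: "(real \<Rightarrow> 'a::banach) \<Rightarrow> real \<Rightarrow> 'a" where
  "prim f x = integral {0..x} f"

lemma prim_0 [simp]: "prim f 0 = 0"
  by (simp add: prim_def)

lemma prim_has_vector_derivative:
  assumes "continuous_on {0..1} f" "x \<in> {0..1}"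
  shows "(prim f has_vector_derivative f x) (at x within {0..1})"
  unfolding prim_def using integral_has_vector_derivative[OF assms] .

lemma continuous_on_prim [continuous_intros]:
  "continuous_on {0..1} f \<Longrightarrow> continuous_on {0..1} (prim f)"
  unfolding prim_def by (intro indefinite_integral_continuous_1 integrable_continuous_real)

lemma prim_integrable:
  fixes f :: "real \<Rightarrow> 'a::banach"
  shows "continuous_on {0..1} f \<Longrightarrow> x \<le> 1 \<Longrightarrow> f integrable_on {0..x}"
  by (intro integrable_continuous_real) (auto intro: continuous_on_subset[of "{0..1}" f])

lemma prim_cong:
  "(\<And>t. t \<in> {0..1} \<Longrightarrow> f t = g t) \<Longrightarrow> x \<le> 1 \<Longrightarrow> prim f x = prim g x"
  unfolding prim_def by (rule integral_cong) auto

lemma prim_add: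
  assumes "continuous_on {0..1} f" "continuous_on {0..1} g" "x \<le> 1"
  shows "prim (\<lambda>t. f t + g t) x = prim f x + prim g x"
  unfolding prim_def using assms by (intro integral_add prim_integrable)

lemma prim_diff:
  assumes "continuous_on {0..1} f" "continuous_on {0..1} g" "x \<le> 1"
  shows "prim (\<lambda>t. f t - g t) x = prim f x - prim g x"
  unfolding prim_def using assms by (intro integral_diff prim_integrable)

lemma prim_mult_left:
  fixes f :: "real \<Rightarrow> 'a::{real_normed_field,banach}"
  shows "prim (\<lambda>t. c * f t) x = c * prim f x"
  unfolding prim_def by simp

lemma prim_of_real:
  assumes "continuous_on {0..1} f" "x \<le> 1"
  shows "prim (\<lambda>t. of_real (f t) :: 'a::{real_normed_field,banach}) x = of_real (prim f x)"
  unfolding prim_def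
  using integral_linear[OF prim_integrable[OF assms] bounded_linear_of_real] by (simp add: o_def)

lemma prim_of_deriv:
  assumes "\<And>t. t \<in> {0..1} \<Longrightarrow> (u has_vector_derivative v t) (at t within {0..1})" "x \<in> {0..1}"
  shows "u x = u 0 + prim v x"
proof -
  have "(v has_integral (u x - u 0)) {0..x}"
    using assms
    by (intro fundamental_theorem_of_calculus
        has_vector_derivative_within_subset[where S = "{0..1}" and T = "{0..x}"]) auto
  then show ?thesis by (simp add: prim_def integral_unique)
qed

lemma norm_prim_le:
  assumes "continuous_on {0..1} f" "continuous_on {0..1} g" "x \<le> 1"
    "\<And>t. t \<in> {0..x} \<Longrightarrow> norm (f t) \<le> g t"
  shows "norm (prim f x) \<le> prim g x"
  unfolding prim_def using assms by (intro integral_norm_bound_integral prim_integrable)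

lemma prim_le:
  fixes f g :: "real \<Rightarrow> real"
  assumes "continuous_on {0..1} f" "continuous_on {0..1} g" "x \<le> 1"
    "\<And>t. t \<in> {0..x} \<Longrightarrow> f t \<le> g t"
  shows "prim f x \<le> prim g x"
  unfolding prim_def using assms by (intro integral_le prim_integrable)

lemma prim_nonneg:
  fixes f :: "real \<Rightarrow> real"
  assumes "continuous_on {0..1} f" "x \<le> 1" "\<And>t. t \<in> {0..x} \<Longrightarrow> 0 \<le> f t"
  shows "0 \<le> prim f x"
  unfolding prim_def using assms by (intro integral_nonneg prim_integrable)

lemma prim_mono:
  fixes f :: "real \<Rightarrow> real"
  assumes "continuous_on {0..1} f" "0 \<le> x" "x \<le> y" "y \<le> 1" "\<And>t. t \<in> {0..1} \<Longrightarrow> 0 \<le> f t"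
  shows "prim f x \<le> prim f y"
  unfolding prim_def using assms
  by (intro integral_subset_le prim_integrable) auto

lemma prim_power: "prim (\<lambda>t. t ^ n) x = x ^ Suc n / (1 + real n)" if "x \<in> {0..1}"
proof -
  have "((\<lambda>t. t ^ Suc n / (1 + real n)) has_vector_derivative t ^ n) (at t within {0..1})" for t
    unfolding has_real_derivative_iff_has_vector_derivative [symmetric]
    by (rule derivative_eq_intros | simp)+
  from prim_of_deriv[OF this that] show ?thesis by simp
qed

text \<open>The Picard estimate: integrating \<open>t ^ n\<close> contributes
  \<open>x / (n + 1)\<close> at each step, which builds up the factorial, while the monotone factor
  \<open>\<phi>\<close> can be pulled out of the integral at its right end.\<close>

lemma iterated_prim_bound:
  fixes a :: "nat \<Rightarrow> real \<Rightarrow> 'a::banach" and \<phi> :: "real \<Rightarrow> real"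
  assumes cont: "\<And>n. continuous_on {0..1} (a n)" and M: "0 \<le> M"
    and step: "\<And>n x. x \<in> {0..1} \<Longrightarrow> norm (a (Suc n) x) \<le> M * prim (\<lambda>t. norm (a n t)) x"
    and base: "\<And>x. x \<in> {0..1} \<Longrightarrow> norm (a 0 x) \<le> \<phi> x"
    and mono: "\<And>x y. 0 \<le> x \<Longrightarrow> x \<le> y \<Longrightarrow> y \<le> 1 \<Longrightarrow> \<phi> x \<le> \<phi> y"
    and x: "x \<in> {0..1}"
  shows "norm (a n x) \<le> (M * x) ^ n / fact n * \<phi> x"
  using x
proof (induction n arbitrary: x)
  case 0
  then show ?case using base by simp
next
  case (Suc n)
  have "prim (\<lambda>t. norm (a n t)) x \<le> prim (\<lambda>t. (M ^ n / fact n * \<phi> x) * t ^ n) x"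
  proof (rule prim_le)
    fix t assume t: "t \<in> {0..x}"
    have "norm (a n t) \<le> (M * t) ^ n / fact n * \<phi> t"
      using Suc t by auto
    also have "\<dots> \<le> (M * t) ^ n / fact n * \<phi> x"
      using t Suc.prems M by (intro mult_left_mono mono) auto
    finally show "norm (a n t) \<le> (M ^ n / fact n * \<phi> x) * t ^ n"
      by (simp add: power_mult_distrib mult_ac)
  qed (use Suc.prems cont in \<open>auto intro!: continuous_intros\<close>)
  also have "\<dots> = (M ^ n / fact n * \<phi> x) * (x ^ Suc n / (1 + real n))"
    using Suc.prems by (simp only: prim_mult_left prim_power)
  finally have "M * prim (\<lambda>t. norm (a n t)) x \<le> M * ((M ^ n / fact n * \<phi> x) * (x ^ Suc n / (1 + real n)))"
    using M by (rule mult_left_mono)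
  also have "\<dots> = (M * x) ^ Suc n / fact (Suc n) * \<phi> x"
    by (simp add: power_mult_distrib divide_simps)
  finally show ?case using step[OF Suc.prems, of n] by linarith
qed

lemma continuous_on_bound:
  fixes f :: "real \<Rightarrow> 'a::real_normed_vector"
  assumes "continuous_on {0..1} f"
  obtains B where "0 \<le> B" "\<And>x. x \<in> {0..1} \<Longrightarrow> norm (f x) \<le> B"
proof -
  have "bounded (f ` {0..1})"
    by (intro compact_imp_bounded compact_continuous_image assms compact_Icc)
  then obtain C where "\<forall>x\<in>{0..1}. norm (f x) \<le> C"
    unfolding bounded_iff by auto
  then have "norm (f x) \<le> \<bar>C\<bar>" if "x \<in> {0..1}" for x
    using that by force
  then show ?thesis by (rule that[of "\<bar>C\<bar>", rotated]) auto
qed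

text \<open>Gronwall's lemma in homogeneous form: the iterated bound applied to the constant
  sequence \<open>f\<close> tends to \<open>0\<close>.\<close>

lemma prim_bound_imp_zero:
  fixes f :: "real \<Rightarrow> 'a::banach"
  assumes cont: "continuous_on {0..1} f" and M: "0 \<le> M"
    and step: "\<And>x. x \<in> {0..1} \<Longrightarrow> norm (f x) \<le> M * prim (\<lambda>t. norm (f t)) x"
    and x: "x \<in> {0..1}"
  shows "f x = 0"
proof -
  obtain C where "0 \<le> C" and C: "\<And>x. x \<in> {0..1} \<Longrightarrow> norm (f x) \<le> C"
    using continuous_on_bound[OF cont] by blast
  have "norm (f x) \<le> (M * x) ^ n / fact n * C" for n
    using iterated_prim_bound[of "\<lambda>_. f" M "\<lambda>_. C", OF cont M step C _ x] by simp
  moreover have "(\<lambda>n. (M * x) ^ n / fact n * C) \<longlonglongrightarrow> 0 * C"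
    using summable_LIMSEQ_zero[OF summable_exp[of "M * x"]]
    by (intro tendsto_mult tendsto_const) (simp add: divide_inverse mult.commute)
  ultimately have "norm (f x) \<le> 0 * C"
    by (intro LIMSEQ_le_const) auto
  then show ?thesis by simp
qed

text \<open>Domination by an exponential series, uniformly in \<open>x\<close>, makes
  \<open>ser a h\<close> converge for every \<open>h\<close>. The coefficients are real and
  \<open>h\<close> lies in any real Banach field, so the same series serves real and complex
  spectral parameters.\<close>

definition entire_coeffs :: "(nat \<Rightarrow> real \<Rightarrow> real) \<Rightarrow> bool" where
  "entire_coeffs a \<longleftrightarrow> (\<forall>n. continuous_on {0..1} (a n)) \<and>
     (\<exists>C M. 0 \<le> C \<and> 0 \<le> M \<and> (\<forall>n. \<forall>x\<in>{0..1}. \<bar>a n x\<bar> \<le> C * (M ^ n / fact n)))"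

definition ser :: "(nat \<Rightarrow> real \<Rightarrow> real) \<Rightarrow> 'a::{real_normed_field,banach} \<Rightarrow> real \<Rightarrow> 'a" where
  "ser a h x = (\<Sum>n. of_real (a n x) * h ^ n)"

lemma entire_coeffsI:
  assumes "\<And>n. continuous_on {0..1} (a n)" "0 \<le> C" "0 \<le> M"
    "\<And>n x. x \<in> {0..1} \<Longrightarrow> \<bar>a n x\<bar> \<le> C * (M ^ n / fact n)"
  shows "entire_coeffs a"
  using assms unfolding entire_coeffs_def by blast

lemma entire_coeffs_continuous: "entire_coeffs a \<Longrightarrow> continuous_on {0..1} (a n)"
  unfolding entire_coeffs_def by blast

lemma summable_exp_bound: "summable (\<lambda>n. C * (M ^ n / fact n) * r ^ n :: real)"
proof -
  have "summable (\<lambda>n. C * (inverse (fact n) * (M * r) ^ n))"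
    by (intro summable_mult summable_exp)
  then show ?thesis by (simp add: field_simps power_mult_distrib)
qed

lemma ser_uniform_limit:
  fixes h :: "'a::{real_normed_field,banach}"
  assumes "entire_coeffs a"
  shows "uniform_limit {0..1} (\<lambda>N x. \<Sum>n<N. of_real (a n x) * h ^ n) (ser a h) sequentially"
proof -
  obtain C M where "0 \<le> C" "0 \<le> M" and CM: "\<And>n x. x \<in> {0..1} \<Longrightarrow> \<bar>a n x\<bar> \<le> C * (M ^ n / fact n)"
    using assms unfolding entire_coeffs_def by blast
  have bd: "norm (of_real (a n x) * h ^ n) \<le> C * (M ^ n / fact n) * norm h ^ n" if "x \<in> {0..1}" for n x
    unfolding norm_mult norm_power norm_of_real using CM[OF that]
    by (rule mult_right_mono) simp
  show ?thesis
    unfolding ser_def by (rule Weierstrass_m_test[OF bd summable_exp_bound])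
qed

lemma ser_sums:
  fixes h :: "'a::{real_normed_field,banach}"
  assumes "entire_coeffs a" "x \<in> {0..1}"
  shows "(\<lambda>n. of_real (a n x) * h ^ n) sums ser a h x"
  using tendsto_uniform_limitI[OF ser_uniform_limit[OF assms(1)] assms(2)] by (simp add: sums_def)

lemma continuous_on_ser [continuous_intros]:
  fixes h :: "'a::{real_normed_field,banach}"
  assumes "entire_coeffs a"
  shows "continuous_on {0..1} (ser a h)"
  by (rule uniform_limit_theorem[OF _ ser_uniform_limit[OF assms]])
    (auto intro!: always_eventually continuous_intros entire_coeffs_continuous[OF assms])

lemma entire_coeffs_prim_mult:
  assumes "entire_coeffs a" and r: "continuous_on {0..1} r"
  shows "entire_coeffs (\<lambda>n. prim (\<lambda>t. r t * a n t))"
proof -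
  obtain C M where CM: "0 \<le> C" "0 \<le> M" "\<And>n x. x \<in> {0..1} \<Longrightarrow> \<bar>a n x\<bar> \<le> C * (M ^ n / fact n)"
    using assms unfolding entire_coeffs_def by blast
  obtain B where B: "0 \<le> B" "\<And>x. x \<in> {0..1} \<Longrightarrow> norm (r x) \<le> B"
    using continuous_on_bound[OF r] by blast
  have cont: "continuous_on {0..1} (\<lambda>t. r t * a n t)" for n
    by (intro continuous_intros r entire_coeffs_continuous[OF assms(1)])
  show ?thesis
  proof (rule entire_coeffsI)
    fix n :: nat and x :: real assume x: "x \<in> {0..1}"
    have "norm (prim (\<lambda>t. r t * a n t) x) \<le> prim (\<lambda>t. B * (C * (M ^ n / fact n)) * t ^ 0) x"
      using x B CM by (intro norm_prim_le cont continuous_intros)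
        (auto simp: abs_mult simp del: times_divide_eq_right intro!: mult_mono)
    also have "\<dots> = B * (C * (M ^ n / fact n)) * x"
      using x by (simp only: prim_mult_left prim_power) simp
    also have "\<dots> \<le> B * (C * (M ^ n / fact n))"
      using x B CM by (intro mult_right_le_one_le) auto
    finally show "\<bar>prim (\<lambda>t. r t * a n t) x\<bar> \<le> B * C * (M ^ n / fact n)" by simp
  qed (use B CM cont in \<open>auto intro!: continuous_on_prim\<close>)
qed

text \<open>Uniform convergence on \<open>{0..1}\<close> permits integration term by term.
  Differential equations for series are therefore handled in integral form, and no series is
  differentiated in \<open>x\<close>.\<close>

lemma ser_prim_mult:
  fixes h :: "'a::{real_normed_field,banach}"
  assumes a: "entire_coeffs a" and r: "continuous_on {0..1} r" and x: "x \<in> {0..1}"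
  shows "prim (\<lambda>t. of_real (r t) * ser a h t) x = ser (\<lambda>n. prim (\<lambda>t. r t * a n t)) h x"
proof -
  let ?p = "\<lambda>N t. \<Sum>n<N. of_real (a n t) * h ^ n"
  have ra: "continuous_on {0..1} (\<lambda>t. r t * a n t)" for n
    by (intro continuous_intros r entire_coeffs_continuous[OF a])
  have eq: "(\<Sum>n<N. of_real (prim (\<lambda>t. r t * a n t) x) * h ^ n)
      = prim (\<lambda>t. of_real (r t) * ?p N t) x" for N
  proof -
    have "integral {0..x} (\<lambda>t. \<Sum>n<N. h ^ n * of_real (r t * a n t))
        = (\<Sum>n<N. integral {0..x} (\<lambda>t. h ^ n * of_real (r t * a n t)))"
      using x by (intro integral_sum prim_integrable continuous_intros ra) auto
    also have "\<dots> = (\<Sum>n<N. h ^ n * of_real (prim (\<lambda>t. r t * a n t) x))"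
    proof (intro sum.cong refl)
      fix n
      have "integral {0..x} (\<lambda>t. of_real (r t * a n t) :: 'a) = of_real (prim (\<lambda>t. r t * a n t) x)"
        using prim_of_real[OF ra, of x] x unfolding prim_def by simp
      then show "integral {0..x} (\<lambda>t. h ^ n * of_real (r t * a n t))
          = h ^ n * of_real (prim (\<lambda>t. r t * a n t) x)" by simp
    qed
    finally show ?thesis by (simp add: prim_def sum_distrib_left mult_ac)
  qed
  obtain B where B: "0 \<le> B" "\<And>x. x \<in> {0..1} \<Longrightarrow> norm (r x) \<le> B"
    using continuous_on_bound[OF r] by blast
  have "uniform_limit {0..x} (\<lambda>N t. of_real (r t) * ?p N t) (\<lambda>t. of_real (r t) * ser a h t) sequentially"
  proof (rule uniform_limitI)
    fix e :: real assume e: "0 < e"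
    have "\<forall>\<^sub>F N in sequentially. \<forall>t\<in>{0..1}. dist (?p N t) (ser a h t) < e / (B + 1)"
      using ser_uniform_limit[OF a, of h] e B by (intro uniform_limitD) auto
    then show "\<forall>\<^sub>F N in sequentially. \<forall>t\<in>{0..x}. dist (of_real (r t) * ?p N t) (of_real (r t) * ser a h t) < e"
    proof eventually_elim
      case (elim N)
      show ?case
      proof
        fix t assume t: "t \<in> {0..x}"
        have d: "dist (?p N t) (ser a h t) < e / (B + 1)" using elim t x by auto
        have "dist (of_real (r t) * ?p N t) (of_real (r t) * ser a h t)
            = \<bar>r t\<bar> * dist (?p N t) (ser a h t)"
          by (simp add: dist_norm norm_mult flip: right_diff_distrib)
        also have "\<dots> \<le> (B + 1) * dist (?p N t) (ser a h t)"
          using B(2)[of t] t x by (intro mult_right_mono) auto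
        also have "\<dots> < e" using d B(1) by (simp add: field_simps)
        finally show "dist (of_real (r t) * ?p N t) (of_real (r t) * ser a h t) < e" .
      qed
    qed
  qed
  moreover have cp: "continuous_on {0..x} (\<lambda>t. of_real (r t) * ?p N t)" for N
    using x by (intro continuous_on_subset[of "{0..1}" _ "{0..x}"] continuous_intros r entire_coeffs_continuous[OF a]) auto
  ultimately obtain I J where IJ: "\<And>N. ((\<lambda>t. of_real (r t) * ?p N t) has_integral I N) {0..x}"
      "((\<lambda>t. of_real (r t) * ser a h t) has_integral J) {0..x}" "I \<longlonglongrightarrow> J"
    by (elim uniform_limit_integral[OF _ _ sequentially_bot]) blast+
  have "I = (\<lambda>N. \<Sum>n<N. of_real (prim (\<lambda>t. r t * a n t) x) * h ^ n)"
    unfolding eq unfolding prim_def using integral_unique[OF IJ(1)] by (intro ext) simp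
  with IJ(3) have "(\<lambda>n. of_real (prim (\<lambda>t. r t * a n t) x) * h ^ n) sums J"
    by (simp add: sums_def)
  moreover have "prim (\<lambda>t. of_real (r t) * ser a h t) x = J"
    using IJ(2) by (simp add: prim_def integral_unique)
  ultimately show ?thesis by (simp add: ser_def sums_iff)
qed

lemma ser_Suc:
  fixes h :: "'a::{real_normed_field,banach}"
  assumes "entire_coeffs a" "x \<in> {0..1}"
  shows "ser a h x = of_real (a 0 x) + (\<Sum>n. of_real (a (Suc n) x) * h ^ Suc n)"
  using suminf_split_initial_segment[OF sums_summable[OF ser_sums[OF assms, where h = h]], of 1]
  by (simp add: ser_def)

text \<open>\<open>sol q \<mu> g u v\<close> is the equation \<open>- u'' + (q - \<mu>) u = g\<close> on \<open>[0,1]\<close> with \<open>v = u'\<close>.\<close>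

definition sol :: "(real \<Rightarrow> real) \<Rightarrow> real \<Rightarrow> (real \<Rightarrow> real) \<Rightarrow> (real \<Rightarrow> real) \<Rightarrow> (real \<Rightarrow> real) \<Rightarrow> bool" where
  "sol q \<mu> g u v \<longleftrightarrow>
     (\<forall>x\<in>{0..1}. (u has_vector_derivative v x) (at x within {0..1}) \<and>
        (v has_vector_derivative (q x - \<mu>) * u x - g x) (at x within {0..1}))"

section \<open>Existence, uniqueness and bounds for the inhomogeneous equation\<close>

lemma has_vector_derivative_imp_continuous_on:
  "(\<And>x. x \<in> S \<Longrightarrow> (f has_vector_derivative f' x) (at x within S)) \<Longrightarrow> continuous_on S f"
  by (auto simp: continuous_on_eq_continuous_within intro: has_vector_derivative_continuous)

lemma sol_continuous:
  assumes "sol q \<mu> g u v"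
  shows "continuous_on {0..1} u" "continuous_on {0..1} v"
  using assms unfolding sol_def by (auto intro: has_vector_derivative_imp_continuous_on)

lemma sol_prim:
  assumes "sol q \<mu> g u v" "x \<in> {0..1}"
  shows "u x = u 0 + prim v x" "v x = v 0 + prim (\<lambda>t. (q t - \<mu>) * u t - g t) x"
  by (rule prim_of_deriv; use assms in \<open>simp add: sol_def\<close>)+

lemma sol_lincomb:
  assumes "sol q \<mu> g u v" "sol q \<mu> g' u' v'"
  shows "sol q \<mu> (\<lambda>x. g x + r * g' x) (\<lambda>x. u x + r * u' x) (\<lambda>x. v x + r * v' x)"
  unfolding sol_def
proof (intro ballI conjI)
  fix x :: real assume x: "x \<in> {0..1}"
  show "((\<lambda>x. u x + r * u' x) has_vector_derivative v x + r * v' x) (at x within {0..1})"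
    using assms x by (intro has_vector_derivative_add has_vector_derivative_mult_right)
      (auto simp: sol_def)
  have "((\<lambda>x. v x + r * v' x) has_vector_derivative
      ((q x - \<mu>) * u x - g x) + r * ((q x - \<mu>) * u' x - g' x)) (at x within {0..1})"
    using assms x by (intro has_vector_derivative_add has_vector_derivative_mult_right)
      (auto simp: sol_def)
  then show "((\<lambda>x. v x + r * v' x) has_vector_derivative
      (q x - \<mu>) * (u x + r * u' x) - (g x + r * g' x)) (at x within {0..1})"
    by (simp add: algebra_simps)
qed

lemma sol_shift:
  assumes "sol q \<mu> g u v"
  shows "sol q \<nu> (\<lambda>x. g x + (\<mu> - \<nu>) * u x) u v"
  using assms unfolding sol_def by (simp add: algebra_simps)

text \<open>The sum of the two norms satisfies a Gronwall inequality. The values lie in a general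
  field because the lemma is applied to real solutions and to the complex function
  \<open>y\<close>.\<close>

lemma first_order_system_unique:
  fixes u v :: "real \<Rightarrow> 'a::{real_normed_field,banach}"
  assumes cont: "continuous_on {0..1} u" "continuous_on {0..1} v" "continuous_on {0..1} p"
    and u: "\<And>x. x \<in> {0..1} \<Longrightarrow> u x = prim v x"
    and v: "\<And>x. x \<in> {0..1} \<Longrightarrow> v x = prim (\<lambda>t. p t * u t) x"
    and x: "x \<in> {0..1}"
  shows "u x = 0" "v x = 0"
proof -
  define N where "N t = norm (u t) + norm (v t)" for t
  obtain P where P: "0 \<le> P" "\<And>x. x \<in> {0..1} \<Longrightarrow> norm (p x) \<le> P"
    using continuous_on_bound[OF cont(3)] by blast
  have cN: "continuous_on {0..1} N"
    unfolding N_def by (intro continuous_intros cont)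
  have "N x = 0"
  proof (rule prim_bound_imp_zero[OF cN _ _ x])
    show "0 \<le> 1 + P" using P by simp
    fix y :: real assume y: "y \<in> {0..1}"
    have "norm (u y) \<le> prim N y"
      unfolding u[OF y] using y by (intro norm_prim_le cont cN) (auto simp: N_def)
    moreover have "norm (v y) \<le> prim (\<lambda>t. P * N t) y"
      unfolding v[OF y] using y P
      by (intro norm_prim_le continuous_intros cont cN)
        (auto simp: N_def norm_mult intro!: mult_mono)
    ultimately have "N y \<le> (1 + P) * prim N y"
      by (simp add: N_def[of y] prim_mult_left algebra_simps)
    moreover have "(\<lambda>t. norm (N t)) = N" by (simp add: N_def fun_eq_iff)
    ultimately show "norm (N y) \<le> (1 + P) * prim (\<lambda>t. norm (N t)) y"
      by (simp add: N_def)
  qed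
  then show "u x = 0" "v x = 0" by (simp_all add: N_def add_nonneg_eq_0_iff)
qed

lemma sol_zero_unique:
  assumes q: "continuous_on {0..1} q" and s: "sol q \<mu> (\<lambda>x. 0) u v" and "u 0 = 0" "v 0 = 0" "x \<in> {0..1}"
  shows "u x = 0" "v x = 0"
proof -
  have c: "continuous_on {0..1} (\<lambda>t. q t - \<mu>)" by (intro continuous_intros q)
  show "u x = 0" "v x = 0"
    using first_order_system_unique[OF sol_continuous[OF s] c, of x] sol_prim[OF s] assms by auto
qed

lemma sol_unique:
  assumes q: "continuous_on {0..1} q" and "sol q \<mu> g u v" "sol q \<mu> g u' v'"
    and "u 0 = u' 0" "v 0 = v' 0" "x \<in> {0..1}"
  shows "u x = u' x" "v x = v' x"
proof -
  have "sol q \<mu> (\<lambda>x. 0) (\<lambda>x. u x + (-1) * u' x) (\<lambda>x. v x + (-1) * v' x)"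
    using sol_lincomb[OF assms(2,3), of "-1"] by simp
  from sol_zero_unique[OF q this, of x] show "u x = u' x" "v x = v' x" using assms by auto
qed

text \<open>The Picard series is summed with explicit bounds. What matters is that \<open>M\<close>
  does not depend on \<open>g\<close> and that \<open>g\<close> enters only through the integral of
  its absolute value: later the sources converge merely in mean square.\<close>

lemma sol_exists_bounded:
  assumes q: "continuous_on {0..1} q"
  obtains M where "0 \<le> M"
    "\<And>g. continuous_on {0..1} g \<Longrightarrow> \<exists>u v. sol q \<mu> g u v \<and> u 0 = 0 \<and> v 0 = 0 \<and>
       (\<forall>x\<in>{0..1}. \<bar>u x\<bar> \<le> M * prim (\<lambda>t. \<bar>g t\<bar>) x \<and> \<bar>v x\<bar> \<le> M * prim (\<lambda>t. \<bar>g t\<bar>) x)"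
proof -
  have cQ: "continuous_on {0..1} (\<lambda>t. q t - \<mu>)" by (intro continuous_intros q)
  obtain P where P: "0 \<le> P" "\<And>x. x \<in> {0..1} \<Longrightarrow> norm (q x - \<mu>) \<le> P"
    using continuous_on_bound[OF cQ] by blast
  have "\<exists>u v. sol q \<mu> g u v \<and> u 0 = 0 \<and> v 0 = 0 \<and>
       (\<forall>x\<in>{0..1}. \<bar>u x\<bar> \<le> (exp P * (P + 1) + 1) * prim (\<lambda>t. \<bar>g t\<bar>) x \<and> \<bar>v x\<bar> \<le> (exp P * (P + 1) + 1) * prim (\<lambda>t. \<bar>g t\<bar>) x)"
    if g: "continuous_on {0..1} g" for g
  proof -
    define \<phi> where "\<phi> = prim (\<lambda>t. \<bar>g t\<bar>)"
    have cag: "continuous_on {0..1} (\<lambda>t. \<bar>g t\<bar>)" by (intro continuous_intros g)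
    have \<phi>mono: "\<phi> x \<le> \<phi> y" if "0 \<le> x" "x \<le> y" "y \<le> 1" for x y
      unfolding \<phi>_def using that by (intro prim_mono cag) auto
    have \<phi>0: "0 \<le> \<phi> x" if "x \<in> {0..1}" for x using \<phi>mono[of 0 x] that by (simp add: \<phi>_def)
    have prim\<phi>: "prim \<phi> x \<le> \<phi> x" if x: "x \<in> {0..1}" for x
    proof -
      have "prim \<phi> x \<le> prim (\<lambda>t. \<phi> x * t ^ 0) x"
        using x \<phi>mono by (intro prim_le continuous_intros) (auto simp: \<phi>_def intro!: continuous_intros cag)
      also have "\<dots> = \<phi> x * x" using x by (simp only: prim_mult_left prim_power) simp
      also have "\<dots> \<le> \<phi> x" using x \<phi>0[OF x] by (simp add: mult_left_le)
      finally show ?thesis .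
    qed
    \<comment> \<open>The Neumann series of \<open>u'' = (q - \<mu>) * u - g\<close>: the start is
      minus the double integral of \<open>g\<close>, and every further term is the double integral
      of \<open>q - \<mu>\<close> times its predecessor.\<close>
    define a where "a = rec_nat (\<lambda>x. - prim (prim g) x) (\<lambda>n an. prim (prim (\<lambda>t. (q t - \<mu>) * an t)))"
    have a0: "a 0 = (\<lambda>x. - prim (prim g) x)" and aS: "a (Suc n) = prim (prim (\<lambda>t. (q t - \<mu>) * a n t))" for n
      by (simp_all add: a_def)
    have ca: "continuous_on {0..1} (a n)" for n
      by (induction n) (auto simp: a0 aS intro!: continuous_intros g cQ)
    have step: "norm (a (Suc n) x) \<le> P * prim (\<lambda>t. norm (a n t)) x" if x: "x \<in> {0..1}" for n x
    proof -
      let ?\<psi> = "prim (\<lambda>t. norm (a n t))"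
      have 1: "norm (prim (\<lambda>t. (q t - \<mu>) * a n t) y) \<le> prim (\<lambda>t. P * norm (a n t)) y" if "y \<in> {0..1}" for y
        using that P by (intro norm_prim_le continuous_intros cQ ca) (auto simp: abs_mult intro!: mult_mono)
      have "norm (a (Suc n) x) \<le> prim (\<lambda>t. P * ?\<psi> x * t ^ 0) x"
        unfolding aS
      proof (rule norm_prim_le)
        fix t assume t: "t \<in> {0..x}"
        have "?\<psi> t \<le> ?\<psi> x" using t x by (intro prim_mono continuous_intros ca) auto
        then show "norm (prim (\<lambda>t. (q t - \<mu>) * a n t) t) \<le> P * ?\<psi> x * t ^ 0"
          using 1[of t] t x P by (simp add: prim_mult_left) (meson mult_left_mono order_trans)
      qed (use x in \<open>auto intro!: continuous_intros cQ ca\<close>)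
      also have "\<dots> = P * ?\<psi> x * x" using x by (simp only: prim_mult_left prim_power) simp
      also have "\<dots> \<le> P * ?\<psi> x"
      proof -
        have "0 \<le> ?\<psi> x" using x by (intro prim_nonneg continuous_intros ca) auto
        then show ?thesis using x P by (intro mult_left_le) auto
      qed
      finally show ?thesis .
    qed
    have base: "norm (a 0 x) \<le> \<phi> x" if x: "x \<in> {0..1}" for x
    proof -
      have "norm (prim (prim g) x) \<le> prim \<phi> x"
        using x unfolding \<phi>_def
        by (intro norm_prim_le continuous_intros g) (auto intro!: norm_prim_le continuous_intros g)
      with prim\<phi>[OF x] show ?thesis by (simp add: a0)
    qed
    have bnd: "norm (a n x) \<le> (P * x) ^ n / fact n * \<phi> x" if "x \<in> {0..1}" for n x
      by (rule iterated_prim_bound[OF ca P(1) step base \<phi>mono that])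
    have bnd': "norm (a n x) \<le> \<phi> x * (P ^ n / fact n)" if x: "x \<in> {0..1}" for n x
    proof -
      have "(P * x) ^ n \<le> P ^ n" using x P by (intro power_mono) (auto simp: mult_left_le)
      then have "(P * x) ^ n / fact n * \<phi> x \<le> P ^ n / fact n * \<phi> x"
        using \<phi>0[OF x] by (intro mult_right_mono divide_right_mono) auto
      then show ?thesis using bnd[OF x, of n] by (simp add: mult_ac)
    qed
    have ec: "entire_coeffs a"
    proof (rule entire_coeffsI)
      fix n and x :: real assume x: "x \<in> {0..1}"
      have "\<phi> x * (P ^ n / fact n) \<le> \<phi> 1 * (P ^ n / fact n)"
        using x P \<phi>mono[of x 1] by (intro mult_right_mono) auto
      then show "\<bar>a n x\<bar> \<le> \<phi> 1 * (P ^ n / fact n)" using bnd'[OF x, of n] by simp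
    qed (use ca \<phi>0[of 1] P in auto)
    \<comment> \<open>The value \<open>1\<close> of the series variable simply adds up the Picard
      terms.\<close>
    define u :: "real \<Rightarrow> real" where "u = ser a 1"
    define v where "v = prim (\<lambda>t. (q t - \<mu>) * u t - g t)"
    have cu: "continuous_on {0..1} u" unfolding u_def by (intro continuous_intros ec)
    have cw: "continuous_on {0..1} (\<lambda>t. (q t - \<mu>) * u t - g t)" by (intro continuous_intros cQ cu g)
    have ec2: "entire_coeffs (\<lambda>n. prim (\<lambda>t. (q t - \<mu>) * a n t))"
      by (rule entire_coeffs_prim_mult[OF ec cQ])
    have u: "u x = prim v x" if x: "x \<in> {0..1}" for x
    proof -
      have 1: "prim (\<lambda>t. (q t - \<mu>) * u t) y = ser (\<lambda>n. prim (\<lambda>t. (q t - \<mu>) * a n t)) 1 y" if "y \<in> {0..1}" for y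
        using ser_prim_mult[OF ec cQ that, where h = "1::real"] by (simp add: u_def)
      have 2: "prim (prim (\<lambda>t. (q t - \<mu>) * u t)) x = ser (\<lambda>n. a (Suc n)) 1 x"
      proof -
        have "prim (prim (\<lambda>t. (q t - \<mu>) * u t)) x = prim (ser (\<lambda>n. prim (\<lambda>t. (q t - \<mu>) * a n t)) 1) x"
          using x by (intro prim_cong 1) auto
        with ser_prim_mult[OF ec2 continuous_on_const[of _ 1] x, where h = "1::real"]
        show ?thesis by (simp add: aS)
      qed
      have "prim v x = prim (prim (\<lambda>t. (q t - \<mu>) * u t)) x - prim (prim g) x"
      proof -
        have "prim v x = prim (\<lambda>y. prim (\<lambda>t. (q t - \<mu>) * u t) y - prim g y) x"
          unfolding v_def using x by (intro prim_cong prim_diff continuous_intros cQ cu g) auto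
        also have "\<dots> = prim (prim (\<lambda>t. (q t - \<mu>) * u t)) x - prim (prim g) x"
          using x by (intro prim_diff continuous_intros cQ cu g) auto
        finally show ?thesis .
      qed
      also have "\<dots> = u x"
        unfolding 2 using ser_Suc[OF ec x, where h = "1::real"] by (simp add: u_def ser_def a0)
      finally show ?thesis by simp
    qed
    have cv: "continuous_on {0..1} v" unfolding v_def by (intro continuous_intros cQ cu g)
    have dv: "(v has_vector_derivative (q x - \<mu>) * u x - g x) (at x within {0..1})" if "x \<in> {0..1}" for x
      unfolding v_def by (rule prim_has_vector_derivative[OF cw that])
    have du: "(u has_vector_derivative v x) (at x within {0..1})" if x: "x \<in> {0..1}" for x
      using prim_has_vector_derivative[OF cv x]
      by (rule has_vector_derivative_transform[rotated 2]) (use x u in auto)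
    have ub: "\<bar>u x\<bar> \<le> exp P * \<phi> x" if x: "x \<in> {0..1}" for x
    proof -
      have s: "(\<lambda>n. P ^ n /\<^sub>R fact n * \<phi> x) sums (exp P * \<phi> x)"
        by (intro sums_mult2 exp_converges)
      have "norm (\<Sum>n. a n x) \<le> (\<Sum>n. P ^ n /\<^sub>R fact n * \<phi> x)"
        using bnd'[OF x] s by (intro norm_suminf_le) (auto simp: sums_iff field_simps)
      then show ?thesis using s by (simp add: u_def ser_def sums_iff)
    qed
    have vb: "\<bar>v x\<bar> \<le> (P * exp P + 1) * \<phi> x" if x: "x \<in> {0..1}" for x
    proof -
      have c\<phi>: "continuous_on {0..1} \<phi>" unfolding \<phi>_def by (intro continuous_intros g)
      have "norm (v x) \<le> prim (\<lambda>t. P * exp P * \<phi> t + \<bar>g t\<bar>) x"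
        unfolding v_def
      proof (rule norm_prim_le[OF cw])
        fix t assume t: "t \<in> {0..x}"
        have "\<bar>q t - \<mu>\<bar> * \<bar>u t\<bar> \<le> P * (exp P * \<phi> t)"
          using t x P ub[of t] by (intro mult_mono) auto
        then show "norm ((q t - \<mu>) * u t - g t) \<le> P * exp P * \<phi> t + \<bar>g t\<bar>"
          using abs_triangle_ineq4[of "(q t - \<mu>) * u t" "g t"] by (simp add: abs_mult mult.assoc)
      qed (use x in \<open>auto intro!: continuous_intros g c\<phi>\<close>)
      also have "\<dots> = P * exp P * prim \<phi> x + \<phi> x"
        using x by (subst prim_add) (auto intro!: continuous_intros g c\<phi> simp: prim_mult_left \<phi>_def)
      also have "\<dots> \<le> (P * exp P + 1) * \<phi> x"
        using prim\<phi>[OF x] P by (simp add: distrib_right mult_left_mono)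
      finally show ?thesis by simp
    qed
    have "sol q \<mu> g u v" unfolding sol_def using du dv by blast
    moreover have "u 0 = 0" "v 0 = 0" using u[of 0] by (simp_all add: v_def)
    moreover have "\<bar>u x\<bar> \<le> (exp P * (P + 1) + 1) * \<phi> x \<and> \<bar>v x\<bar> \<le> (exp P * (P + 1) + 1) * \<phi> x" if x: "x \<in> {0..1}" for x
    proof -
      have "exp P * \<phi> x \<le> (exp P * (P + 1) + 1) * \<phi> x" "(P * exp P + 1) * \<phi> x \<le> (exp P * (P + 1) + 1) * \<phi> x"
        using P \<phi>0[OF x] by (auto intro!: mult_right_mono simp: algebra_simps)
      then show ?thesis using ub[OF x] vb[OF x] by linarith
    qed
    ultimately show ?thesis unfolding \<phi>_def by blast
  qed
  then show ?thesis using P by (intro that[of "exp P * (P + 1) + 1"]) auto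
qed

lemma sol_bound:
  assumes q: "continuous_on {0..1} q"
  obtains M where "0 \<le> M"
    "\<And>g u v x. sol q \<mu> g u v \<Longrightarrow> continuous_on {0..1} g \<Longrightarrow> u 0 = 0 \<Longrightarrow> v 0 = 0 \<Longrightarrow> x \<in> {0..1} \<Longrightarrow>
       \<bar>u x\<bar> \<le> M * prim (\<lambda>t. \<bar>g t\<bar>) x \<and> \<bar>v x\<bar> \<le> M * prim (\<lambda>t. \<bar>g t\<bar>) x"
proof -
  obtain M where M: "0 \<le> M" and ex:
    "\<And>g. continuous_on {0..1} g \<Longrightarrow> \<exists>u v. sol q \<mu> g u v \<and> u 0 = 0 \<and> v 0 = 0 \<and>
       (\<forall>x\<in>{0..1}. \<bar>u x\<bar> \<le> M * prim (\<lambda>t. \<bar>g t\<bar>) x \<and> \<bar>v x\<bar> \<le> M * prim (\<lambda>t. \<bar>g t\<bar>) x)"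
    using sol_exists_bounded[OF q] by blast
  show ?thesis
  proof (rule that[OF M])
    fix g u v and x :: real
    assume *: "sol q \<mu> g u v" "continuous_on {0..1} g" "u 0 = 0" "v 0 = 0" "x \<in> {0..1}"
    obtain u' v' where **: "sol q \<mu> g u' v'" "u' 0 = 0" "v' 0 = 0"
       "\<forall>x\<in>{0..1}. \<bar>u' x\<bar> \<le> M * prim (\<lambda>t. \<bar>g t\<bar>) x \<and> \<bar>v' x\<bar> \<le> M * prim (\<lambda>t. \<bar>g t\<bar>) x"
      using ex[OF *(2)] by blast
    then show "\<bar>u x\<bar> \<le> M * prim (\<lambda>t. \<bar>g t\<bar>) x \<and> \<bar>v x\<bar> \<le> M * prim (\<lambda>t. \<bar>g t\<bar>) x"
      using sol_unique[OF q *(1) **(1) _ _ *(5)] * by auto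
  qed
qed

text \<open>Splitting off the linear function with the prescribed initial data reduces the problem
  to zero initial data.\<close>

lemma sol_exists:
  assumes q: "continuous_on {0..1} q" and g: "continuous_on {0..1} g"
  shows "\<exists>u v. sol q \<mu> g u v \<and> u 0 = \<alpha> \<and> v 0 = \<gamma>"
proof -
  let ?l = "\<lambda>x. \<alpha> + \<gamma> * x :: real"
  have c: "continuous_on {0..1} (\<lambda>x. g x - (q x - \<mu>) * ?l x)" by (intro continuous_intros q g)
  obtain M where
    "\<And>g. continuous_on {0..1} g \<Longrightarrow> \<exists>u v. sol q \<mu> g u v \<and> u 0 = 0 \<and> v 0 = 0 \<and>
       (\<forall>x\<in>{0..1}. \<bar>u x\<bar> \<le> M * prim (\<lambda>t. \<bar>g t\<bar>) x \<and> \<bar>v x\<bar> \<le> M * prim (\<lambda>t. \<bar>g t\<bar>) x)"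
    using sol_exists_bounded[OF q] by blast
  from this[OF c] obtain u v
    where uv: "sol q \<mu> (\<lambda>x. g x - (q x - \<mu>) * ?l x) u v" "u 0 = 0" "v 0 = 0"
    by blast
  have l: "sol q \<mu> (\<lambda>x. (q x - \<mu>) * ?l x) ?l (\<lambda>x. \<gamma>)"
    unfolding sol_def by (auto intro!: derivative_eq_intros)
  show ?thesis
    using sol_lincomb[OF uv(1) l, of 1] uv(2,3)
    by (intro exI[of _ "\<lambda>x. u x + 1 * ?l x"] exI[of _ "\<lambda>x. v x + 1 * \<gamma>"]) simp
qed

text \<open>Each member of the chain is bounded by the integral of its predecessor, which is the
  hypothesis of the Picard estimate.\<close>

lemma sol_chain_entire:
  assumes q: "continuous_on {0..1} q" and g: "continuous_on {0..1} g"
    and s0: "sol q \<mu> g (a 0) (b 0)"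
    and sS: "\<And>n. sol q \<mu> (a n) (a (Suc n)) (b (Suc n))"
    and z: "\<And>n. a (Suc n) 0 = 0" "\<And>n. b (Suc n) 0 = 0"
  shows "entire_coeffs a" "entire_coeffs b"
proof -
  obtain M where M: "0 \<le> M" and bd:
    "\<And>g u v x. sol q \<mu> g u v \<Longrightarrow> continuous_on {0..1} g \<Longrightarrow> u 0 = 0 \<Longrightarrow> v 0 = 0 \<Longrightarrow> x \<in> {0..1} \<Longrightarrow>
       \<bar>u x\<bar> \<le> M * prim (\<lambda>t. \<bar>g t\<bar>) x \<and> \<bar>v x\<bar> \<le> M * prim (\<lambda>t. \<bar>g t\<bar>) x"
    using sol_bound[OF q] by blast
  have ca: "continuous_on {0..1} (a n)" for n
    by (cases n) (use sol_continuous(1)[OF s0] sol_continuous(1)[OF sS] in auto)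
  have cb: "continuous_on {0..1} (b n)" for n
    by (cases n) (use sol_continuous(2)[OF s0] sol_continuous(2)[OF sS] in auto)
  have bS: "\<bar>a (Suc n) x\<bar> \<le> M * prim (\<lambda>t. \<bar>a n t\<bar>) x" "\<bar>b (Suc n) x\<bar> \<le> M * prim (\<lambda>t. \<bar>a n t\<bar>) x"
    if "x \<in> {0..1}" for n x
    using bd[OF sS ca z that] by auto
  obtain A where A: "0 \<le> A" "\<And>x. x \<in> {0..1} \<Longrightarrow> norm (a 0 x) \<le> A"
    using continuous_on_bound[OF ca] by blast
  obtain B where B: "0 \<le> B" "\<And>x. x \<in> {0..1} \<Longrightarrow> norm (b 0 x) \<le> B"
    using continuous_on_bound[OF cb] by blast
  have a_bd: "\<bar>a n x\<bar> \<le> M ^ n / fact n * A" if x: "x \<in> {0..1}" for n x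
  proof -
    have "norm (a n x) \<le> (M * x) ^ n / fact n * A"
      using iterated_prim_bound[of a M "\<lambda>_. A", OF ca M _ A(2) _ x] bS(1) by simp
    also have "\<dots> \<le> M ^ n / fact n * A"
      using x M A by (intro mult_right_mono divide_right_mono power_mono) (auto simp: mult_left_le)
    finally show ?thesis by simp
  qed
  show "entire_coeffs a"
  proof (rule entire_coeffsI[OF ca A(1) M])
    show "\<bar>a n x\<bar> \<le> A * (M ^ n / fact n)" if "x \<in> {0..1}" for n x
      using a_bd[OF that] by (simp add: mult_ac)
  qed
  \<comment> \<open>\<open>b n\<close> is controlled by \<open>a (n - 1)\<close>, whose factorial
    lacks the factor \<open>n\<close>; the inequality \<open>n \<le> 2 ^ n\<close> absorbs it, at
    the price of \<open>2 * M\<close> in place of \<open>M\<close>.\<close>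
  have b_bd: "\<bar>b n x\<bar> \<le> (B + A) * ((2 * M) ^ n / fact n)" if x: "x \<in> {0..1}" for n x
  proof (cases n)
    case 0
    then show ?thesis using B(2)[OF x] A by simp
  next
    case (Suc m)
    let ?c = "A * (M ^ m / fact m)"
    have "prim (\<lambda>t. \<bar>a m t\<bar>) x \<le> prim (\<lambda>t. ?c * t ^ 0) x"
      using x a_bd by (intro prim_le continuous_intros ca) (auto simp: mult_ac)
    also have "\<dots> = ?c * x" using x by (simp only: prim_mult_left prim_power) simp
    also have "\<dots> \<le> ?c" using x A M by (intro mult_left_le) auto
    finally have "\<bar>b n x\<bar> \<le> M * ?c"
      using bS(2)[OF x, of m] M Suc by (meson mult_left_mono order_trans)
    also have "\<dots> = A * (real n * M ^ n / fact n)"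
    proof -
      have "1 / fact m = (real n / fact n :: real)" using Suc by (simp add: divide_simps)
      then have "M ^ n * (1 / fact m) = M ^ n * (real n / fact n)" by simp
      then show ?thesis using Suc by (simp add: mult_ac)
    qed
    also have "\<dots> \<le> A * ((2 * M) ^ n / fact n)"
    proof -
      have "real n \<le> 2 ^ n" using less_exp[of n] by (metis less_imp_le of_nat_le_iff of_nat_numeral of_nat_power)
      then show ?thesis using A M
        by (intro mult_left_mono divide_right_mono) (auto simp: power_mult_distrib intro!: mult_right_mono)
    qed
    also have "\<dots> \<le> (B + A) * ((2 * M) ^ n / fact n)"
      using A B M by (intro mult_right_mono) auto
    finally show ?thesis .
  qed
  show "entire_coeffs b"
    by (rule entire_coeffsI[OF cb _ _ b_bd]) (use A B M in auto)
qed

text \<open>As each coefficient is the source of the next, summing the equations against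
  \<open>h ^ n\<close> moves the parameter from \<mu> to \<open>\<mu> + h\<close>. The conclusion is
  the integral form of the equation with this new parameter.\<close>

lemma sol_chain_ser:
  fixes h :: "'a::{real_normed_field,banach}"
  assumes q: "continuous_on {0..1} q" and g: "continuous_on {0..1} g"
    and s0: "sol q \<mu> g (a 0) (b 0)"
    and sS: "\<And>n. sol q \<mu> (a n) (a (Suc n)) (b (Suc n))"
    and z: "\<And>n. a (Suc n) 0 = 0" "\<And>n. b (Suc n) 0 = 0"
    and x: "x \<in> {0..1}"
  shows "ser a h x = of_real (a 0 0) + prim (ser b h) x"
    "ser b h x = of_real (b 0 0) + prim (\<lambda>t. (of_real (q t - \<mu>) - h) * ser a h t - of_real (g t)) x"
proof -
  note ec = sol_chain_entire[OF q g s0 sS z]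
  have Sb: "(\<lambda>n. of_real (prim (b n) x) * h ^ n) sums prim (ser b h) x"
    using ser_sums[OF entire_coeffs_prim_mult[OF ec(2) continuous_on_const[of _ 1]] x, of h]
      ser_prim_mult[OF ec(2) continuous_on_const[of _ 1] x, of h] by simp
  have an: "a n x = (if n = 0 then a 0 0 else 0) + prim (b n) x" for n
    by (cases n) (use sol_prim(1)[OF s0 x] sol_prim(1)[OF sS x] z in auto)
  have "(\<lambda>n. of_real (if n = 0 then a 0 0 else 0) * h ^ n) = (\<lambda>n. if n = 0 then of_real (a 0 0) else 0)"
    by (auto simp: fun_eq_iff)
  with sums_single[of 0 "\<lambda>_. of_real (a 0 0) :: 'a"]
  have "(\<lambda>n. of_real (if n = 0 then a 0 0 else 0) * h ^ n) sums (of_real (a 0 0))" by simp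
  from sums_add[OF this Sb]
  show "ser a h x = of_real (a 0 0) + prim (ser b h) x"
    by (simp add: ser_def sums_iff an[symmetric] flip: distrib_right of_real_add)
  have cQ: "continuous_on {0..1} (\<lambda>t. q t - \<mu>)" by (intro continuous_intros q)
  have Sq: "(\<lambda>n. of_real (prim (\<lambda>t. (q t - \<mu>) * a n t) x) * h ^ n) sums
      prim (\<lambda>t. of_real (q t - \<mu>) * ser a h t) x"
    using ser_sums[OF entire_coeffs_prim_mult[OF ec(1) cQ] x, of h]
      ser_prim_mult[OF ec(1) cQ x, of h] by simp
  have Sa: "(\<lambda>n. of_real (prim (a n) x) * h ^ n) sums prim (ser a h) x"
    using ser_sums[OF entire_coeffs_prim_mult[OF ec(1) continuous_on_const[of _ 1]] x, of h]
      ser_prim_mult[OF ec(1) continuous_on_const[of _ 1] x, of h] by simp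
  \<comment> \<open>The integrated source of the \<open>n\<close>-th equation: \<open>g\<close> for
    the start of the chain, the preceding coefficient afterwards.\<close>
  define c where "c n = (case n of 0 \<Rightarrow> prim g x | Suc m \<Rightarrow> prim (a m) x)" for n
  have "(\<lambda>n. of_real (c (Suc n)) * h ^ Suc n) sums (h * prim (ser a h) x)"
    using sums_mult[OF Sa, of h] by (simp add: c_def mult_ac)
  from sums_Suc[OF this] have Sc: "(\<lambda>n. of_real (c n) * h ^ n) sums (h * prim (ser a h) x + of_real (prim g x))"
    by (simp add: c_def)
  have bn: "b n x = (if n = 0 then b 0 0 else 0) + prim (\<lambda>t. (q t - \<mu>) * a n t) x - c n" for n
  proof (cases n)
    case 0
    then show ?thesis
      using sol_prim(2)[OF s0 x] x
      by (simp add: c_def prim_diff continuous_intros q g entire_coeffs_continuous[OF ec(1)])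
  next
    case (Suc m)
    then show ?thesis
      using sol_prim(2)[OF sS x, of m] x z
      by (simp add: c_def prim_diff continuous_intros q g entire_coeffs_continuous[OF ec(1)])
  qed
  have "(\<lambda>n. of_real (if n = 0 then b 0 0 else 0) * h ^ n) = (\<lambda>n. if n = 0 then of_real (b 0 0) else 0)"
    by (auto simp: fun_eq_iff)
  with sums_single[of 0 "\<lambda>_. of_real (b 0 0) :: 'a"]
  have "(\<lambda>n. of_real (if n = 0 then b 0 0 else 0) * h ^ n) sums (of_real (b 0 0))" by simp
  from sums_diff[OF sums_add[OF this Sq] Sc]
  have "ser b h x = of_real (b 0 0) + prim (\<lambda>t. of_real (q t - \<mu>) * ser a h t) x
      - (h * prim (ser a h) x + of_real (prim g x))"
    by (simp add: ser_def sums_iff bn flip: distrib_right left_diff_distrib of_real_add of_real_diff)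
  also have "\<dots> = of_real (b 0 0) + prim (\<lambda>t. (of_real (q t - \<mu>) - h) * ser a h t - of_real (g t)) x"
    using x
    by (simp add: left_diff_distrib prim_diff prim_mult_left prim_of_real g continuous_intros ec(1) cQ q)
  finally show "ser b h x = \<dots>" .
qed

section \<open>The indefinite form and the Jordan chains\<close>

definition rip :: "(real \<Rightarrow> real) \<Rightarrow> (real \<Rightarrow> real) \<Rightarrow> real" where
  "rip f g = prim (\<lambda>t. f t * g t) 1"

type_synonym pair = "(real \<Rightarrow> real) \<times> real"

definition comb :: "pair \<Rightarrow> real \<Rightarrow> pair \<Rightarrow> pair" where
  "comb P r R = ((\<lambda>x. fst P x + r * fst R x), snd P + r * snd R)"

definition cpair :: "pair \<Rightarrow> bool" where
  "cpair P \<longleftrightarrow> continuous_on {0..1} (fst P)"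

lemma cpair_comb [intro]: "cpair P \<Longrightarrow> cpair R \<Longrightarrow> cpair (comb P r R)"
  unfolding cpair_def comb_def by (auto intro!: continuous_intros)

lemma rip_commute: "rip f g = rip g f"
  by (simp add: rip_def mult.commute)

lemma rip_cong:
  "(\<And>x. x \<in> {0..1} \<Longrightarrow> f x = f' x) \<Longrightarrow> (\<And>x. x \<in> {0..1} \<Longrightarrow> g x = g' x) \<Longrightarrow> rip f g = rip f' g'"
  unfolding rip_def by (intro prim_cong) auto

lemma rip_add_left:
  assumes "continuous_on {0..1} f" "continuous_on {0..1} g" "continuous_on {0..1} h"
  shows "rip (\<lambda>x. f x + r * g x) h = rip f h + r * rip g h"
proof -
  have "rip (\<lambda>x. f x + r * g x) h = prim (\<lambda>t. f t * h t + r * (g t * h t)) 1"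
    by (simp add: rip_def algebra_simps)
  also have "\<dots> = rip f h + r * rip g h"
    using assms by (subst prim_add) (auto intro!: continuous_intros simp: rip_def prim_mult_left)
  finally show ?thesis .
qed

lemma rip_add_right:
  assumes "continuous_on {0..1} f" "continuous_on {0..1} g" "continuous_on {0..1} h"
  shows "rip h (\<lambda>x. f x + r * g x) = rip h f + r * rip h g"
  using rip_add_left[OF assms] by (simp add: rip_commute)

lemma rip_nonneg: "continuous_on {0..1} f \<Longrightarrow> 0 \<le> rip f f"
  unfolding rip_def by (intro prim_nonneg continuous_intros) auto

lemma rip_eq_0D:
  assumes f: "continuous_on {0..1} f" and 0: "rip f f = 0" and x: "x \<in> {0..1}"
  shows "f x = 0"
proof -
  have "((\<lambda>t. f t * f t) has_integral 0) (cbox 0 1)"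
    using 0 integrable_continuous_real[of 0 1 "\<lambda>t. f t * f t"] f
    by (auto simp: rip_def prim_def has_integral_iff intro!: continuous_intros)
  then have "f x * f x = 0"
    using x f by (intro has_integral_0_cbox_imp_0[of 0 1 "\<lambda>t. f t * f t"]) (auto intro!: continuous_intros)
  then show ?thesis by simp
qed

lemma rip_add_mult_self:
  assumes "continuous_on {0..1} f" "continuous_on {0..1} g"
  shows "rip (\<lambda>x. f x + t * g x) (\<lambda>x. f x + t * g x) = rip f f + 2 * t * rip f g + t\<^sup>2 * rip g g"
proof -
  have c: "continuous_on {0..1} (\<lambda>x. f x + t * g x)" by (intro continuous_intros assms)
  show ?thesis
    using assms c by (simp add: rip_add_left rip_add_right rip_commute[of g f] power2_eq_square algebra_simps)
qed

lemma quadratic_nonneg_discriminant: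
  fixes A L Q :: real
  assumes "\<And>t. 0 \<le> A + 2 * t * L + t\<^sup>2 * Q" "0 \<le> Q"
  shows "L\<^sup>2 \<le> A * Q"
proof (cases "Q = 0")
  case True
  have "L = 0"
  proof (rule ccontr)
    assume "L \<noteq> 0"
    then show False using assms(1)[of "- (A + 1) / (2 * L)"] True by (simp add: field_simps)
  qed
  then show ?thesis using True by simp
next
  case False
  then have Q: "0 < Q" using assms by simp
  have "0 \<le> (A + 2 * (- L / Q) * L + (- L / Q)\<^sup>2 * Q) * Q"
    using assms(1)[of "- L / Q"] Q by (intro mult_nonneg_nonneg) auto
  also have "\<dots> = A * Q - L\<^sup>2" using Q by (simp add: field_simps power2_eq_square)
  finally show ?thesis by simp
qed

lemma rip_Cauchy_Schwarz:
  assumes f: "continuous_on {0..1} f" and g: "continuous_on {0..1} g"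
  shows "(rip f g)\<^sup>2 \<le> rip f f * rip g g"
proof (rule quadratic_nonneg_discriminant[OF _ rip_nonneg[OF g]])
  show "0 \<le> rip f f + 2 * t * rip f g + t\<^sup>2 * rip g g" for t
    unfolding rip_add_mult_self[OF f g, symmetric] by (intro rip_nonneg continuous_intros f g)
qed

lemma dx_derivative:
  assumes "sl_solution q \<mu> u" "x \<in> {0..1}"
  shows "(u has_vector_derivative dx u x) (at x within {0..1})"
    "(dx u has_vector_derivative (of_real (q x) - \<mu>) * u x) (at x within {0..1})"
proof -
  have d: "u differentiable (at x within {0..1})" "dx u differentiable (at x within {0..1})"
    and eq: "- dx (dx u) x + of_real (q x) * u x = \<mu> * u x"
    using assms unfolding sl_solution_def by auto
  show "(u has_vector_derivative dx u x) (at x within {0..1})"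
    using d(1) unfolding dx_def by (simp add: vector_derivative_works)
  have "(dx u has_vector_derivative dx (dx u) x) (at x within {0..1})"
    using d(2) unfolding dx_def[of "dx u"] by (simp add: vector_derivative_works)
  moreover have "dx (dx u) x = (of_real (q x) - \<mu>) * u x" using eq by (simp add: algebra_simps)
  ultimately show "(dx u has_vector_derivative (of_real (q x) - \<mu>) * u x) (at x within {0..1})" by simp
qed

section \<open>The boundary value problem as a symmetric operator on pairs\<close>

locale sl_problem =
  fixes q :: "real \<Rightarrow> real" and \<beta> a b c d :: real and y :: "real \<Rightarrow> complex \<Rightarrow> complex"
  assumes q: "continuous_on {0..1} q" and det: "a * d - b * c < 0" and fam: "sl_family q \<beta> y"
begin

abbreviation \<omega> :: "complex \<Rightarrow> complex" where "\<omega> \<equiv> char_fun a b c d y"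
abbreviation \<sigma> :: real where "\<sigma> \<equiv> b * c - a * d"
abbreviation mm :: "(real \<Rightarrow> real) \<Rightarrow> (real \<Rightarrow> real) \<Rightarrow> real" where "mm u v \<equiv> a * u 1 - c * v 1"
abbreviation nn :: "(real \<Rightarrow> real) \<Rightarrow> (real \<Rightarrow> real) \<Rightarrow> real" where "nn u v \<equiv> b * u 1 - d * v 1"

lemma \<sigma>_pos: "0 < \<sigma>" using det by simp

definition frm :: "pair \<Rightarrow> pair \<Rightarrow> real" where
  "frm P R = \<sigma> * rip (fst P) (fst R) - snd P * snd R"

text \<open>\<open>res \<mu> P U\<close> says \<open>(A - \<mu>) U = P\<close>.\<close>

definition res :: "real \<Rightarrow> pair \<Rightarrow> pair \<Rightarrow> bool" where
  "res \<mu> P U \<longleftrightarrow> cpair P \<and>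
     (\<exists>v. sol q \<mu> (fst P) (fst U) v \<and> fst U 0 * cos \<beta> = v 0 * sin \<beta> \<and>
        snd U = mm (fst U) v \<and> snd P = - nn (fst U) v - \<mu> * snd U)"

lemma frm_commute: "frm P R = frm R P"
  by (simp add: frm_def rip_commute)

lemma frm_comb_left: "cpair P \<Longrightarrow> cpair R \<Longrightarrow> cpair S \<Longrightarrow> frm (comb P r R) S = frm P S + r * frm R S"
  by (simp add: frm_def comb_def cpair_def rip_add_left algebra_simps)

lemma frm_comb_right: "cpair P \<Longrightarrow> cpair R \<Longrightarrow> cpair S \<Longrightarrow> frm S (comb P r R) = frm S P + r * frm S R"
  by (simp add: frm_def comb_def cpair_def rip_add_right algebra_simps)

lemma res_cpair: "res \<mu> P U \<Longrightarrow> cpair P" "res \<mu> P U \<Longrightarrow> cpair U"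
  unfolding res_def cpair_def by (auto dest: sol_continuous)

lemma res_comb:
  assumes "res \<mu> P U" "res \<mu> P' U'"
  shows "res \<mu> (comb P r P') (comb U r U')"
proof -
  obtain v v' where
    v: "sol q \<mu> (fst P) (fst U) v" "fst U 0 * cos \<beta> = v 0 * sin \<beta>"
      "snd U = mm (fst U) v" "snd P = - nn (fst U) v - \<mu> * snd U"
    and v': "sol q \<mu> (fst P') (fst U') v'" "fst U' 0 * cos \<beta> = v' 0 * sin \<beta>"
      "snd U' = mm (fst U') v'" "snd P' = - nn (fst U') v' - \<mu> * snd U'"
    using assms unfolding res_def by blast
  have "sol q \<mu> (fst (comb P r P')) (fst (comb U r U')) (\<lambda>x. v x + r * v' x)"
    unfolding comb_def using sol_lincomb[OF v(1) v'(1)] by simp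
  moreover have "(fst U 0 + r * fst U' 0) * cos \<beta> = (v 0 + r * v' 0) * sin \<beta>"
    using v(2) v'(2) by (simp add: distrib_right mult.assoc)
  moreover have "snd U + r * snd U' = a * (fst U 1 + r * fst U' 1) - c * (v 1 + r * v' 1)"
    unfolding v(3) v'(3) by (simp add: algebra_simps)
  moreover have "snd P + r * snd P' = - (b * (fst U 1 + r * fst U' 1) - d * (v 1 + r * v' 1)) - \<mu> * (snd U + r * snd U')"
    unfolding v(4) v'(4) by (simp add: algebra_simps)
  ultimately show ?thesis
    unfolding res_def using res_cpair(1)[OF assms(1)] res_cpair(1)[OF assms(2)]
    by (intro conjI cpair_comb exI[of _ "\<lambda>x. v x + r * v' x"]) (auto simp: comb_def)
qed

lemma res_shift:
  assumes "res \<mu> P U"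
  shows "res \<nu> (comb P (\<mu> - \<nu>) U) U"
proof -
  obtain v where
    v: "sol q \<mu> (fst P) (fst U) v" "fst U 0 * cos \<beta> = v 0 * sin \<beta>"
      "snd U = mm (fst U) v" "snd P = - nn (fst U) v - \<mu> * snd U"
    using assms unfolding res_def by blast
  show ?thesis
    unfolding res_def
  proof (intro conjI cpair_comb res_cpair[OF assms] exI[of _ v])
    show "sol q \<nu> (fst (comb P (\<mu> - \<nu>) U)) (fst U) v"
      unfolding comb_def using sol_shift[OF v(1)] by simp
    show "snd (comb P (\<mu> - \<nu>) U) = - nn (fst U) v - \<nu> * snd U"
      using v(4) by (simp add: comb_def algebra_simps)
  qed (use v in auto)
qed

text \<open>Lagrange's identity. The Wronskian of the two first components vanishes at
  \<open>0\<close> by the common boundary condition. At \<open>1\<close>, multiplied by \<sigma>, it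
  is \<open>mm\<close> of the first times \<open>nn\<close> of the second minus the same with the
  roles exchanged, and this is what the scalar parts of the form compensate.\<close>

lemma res_symmetric:
  assumes "res \<mu> P U" "res \<nu> R V"
  shows "frm P V - frm U R = (\<nu> - \<mu>) * frm U V"
proof -
  obtain u' v' where
    u': "sol q \<mu> (fst P) (fst U) u'" "fst U 0 * cos \<beta> = u' 0 * sin \<beta>"
      "snd U = mm (fst U) u'" "snd P = - nn (fst U) u' - \<mu> * snd U"
    and v': "sol q \<nu> (fst R) (fst V) v'" "fst V 0 * cos \<beta> = v' 0 * sin \<beta>"
      "snd V = mm (fst V) v'" "snd R = - nn (fst V) v' - \<nu> * snd V"
    using assms unfolding res_def by blast
  let ?u = "fst U" and ?v = "fst V" and ?g = "fst P" and ?f = "fst R"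
  have c: "continuous_on {0..1} ?u" "continuous_on {0..1} ?v" "continuous_on {0..1} ?g" "continuous_on {0..1} ?f"
    using res_cpair[OF assms(1)] res_cpair[OF assms(2)] by (auto simp: cpair_def)
  let ?D = "\<lambda>x. (?g x * ?v x - ?u x * ?f x) + (\<mu> - \<nu>) * (?u x * ?v x)"
  have "((\<lambda>x. ?u x * v' x - u' x * ?v x) has_vector_derivative ?D x) (at x within {0..1})" if x: "x \<in> {0..1}" for x
  proof -
    have "((\<lambda>x. ?u x * v' x - u' x * ?v x) has_vector_derivative
        (?u x * ((q x - \<nu>) * ?v x - ?f x) + u' x * v' x) - (u' x * v' x + ((q x - \<mu>) * ?u x - ?g x) * ?v x)) (at x within {0..1})"
      using u'(1) v'(1) x unfolding sol_def
      by (intro has_vector_derivative_diff has_vector_derivative_mult) auto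
    then show ?thesis by (simp add: algebra_simps)
  qed
  from prim_of_deriv[OF this, of 1]
  have W: "?u 1 * v' 1 - u' 1 * ?v 1 = (?u 0 * v' 0 - u' 0 * ?v 0) + prim ?D 1" by simp
  \<comment> \<open>Multiplication by \<open>sin \<beta>\<close> and by \<open>cos \<beta>\<close>
    gives zero in both cases, and the two factors do not vanish together.\<close>
  have "?u 0 * v' 0 - u' 0 * ?v 0 = 0"
  proof -
    have "(?u 0 * v' 0 - u' 0 * ?v 0) * sin \<beta> = ?u 0 * (v' 0 * sin \<beta>) - ?v 0 * (u' 0 * sin \<beta>)"
      by (simp add: algebra_simps)
    also have "\<dots> = 0" unfolding u'(2)[symmetric] v'(2)[symmetric] by simp
    finally have S: "(?u 0 * v' 0 - u' 0 * ?v 0) * sin \<beta> = 0" .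
    have "(?u 0 * v' 0 - u' 0 * ?v 0) * cos \<beta> = v' 0 * (?u 0 * cos \<beta>) - u' 0 * (?v 0 * cos \<beta>)"
      by (simp add: algebra_simps)
    also have "\<dots> = 0" unfolding u'(2) v'(2) by simp
    finally have "(?u 0 * v' 0 - u' 0 * ?v 0) * cos \<beta> = 0" .
    with S show ?thesis using sin_zero_abs_cos_one[of \<beta>] by auto
  qed
  moreover have "prim ?D 1 = rip ?g ?v - rip ?u ?f + (\<mu> - \<nu>) * rip ?u ?v"
    using c by (simp add: prim_add prim_diff prim_mult_left continuous_intros rip_def)
  ultimately have W': "\<sigma> * (rip ?g ?v - rip ?u ?f + (\<mu> - \<nu>) * rip ?u ?v) = \<sigma> * (?u 1 * v' 1 - u' 1 * ?v 1)"
    using W by simp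
  have "frm P V - frm U R - (\<nu> - \<mu>) * frm U V
      = \<sigma> * (rip ?g ?v - rip ?u ?f + (\<mu> - \<nu>) * rip ?u ?v)
        - snd P * snd V + snd U * snd R + (\<nu> - \<mu>) * (snd U * snd V)"
    by (simp add: frm_def algebra_simps)
  also have "\<dots> = 0"
    unfolding W' u'(4) v'(4) u'(3) v'(3) by (simp add: algebra_simps)
  finally show ?thesis by simp
qed

section \<open>Expansion of \<open>y\<close> and \<omega> in the spectral parameter\<close>

lemma y_sl: "sl_solution q \<mu> (\<lambda>x. y x \<mu>)" "y 0 \<mu> = of_real (sin \<beta>)" "dx (\<lambda>x. y x \<mu>) 0 = of_real (cos \<beta>)"
  using fam unfolding sl_family_def by auto

lemma y_deriv:
  assumes "x \<in> {0..1}"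
  shows "((\<lambda>x. y x \<mu>) has_vector_derivative dx (\<lambda>x. y x \<mu>) x) (at x within {0..1})"
    "(dx (\<lambda>x. y x \<mu>) has_vector_derivative (of_real (q x) - \<mu>) * y x \<mu>) (at x within {0..1})"
  using dx_derivative[OF y_sl(1) assms] by auto

lemma y_continuous:
  "continuous_on {0..1} (\<lambda>x. y x \<mu>)" "continuous_on {0..1} (dx (\<lambda>x. y x \<mu>))"
  by (auto intro!: has_vector_derivative_imp_continuous_on y_deriv)

lemma y_real_sol:
  "sol q \<kappa> (\<lambda>_. 0) (\<lambda>x. Re (y x (of_real \<kappa>))) (\<lambda>x. Re (dx (\<lambda>x. y x (of_real \<kappa>)) x))"
  "sol q \<kappa> (\<lambda>_. 0) (\<lambda>x. Im (y x (of_real \<kappa>))) (\<lambda>x. Im (dx (\<lambda>x. y x (of_real \<kappa>)) x))"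
  unfolding sol_def
  using bounded_linear.has_vector_derivative[OF bounded_linear_Re y_deriv(1)[of _ "of_real \<kappa>"]]
    bounded_linear.has_vector_derivative[OF bounded_linear_Re y_deriv(2)[of _ "of_real \<kappa>"]]
    bounded_linear.has_vector_derivative[OF bounded_linear_Im y_deriv(1)[of _ "of_real \<kappa>"]]
    bounded_linear.has_vector_derivative[OF bounded_linear_Im y_deriv(2)[of _ "of_real \<kappa>"]]
  by simp_all

text \<open>At a real parameter the imaginary part solves the homogeneous equation with zero initial
  data.\<close>

lemma y_real:
  assumes "x \<in> {0..1}"
  shows "y x (of_real \<kappa>) = of_real (Re (y x (of_real \<kappa>)))"
    "dx (\<lambda>x. y x (of_real \<kappa>)) x = of_real (Re (dx (\<lambda>x. y x (of_real \<kappa>)) x))"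
  using sol_zero_unique[OF q y_real_sol(2) _ _ assms] by (simp_all add: y_sl complex_eq_iff)

text \<open>Taylor coefficients of \<open>y\<close> and \<open>y'\<close> with respect to the spectral parameter at \<open>\<kappa>\<close>.\<close>

primrec chain :: "real \<Rightarrow> nat \<Rightarrow> (real \<Rightarrow> real) \<times> (real \<Rightarrow> real)" where
  "chain \<kappa> 0 = ((\<lambda>x. Re (y x (of_real \<kappa>))), (\<lambda>x. Re (dx (\<lambda>x. y x (of_real \<kappa>)) x)))"
| "chain \<kappa> (Suc n) = (SOME p. sol q \<kappa> (fst (chain \<kappa> n)) (fst p) (snd p) \<and> fst p 0 = 0 \<and> snd p 0 = 0)"

abbreviation ca :: "real \<Rightarrow> nat \<Rightarrow> real \<Rightarrow> real" where "ca \<kappa> n \<equiv> fst (chain \<kappa> n)"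
abbreviation cb :: "real \<Rightarrow> nat \<Rightarrow> real \<Rightarrow> real" where "cb \<kappa> n \<equiv> snd (chain \<kappa> n)"

lemma chain_0: "sol q \<kappa> (\<lambda>_. 0) (ca \<kappa> 0) (cb \<kappa> 0)" "ca \<kappa> 0 0 = sin \<beta>" "cb \<kappa> 0 0 = cos \<beta>"
  using y_real_sol(1)[of \<kappa>] by (simp_all add: y_sl)

text \<open>The choice made in \<open>chain\<close> is justified only if the previous coefficient is
  continuous, so continuity is carried through the induction.\<close>

lemma chain_Suc_aux:
  "continuous_on {0..1} (ca \<kappa> n) \<and>
   sol q \<kappa> (ca \<kappa> n) (ca \<kappa> (Suc n)) (cb \<kappa> (Suc n)) \<and> ca \<kappa> (Suc n) 0 = 0 \<and> cb \<kappa> (Suc n) 0 = 0"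
proof (induction n)
  have *: "sol q \<kappa> (ca \<kappa> n) (ca \<kappa> (Suc n)) (cb \<kappa> (Suc n)) \<and> ca \<kappa> (Suc n) 0 = 0 \<and> cb \<kappa> (Suc n) 0 = 0"
    if c: "continuous_on {0..1} (ca \<kappa> n)" for n
  proof -
    obtain u v where "sol q \<kappa> (ca \<kappa> n) u v \<and> u 0 = 0 \<and> v 0 = 0"
      using sol_exists[OF q c] by blast
    then have "\<exists>p. sol q \<kappa> (ca \<kappa> n) (fst p) (snd p) \<and> fst p 0 = 0 \<and> snd p 0 = 0"
      by (intro exI[of _ "(u, v)"]) simp
    from someI_ex[OF this] show ?thesis by simp
  qed
  { case 0 show ?case using sol_continuous(1)[OF chain_0(1)] * by blast }
  { case (Suc n) then show ?case using sol_continuous(1) * by blast }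
qed

lemma chain_Suc:
  "sol q \<kappa> (ca \<kappa> n) (ca \<kappa> (Suc n)) (cb \<kappa> (Suc n))" "ca \<kappa> (Suc n) 0 = 0" "cb \<kappa> (Suc n) 0 = 0"
  using chain_Suc_aux by blast+

declare chain.simps [simp del]

lemmas chain_entire = sol_chain_entire[OF q continuous_on_const, of \<kappa> 0 "ca \<kappa>" "cb \<kappa>" for \<kappa>, OF chain_0(1) chain_Suc]
lemmas chain_ser = sol_chain_ser[OF q continuous_on_const, of \<kappa> 0 "ca \<kappa>" "cb \<kappa>" for \<kappa>, OF chain_0(1) chain_Suc]

text \<open>Both sides solve the same first-order integral system, so Gronwall identifies them. This
  yields at once that \<open>y\<close> and its \<open>x\<close>-derivative are entire in the
  parameter.\<close>

lemma y_eq_ser: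
  fixes h :: complex
  assumes x: "x \<in> {0..1}"
  shows "y x (of_real \<kappa> + h) = ser (ca \<kappa>) h x" "dx (\<lambda>x. y x (of_real \<kappa> + h)) x = ser (cb \<kappa>) h x"
proof -
  let ?\<mu> = "of_real \<kappa> + h"
  let ?u = "\<lambda>x. y x ?\<mu> - ser (ca \<kappa>) h x" and ?v = "\<lambda>x. dx (\<lambda>x. y x ?\<mu>) x - ser (cb \<kappa>) h x"
  let ?p = "\<lambda>t. of_real (q t - \<kappa>) - h"
  have cq: "continuous_on {0..1} ?p" by (intro continuous_intros q)
  have c: "continuous_on {0..1} (\<lambda>x. y x ?\<mu>)" "continuous_on {0..1} (dx (\<lambda>x. y x ?\<mu>))"
    "continuous_on {0..1} (ser (ca \<kappa>) h)" "continuous_on {0..1} (ser (cb \<kappa>) h)"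
    by (auto intro!: y_continuous continuous_intros chain_entire)
  have u: "?u x = prim ?v x" if x: "x \<in> {0..1}" for x
  proof -
    have "y x ?\<mu> = of_real (sin \<beta>) + prim (dx (\<lambda>x. y x ?\<mu>)) x"
      using prim_of_deriv[OF y_deriv(1)[of _ ?\<mu>] x] by (simp add: y_sl)
    then show ?thesis
      using chain_ser(1)[OF x, of \<kappa> h] x c by (simp add: chain_0 prim_diff)
  qed
  have v: "?v x = prim (\<lambda>t. ?p t * ?u t) x" if x: "x \<in> {0..1}" for x
  proof -
    have "dx (\<lambda>x. y x ?\<mu>) x = of_real (cos \<beta>) + prim (\<lambda>t. ?p t * y t ?\<mu>) x"
      using prim_of_deriv[OF y_deriv(2)[of _ ?\<mu>] x] by (simp add: y_sl algebra_simps)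
    moreover have "prim (\<lambda>t. ?p t * ?u t) x = prim (\<lambda>t. ?p t * y t ?\<mu> - ?p t * ser (ca \<kappa>) h t) x"
      by (simp add: right_diff_distrib)
    moreover have "\<dots> = prim (\<lambda>t. ?p t * y t ?\<mu>) x - prim (\<lambda>t. ?p t * ser (ca \<kappa>) h t) x"
      using x by (intro prim_diff continuous_on_mult c cq) auto
    ultimately show ?thesis
      using chain_ser(2)[OF x, of \<kappa> h] by (simp add: chain_0)
  qed
  have "?u x = 0" "?v x = 0"
    using first_order_system_unique[of ?u ?v ?p, OF _ _ cq u v x] c
    by (simp_all only: continuous_on_diff)
  then show "y x (of_real \<kappa> + h) = ser (ca \<kappa>) h x" "dx (\<lambda>x. y x (of_real \<kappa> + h)) x = ser (cb \<kappa>) h x"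
    by simp_all
qed

lemma y_sums:
  fixes h :: complex
  assumes x: "x \<in> {0..1}"
  shows "(\<lambda>n. of_real (ca \<kappa> n x) * h ^ n) sums y x (of_real \<kappa> + h)"
    "(\<lambda>n. of_real (cb \<kappa> n x) * h ^ n) sums dx (\<lambda>x. y x (of_real \<kappa> + h)) x"
  using ser_sums[OF chain_entire(1) x, of \<kappa> h] ser_sums[OF chain_entire(2) x, of \<kappa> h]
  by (simp_all add: y_eq_ser[OF x])

definition Y :: "real \<Rightarrow> nat \<Rightarrow> pair" where
  "Y \<kappa> n = (ca \<kappa> n, mm (ca \<kappa> n) (cb \<kappa> n))"

text \<open>The Taylor coefficients of \<omega> at \<kappa>. With
  \<open>\<mu> = \<kappa> + h\<close>, \<omega> is \<open>\<mu>\<close> times the boundary form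
  \<open>mm\<close> plus \<open>nn\<close>; the part \<open>h * mm\<close> shifts the index by one
  and produces the last summand.\<close>

definition w :: "real \<Rightarrow> nat \<Rightarrow> real" where
  "w \<kappa> n = \<kappa> * mm (ca \<kappa> n) (cb \<kappa> n) + nn (ca \<kappa> n) (cb \<kappa> n) +
     (case n of 0 \<Rightarrow> 0 | Suc m \<Rightarrow> mm (ca \<kappa> m) (cb \<kappa> m))"

lemma cpair_Y [simp, intro]: "cpair (Y \<kappa> n)"
  using entire_coeffs_continuous[OF chain_entire(1)[of \<kappa>], of n] by (simp add: cpair_def Y_def)

text \<open>Every Taylor coefficient satisfies the differential equation and the condition at
  \<open>0\<close>; the scalar equation fails by exactly \<open>w\<close>. Hence at a zero of order
  \<open>r\<close> the first \<open>r\<close> pairs form a Jordan chain.\<close>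

lemma res_Y_0: "res \<kappa> ((\<lambda>_. 0), - w \<kappa> 0) (Y \<kappa> 0)"
  unfolding res_def cpair_def Y_def w_def using chain_0[of \<kappa>]
  by (auto intro!: exI[of _ "cb \<kappa> 0"])

lemma res_Y_Suc: "res \<kappa> (comb (Y \<kappa> n) (- w \<kappa> (Suc n)) ((\<lambda>_. 0), 1)) (Y \<kappa> (Suc n))"
  unfolding res_def
proof (intro conjI exI[of _ "cb \<kappa> (Suc n)"])
  show "cpair (comb (Y \<kappa> n) (- w \<kappa> (Suc n)) (\<lambda>_. 0, 1))"
    by (intro cpair_comb cpair_Y) (simp add: cpair_def)
qed (use chain_Suc[of \<kappa> n] in \<open>auto simp: comb_def Y_def w_def\<close>)

lemma \<omega>_sums: "(\<lambda>n. of_real (w \<kappa> n) * h ^ n) sums \<omega> (of_real \<kappa> + h)"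
proof -
  let ?m = "\<lambda>n. mm (ca \<kappa> n) (cb \<kappa> n)" and ?n = "\<lambda>n. nn (ca \<kappa> n) (cb \<kappa> n)"
  let ?y = "y 1 (of_real \<kappa> + h)" and ?z = "dx (\<lambda>x. y x (of_real \<kappa> + h)) 1"
  have ya: "(\<lambda>n. of_real (ca \<kappa> n 1) * h ^ n) sums ?y" and yb: "(\<lambda>n. of_real (cb \<kappa> n 1) * h ^ n) sums ?z"
    by (intro y_sums; simp)+
  have m: "(\<lambda>n. of_real (?m n) * h ^ n) sums (of_real a * ?y - of_real c * ?z)"
    using sums_diff[OF sums_mult[OF ya, of "of_real a"] sums_mult[OF yb, of "of_real c"]]
    by (simp add: algebra_simps)
  have n: "(\<lambda>n. of_real (?n n) * h ^ n) sums (of_real b * ?y - of_real d * ?z)"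
    using sums_diff[OF sums_mult[OF ya, of "of_real b"] sums_mult[OF yb, of "of_real d"]]
    by (simp add: algebra_simps)
  define e where "e n = (case n of 0 \<Rightarrow> 0 | Suc k \<Rightarrow> ?m k)" for n
  have "(\<lambda>n. of_real (e (Suc n)) * h ^ Suc n) sums (h * (of_real a * ?y - of_real c * ?z))"
    using sums_mult[OF m, of h] by (simp add: e_def mult_ac)
  from sums_Suc[OF this] have e: "(\<lambda>n. of_real (e n) * h ^ n) sums (h * (of_real a * ?y - of_real c * ?z))"
    by (simp add: e_def)
  have "(\<lambda>n. of_real \<kappa> * (of_real (?m n) * h ^ n) + of_real (?n n) * h ^ n + of_real (e n) * h ^ n) sums
     (of_real \<kappa> * (of_real a * ?y - of_real c * ?z) + (of_real b * ?y - of_real d * ?z) + h * (of_real a * ?y - of_real c * ?z))"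
    by (intro sums_add sums_mult m n e)
  moreover have "of_real \<kappa> * (of_real (?m n) * h ^ n) + of_real (?n n) * h ^ n + of_real (e n) * h ^ n = of_real (w \<kappa> n) * h ^ n" for n
    by (simp add: w_def e_def algebra_simps)
  ultimately show ?thesis by (simp add: char_fun_def algebra_simps)
qed

lemma \<omega>_real: "\<omega> (of_real \<kappa>) = of_real (w \<kappa> 0)"
  using \<omega>_sums[of \<kappa> 0] by (simp add: sums_iff powser_zero)

lemma chain_shift:
  assumes x: "x \<in> {0..1}"
  shows "ca (\<kappa> + h) 0 x = ser (ca \<kappa>) h x" "cb (\<kappa> + h) 0 x = ser (cb \<kappa>) h x"
proof -
  have "(\<lambda>n. of_real (ca \<kappa> n x * h ^ n)) sums y x (of_real (\<kappa> + h))"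
    "(\<lambda>n. of_real (cb \<kappa> n x * h ^ n)) sums dx (\<lambda>x. y x (of_real (\<kappa> + h))) x"
    using y_sums[OF x, of \<kappa> "of_real h"] by simp_all
  then have "(\<lambda>n. ca \<kappa> n x * h ^ n) sums ca (\<kappa> + h) 0 x" "(\<lambda>n. cb \<kappa> n x * h ^ n) sums cb (\<kappa> + h) 0 x"
    using y_real[OF x, of "\<kappa> + h"] by (simp_all add: chain.simps(1) sums_of_real_iff[symmetric, where 'a = complex])
  then show "ca (\<kappa> + h) 0 x = ser (ca \<kappa>) h x" "cb (\<kappa> + h) 0 x = ser (cb \<kappa>) h x"
    by (simp_all add: ser_def sums_iff)
qed

lemma snd_Y_sums: "(\<lambda>n. snd (Y \<kappa> n) * h ^ n) sums snd (Y (\<kappa> + h) 0)"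
proof -
  have one: "(1::real) \<in> {0..1}" by simp
  show ?thesis
    using sums_diff[OF sums_mult[OF ser_sums[OF chain_entire(1) one, of \<kappa> h], of a] sums_mult[OF ser_sums[OF chain_entire(2) one, of \<kappa> h], of c]]
    by (simp add: Y_def chain_shift algebra_simps)
qed

text \<open>Orthogonality to the first members of a Jordan chain thereby becomes vanishing of an
  entire function to the corresponding order, to be cancelled against the zero of
  \<open>w\<close>.\<close>

lemma frm_Y_sums:
  assumes "cpair P"
  shows "(\<lambda>n. frm P (Y \<kappa> n) * h ^ n) sums frm P (Y (\<kappa> + h) 0)"
proof -
  have one: "(1::real) \<in> {0..1}" by simp
  have cP: "continuous_on {0..1} (fst P)" using assms by (simp add: cpair_def)
  have "rip (fst P) (ca (\<kappa> + h) 0) = prim (\<lambda>t. fst P t * ser (ca \<kappa>) h t) 1"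
    unfolding rip_def using chain_shift(1) by (intro prim_cong) auto
  also have "\<dots> = ser (\<lambda>n. prim (\<lambda>t. fst P t * ca \<kappa> n t)) h 1"
    using ser_prim_mult[OF chain_entire(1) cP one, of \<kappa> h] by simp
  finally have "rip (fst P) (ca (\<kappa> + h) 0) = \<dots>" .
  then have "(\<lambda>n. rip (fst P) (ca \<kappa> n) * h ^ n) sums rip (fst P) (ca (\<kappa> + h) 0)"
    using ser_sums[OF entire_coeffs_prim_mult[OF chain_entire(1) cP] one, of \<kappa> h] by (simp add: rip_def)
  from sums_diff[OF sums_mult[OF this, of \<sigma>] sums_mult[OF snd_Y_sums, of "snd P"]]
  show ?thesis by (simp add: frm_def Y_def algebra_simps)
qed

lemma w_sums: "(\<lambda>n. w \<kappa> n * h ^ n) sums w (\<kappa> + h) 0"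
proof -
  have "(\<lambda>n. complex_of_real (w \<kappa> n * h ^ n)) sums of_real (w (\<kappa> + h) 0)"
    using \<omega>_sums[of \<kappa> "of_real h"] \<omega>_real[of "\<kappa> + h"] by simp
  then show ?thesis by (simp only: sums_of_real_iff)
qed

end

section \<open>Orders of zeros of everywhere convergent power series\<close>

lemma powser_factor:
  fixes f :: "'a::{real_normed_field,banach} \<Rightarrow> 'a"
  assumes S: "\<And>h. (\<lambda>n. e n * h ^ n) sums f h" and z: "\<And>n. n < r \<Longrightarrow> e n = 0"
  obtains g where "\<And>h. (\<lambda>n. e (n + r) * h ^ n) sums g h" "\<And>h. f h = h ^ r * g h" "isCont g 0" "g 0 = e r"
proof
  let ?g = "\<lambda>h. \<Sum>n. e (n + r) * h ^ n"
  have Sr: "(\<lambda>n. e (n + r) * h ^ (n + r)) sums f h" for h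
    using sums_split_initial_segment[OF S, of r h] z by simp
  have sm: "summable (\<lambda>n. e (n + r) * h ^ n)" for h
  proof (cases "h = 0")
    case True
    then show ?thesis by (intro sums_summable[OF powser_sums_zero[of "\<lambda>n. e (n + r)", folded True]])
  next
    case False
    have "summable (\<lambda>n. inverse (h ^ r) * (e (n + r) * h ^ (n + r)))"
      by (intro summable_mult sums_summable[OF Sr])
    then show ?thesis using False by (simp add: power_add field_simps)
  qed
  show g: "(\<lambda>n. e (n + r) * h ^ n) sums ?g h" for h
    using sm by (rule summable_sums)
  show "f h = h ^ r * ?g h" for h
    using Sr[of h] sums_mult[OF g[of h], of "h ^ r"]
    by (simp add: power_add mult_ac sums_iff)
  show "isCont ?g 0" by (rule isCont_powser_converges_everywhere[OF sm])
  show "?g 0 = e r" by (simp add: powser_zero)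
qed

lemma isCont_shifted_powser:
  fixes f :: "real \<Rightarrow> real"
  assumes S: "\<And>h. (\<lambda>n. e n * h ^ n) sums f (x + h)"
  shows "isCont f x"
proof -
  have "(\<Sum>n. e n * h ^ n) = f (x + h)" "summable (\<lambda>n. e n * h ^ n)" for h
    using S[of h] by (simp_all add: sums_iff)
  then have "isCont (\<lambda>h. f (x + h)) 0"
    using isCont_powser_converges_everywhere[of e "0::real"] by presburger
  then show ?thesis by (simp add: isCont_iff)
qed

lemma powser_holomorphic:
  assumes "\<And>h. (\<lambda>n. e n * h ^ n) sums f (z + h)"
  shows "f holomorphic_on UNIV"
proof -
  have "f holomorphic_on ball z r" for r
    using assms[of "_ - z"] by (intro power_series_holomorphic[of _ _ e]) simp
  then have "f field_differentiable (at x)" for x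
    by (rule holomorphic_on_imp_differentiable_at[of _ "ball z (dist z x + 1)"]) auto
  then show ?thesis by (simp add: holomorphic_on_def field_differentiable_at_within)
qed

lemma powser_higher_deriv:
  fixes f :: "complex \<Rightarrow> complex"
  assumes S: "\<And>h. (\<lambda>n. e n * h ^ n) sums f (z + h)"
  shows "(deriv ^^ n) f z = fact n * e n"
proof -
  have "(\<lambda>h. f (z + h)) has_fps_expansion Abs_fps e"
    unfolding has_fps_expansion_def
  proof
    have "fps_conv_radius (Abs_fps e) = \<infinity>"
      unfolding fps_conv_radius_def
      by (rule conv_radius_inftyI'') (use S in \<open>auto simp: sums_iff\<close>)
    then show "0 < fps_conv_radius (Abs_fps e)" by simp
    show "\<forall>\<^sub>F h in nhds 0. eval_fps (Abs_fps e) h = f (z + h)"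
      using S by (intro always_eventually) (auto simp: eval_fps_def sums_iff)
  qed
  from fps_nth_fps_expansion[OF this, of n]
  have "e n = (deriv ^^ n) (\<lambda>h. f (z + h)) 0 / fact n" by simp
  moreover have "(deriv ^^ n) (\<lambda>h. f (z + h)) 0 = (deriv ^^ n) f z"
    using higher_deriv_shift_0[of n f z] by (simp add: o_def)
  ultimately show ?thesis by simp
qed

text \<open>The order is the least index with a nonzero coefficient; the point \<open>z'\<close>
  guarantees that there is one.\<close>

lemma powser_zorder:
  assumes S: "\<And>h. (\<lambda>n. e n * h ^ n) sums f (z + h)" and nz: "f z' \<noteq> 0" and zo: "zorder f z = int r"
  shows "n < r \<Longrightarrow> e n = 0" "e r \<noteq> 0"
proof -
  have "\<exists>n. e n \<noteq> 0"
  proof (rule ccontr)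
    assume "\<nexists>n. e n \<noteq> 0"
    then show False using S[of "z' - z"] nz by (simp add: sums_iff)
  qed
  define r' where "r' = (LEAST n. e n \<noteq> 0)"
  have er: "e r' \<noteq> 0" and el: "\<And>n. n < r' \<Longrightarrow> e n = 0"
    using LeastI_ex[OF \<open>\<exists>n. e n \<noteq> 0\<close>] not_less_Least unfolding r'_def by blast+
  obtain g where g: "\<And>h. (\<lambda>n. e (n + r') * h ^ n) sums g h" "\<And>h. f (z + h) = h ^ r' * g h" "g 0 = e r'"
    by (rule powser_factor[where f = "\<lambda>h. f (z + h)" and r = r', OF S el]) blast+
  have "zorder f z = int r'"
  proof (rule zorder_eqI[of UNIV z "\<lambda>w. g (w - z)"])
    have "(\<lambda>n. e (n + r') * h ^ n) sums (\<lambda>w. g (w - z)) (z + h)" for h using g(1) by simp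
    from powser_holomorphic[OF this] show "(\<lambda>w. g (w - z)) holomorphic_on UNIV" .
    show "f w = g (w - z) * (w - z) powi int r'" for w
      using g(2)[of "w - z"] by (simp add: mult.commute)
  qed (use g er in auto)
  then have "r' = r" using zo by simp
  then show "n < r \<Longrightarrow> e n = 0" "e r \<noteq> 0" using er el by auto
qed

context sl_problem
begin

section \<open>Gram matrix of the root vectors\<close>

lemma cpair_const [simp]: "cpair ((\<lambda>_. 0), t)" by (simp add: cpair_def)

lemma frm_zero_left [simp]: "frm ((\<lambda>_. 0), t) P = - (t * snd P)"
  by (simp add: frm_def rip_def prim_def)

lemma frm_zero_right [simp]: "frm P ((\<lambda>_. 0), t) = - (snd P * t)"
  using frm_zero_left[of t P] by (simp add: frm_commute mult.commute)

text \<open>Both resolvent relations have the same parameter, so the right-hand side of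
  \<open>res_symmetric\<close> vanishes. An index can thus be moved from one argument to the other
  at the price of terms in \<open>w\<close>.\<close>

lemma gram_Suc_Suc:
  "frm (Y \<kappa> p) (Y \<kappa> (Suc r)) + w \<kappa> (Suc p) * snd (Y \<kappa> (Suc r))
   = frm (Y \<kappa> (Suc p)) (Y \<kappa> r) + w \<kappa> (Suc r) * snd (Y \<kappa> (Suc p))"
  using res_symmetric[OF res_Y_Suc[of \<kappa> p] res_Y_Suc[of \<kappa> r]]
  by (simp add: frm_comb_left frm_comb_right)

lemma gram_0_Suc:
  "w \<kappa> 0 * snd (Y \<kappa> (Suc r)) = frm (Y \<kappa> 0) (Y \<kappa> r) + w \<kappa> (Suc r) * snd (Y \<kappa> 0)"
  using res_symmetric[OF res_Y_0[of \<kappa>] res_Y_Suc[of \<kappa> r]]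
  by (simp add: frm_comb_right)

lemma frm_simple: "w \<kappa> 0 = 0 \<Longrightarrow> frm (Y \<kappa> 0) (Y \<kappa> 0) = - w \<kappa> 1 * snd (Y \<kappa> 0)"
  using gram_0_Suc[of \<kappa> 0] by simp

text \<open>Moving indices to the right argument reduces the entry \<open>(i, j)\<close> to
  \<open>(0, i + j)\<close>, which is known from \<open>w\<close> of index \<open>i + j + 1\<close>.
  For this reason the entries with \<open>i + j = 3\<close> and \<open>i + j = 4\<close> bring in
  the fourth and fifth coefficients of \<omega>.\<close>

lemma gram_triple:
  assumes "w \<kappa> 0 = 0" "w \<kappa> 1 = 0" "w \<kappa> 2 = 0"
  shows "frm (Y \<kappa> 0) (Y \<kappa> 0) = 0" "frm (Y \<kappa> 0) (Y \<kappa> 1) = 0"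
    "frm (Y \<kappa> 0) (Y \<kappa> 2) = - w \<kappa> 3 * snd (Y \<kappa> 0)"
    "frm (Y \<kappa> 1) (Y \<kappa> 1) = - w \<kappa> 3 * snd (Y \<kappa> 0)"
    "frm (Y \<kappa> 1) (Y \<kappa> 2) = - w \<kappa> 4 * snd (Y \<kappa> 0) - w \<kappa> 3 * snd (Y \<kappa> 1)"
    "frm (Y \<kappa> 2) (Y \<kappa> 2) = - w \<kappa> 5 * snd (Y \<kappa> 0) - w \<kappa> 4 * snd (Y \<kappa> 1) - w \<kappa> 3 * snd (Y \<kappa> 2)"
proof -
  note [simp] = assms eval_nat_numeral
  note g0 = gram_0_Suc[of \<kappa>] and g = gram_Suc_Suc[of \<kappa>]
  show "frm (Y \<kappa> 0) (Y \<kappa> 0) = 0" "frm (Y \<kappa> 0) (Y \<kappa> 1) = 0"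
    using g0[of 0] g0[of 1] assms by (simp_all add: numeral_2_eq_2)
  show 02: "frm (Y \<kappa> 0) (Y \<kappa> 2) = - w \<kappa> 3 * snd (Y \<kappa> 0)"
    using g0[of 2] assms by (simp add: numeral_3_eq_3)
  have 03: "frm (Y \<kappa> 0) (Y \<kappa> 3) = - w \<kappa> 4 * snd (Y \<kappa> 0)"
    using g0[of 3] assms by simp
  have 04: "frm (Y \<kappa> 0) (Y \<kappa> 4) = - w \<kappa> 5 * snd (Y \<kappa> 0)"
    using g0[of 4] assms by simp
  show "frm (Y \<kappa> 1) (Y \<kappa> 1) = - w \<kappa> 3 * snd (Y \<kappa> 0)"
    using g[of 0 1] 02 assms by simp
  show "frm (Y \<kappa> 1) (Y \<kappa> 2) = - w \<kappa> 4 * snd (Y \<kappa> 0) - w \<kappa> 3 * snd (Y \<kappa> 1)"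
    using g[of 0 2] 03 assms by simp
  have 13: "frm (Y \<kappa> 1) (Y \<kappa> 3) = - w \<kappa> 5 * snd (Y \<kappa> 0) - w \<kappa> 4 * snd (Y \<kappa> 1)"
    using g[of 0 3] 04 assms by simp
  show "frm (Y \<kappa> 2) (Y \<kappa> 2) = - w \<kappa> 5 * snd (Y \<kappa> 0) - w \<kappa> 4 * snd (Y \<kappa> 1) - w \<kappa> 3 * snd (Y \<kappa> 2)"
    using g[of 1 2] 13 assms by simp
qed

text \<open>The factor \<open>\<kappa> - \<mu>\<close> in \<open>res_symmetric\<close> is nonzero,
  which gives orthogonality along the chain, one step after the other.\<close>

lemma frm_distinct:
  assumes "w \<mu> 0 = 0" "w \<kappa> 0 = 0" "\<mu> \<noteq> \<kappa>"
  shows "frm (Y \<mu> 0) (Y \<kappa> 0) = 0"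
    "w \<kappa> 1 = 0 \<Longrightarrow> frm (Y \<mu> 0) (Y \<kappa> 1) = 0"
    "w \<kappa> 1 = 0 \<Longrightarrow> w \<kappa> 2 = 0 \<Longrightarrow> frm (Y \<mu> 0) (Y \<kappa> 2) = 0"
proof -
  show 0: "frm (Y \<mu> 0) (Y \<kappa> 0) = 0"
    using res_symmetric[OF res_Y_0[of \<mu>] res_Y_0[of \<kappa>]] assms by simp
  show 1: "frm (Y \<mu> 0) (Y \<kappa> 1) = 0" if "w \<kappa> 1 = 0"
    using res_symmetric[OF res_Y_0[of \<mu>] res_Y_Suc[of \<kappa> 0]] assms 0 that
    by (simp add: frm_comb_right)
  show "frm (Y \<mu> 0) (Y \<kappa> 2) = 0" if "w \<kappa> 1 = 0" "w \<kappa> 2 = 0"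
    using res_symmetric[OF res_Y_0[of \<mu>] res_Y_Suc[of \<kappa> 1]] assms 1 that
    by (simp add: frm_comb_right numeral_2_eq_2)
qed

text \<open>
  If \<open>y\<close> and \<open>y'\<close> both vanished at \<open>1\<close>, so would the constant Wronskian of \<open>y\<close> with any
  other solution.
\<close>

lemma snd_Y_0_nonzero:
  assumes w0: "w \<kappa> 0 = 0"
  shows "snd (Y \<kappa> 0) \<noteq> 0"
proof
  assume "snd (Y \<kappa> 0) = 0"
  then have m: "mm (ca \<kappa> 0) (cb \<kappa> 0) = 0" and n: "nn (ca \<kappa> 0) (cb \<kappa> 0) = 0"
    using w0 by (simp_all add: Y_def w_def)
  have "\<sigma> * cb \<kappa> 0 1 = a * nn (ca \<kappa> 0) (cb \<kappa> 0) - b * mm (ca \<kappa> 0) (cb \<kappa> 0)"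
    "\<sigma> * ca \<kappa> 0 1 = c * nn (ca \<kappa> 0) (cb \<kappa> 0) - d * mm (ca \<kappa> 0) (cb \<kappa> 0)"
    by (simp_all add: algebra_simps)
  then have z: "cb \<kappa> 0 1 = 0" "ca \<kappa> 0 1 = 0"
    unfolding m n using \<sigma>_pos by simp_all
  \<comment> \<open>These initial values make the Wronskian with \<open>ca \<kappa> 0\<close> equal
    to \<open>1\<close> at \<open>0\<close>.\<close>
  obtain u v where uv: "sol q \<kappa> (\<lambda>_. 0) u v" "u 0 = - cos \<beta>" "v 0 = sin \<beta>"
    using sol_exists[OF q continuous_on_const] by blast
  have "((\<lambda>x. ca \<kappa> 0 x * v x - cb \<kappa> 0 x * u x) has_vector_derivative 0) (at x within {0..1})"
    if x: "x \<in> {0..1}" for x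
  proof -
    have "((\<lambda>x. ca \<kappa> 0 x * v x - cb \<kappa> 0 x * u x) has_vector_derivative
        (ca \<kappa> 0 x * ((q x - \<kappa>) * u x - 0) + cb \<kappa> 0 x * v x)
        - (cb \<kappa> 0 x * v x + ((q x - \<kappa>) * ca \<kappa> 0 x - 0) * u x)) (at x within {0..1})"
      using chain_0(1)[of \<kappa>] uv(1) x unfolding sol_def
      by (intro has_vector_derivative_diff has_vector_derivative_mult) auto
    then show ?thesis by (simp add: algebra_simps)
  qed
  from prim_of_deriv[OF this, of 1]
  have "sin \<beta> * sin \<beta> + cos \<beta> * cos \<beta> = 0"
    using z uv by (simp add: chain_0 prim_def)
  then show False using sin_cos_squared_add[of \<beta>] by (simp add: power2_eq_square)
qed

lemma \<omega>_higher_deriv: "(deriv ^^ n) \<omega> (of_real \<kappa>) = fact n * of_real (w \<kappa> n)"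
  by (rule powser_higher_deriv[OF \<omega>_sums])

lemma y_higher_deriv: "x \<in> {0..1} \<Longrightarrow> (deriv ^^ n) (y x) (of_real \<kappa>) = fact n * of_real (ca \<kappa> n x)"
  by (rule powser_higher_deriv[OF y_sums(1)])

lemma \<omega>_zorder:
  assumes "\<omega> z \<noteq> 0" "zorder \<omega> (of_real \<kappa>) = int r"
  shows "n < r \<Longrightarrow> w \<kappa> n = 0" "w \<kappa> r \<noteq> 0"
  using powser_zorder[OF \<omega>_sums assms] by auto

end

section \<open>Completeness of the root vectors\<close>

text \<open>Were the quotient at \<open>l\<close> larger than \<open>H = K m m\<close>, the
  nonincreasing function \<open>?\<phi>\<close> would be negative at \<open>l\<close> and so stay
  below a negative constant on all of \<open>{l..}\<close>. But its first term is nonnegative and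
  its second tends to \<open>0\<close> at infinity; the unbounded range of the kernel is essential
  here.\<close>

lemma pick_kernel_le:
  fixes K :: "real \<Rightarrow> real \<Rightarrow> real"
  assumes nn: "\<And>x. 0 \<le> K x x" and cs: "\<And>x y. (K x y)\<^sup>2 \<le> K x x * K y y"
    and id: "\<And>x y. K x y * (x - y) = G x - G y" and cont: "\<And>y. isCont (\<lambda>x. K x y) y"
    and l: "m < l"
  shows "K l m \<le> K m m"
proof (cases "K m m = 0")
  case True
  then show ?thesis using cs[of l m] by simp
next
  case False
  define H where "H = K m m"
  have H: "0 < H" using nn[of m] False unfolding H_def by linarith
  have dG: "DERIV G x :> K x x" for x
    unfolding CARAT_DERIV using id cont by (intro exI[of _ "\<lambda>z. K z x"]) auto
  have mono: "G x \<le> G z" if "x \<le> z" for x z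
    using that dG nn by (intro DERIV_nonneg_imp_nondecreasing[of x z G]) auto
  show ?thesis
  proof (rule ccontr)
    assume "\<not> K l m \<le> K m m"
    then have big: "H < K l m" by (simp add: H_def)
    then have "H * (l - m) < G l - G m"
      using l by (simp add: id[symmetric])
    moreover have Hl: "0 < H * (l - m)" using H l by simp
    ultimately have Dl: "0 < G l - G m" and lt: "1 / (G l - G m) < 1 / ((l - m) * H)"
      using frac_less2[of 1 1 "H * (l - m)" "G l - G m"] by (linarith, simp add: mult.commute)
    let ?\<phi> = "\<lambda>t. 1 / (G t - G m) - 1 / ((t - m) * H)"
    have dec: "?\<phi> t \<le> ?\<phi> l" if t: "l \<le> t" for t
    proof (rule DERIV_nonpos_imp_nonincreasing[OF t])
      fix x assume x: "l \<le> x" "x \<le> t"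
      have D: "0 < G x - G m" using mono[OF x(1)] Dl by linarith
      have xm: "0 < x - m" using x l by linarith
      have "DERIV ?\<phi> x :> (0 * (G x - G m) - 1 * K x x) / ((G x - G m) * (G x - G m))
          - (0 * ((x - m) * H) - 1 * (1 * H)) / (((x - m) * H) * ((x - m) * H))"
        using D xm H by (auto intro!: derivative_eq_intros dG)
      moreover have "(0 * (G x - G m) - 1 * K x x) / ((G x - G m) * (G x - G m))
          - (0 * ((x - m) * H) - 1 * (1 * H)) / (((x - m) * H) * ((x - m) * H))
          = - (K x x) / (G x - G m)\<^sup>2 + 1 / ((x - m)\<^sup>2 * H)"
        using D xm H by (simp add: power2_eq_square)
      ultimately have "DERIV ?\<phi> x :> - (K x x) / (G x - G m)\<^sup>2 + 1 / ((x - m)\<^sup>2 * H)"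
        by simp
      moreover have "- (K x x) / (G x - G m)\<^sup>2 + 1 / ((x - m)\<^sup>2 * H) \<le> 0"
      proof -
        \<comment> \<open>The sign of the derivative is exactly the two-point Cauchy-Schwarz
          inequality for \<open>x\<close> and \<open>m\<close>.\<close>
        have "(G x - G m)\<^sup>2 = (K x m)\<^sup>2 * (x - m)\<^sup>2"
          using id[of x m] by (metis power_mult_distrib)
        also have "\<dots> \<le> (K x x * H) * (x - m)\<^sup>2"
          using cs[of x m] by (intro mult_right_mono) (auto simp: H_def)
        finally show ?thesis using D xm H by (simp add: field_simps)
      qed
      ultimately show "\<exists>y. DERIV ?\<phi> x :> y \<and> y \<le> 0" by blast
    qed
    define \<delta> where "\<delta> = 1 / ((l - m) * H) - 1 / (G l - G m)"
    have \<delta>: "0 < \<delta>" using lt by (simp add: \<delta>_def)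
    \<comment> \<open>So far out that the second term of \<open>?\<phi>\<close> is at most
      \<open>\<delta> / 2\<close>.\<close>
    define t where "t = max l (m + 2 / (\<delta> * H))"
    have tm: "0 < t - m" and "2 / (\<delta> * H) \<le> t - m" using l by (auto simp: t_def)
    then have "1 / ((t - m) * H) \<le> \<delta> / 2" using \<delta> H by (simp add: field_simps)
    moreover have "0 \<le> 1 / (G t - G m)"
      using mono[of m t] tm by simp
    moreover have "?\<phi> t \<le> - \<delta>" using dec[of t] by (simp add: t_def \<delta>_def)
    ultimately show False using \<delta> by linarith
  qed
qed

text \<open>
  A positive semidefinite kernel \<open>(G x - G y) / (x - y)\<close> on the whole real line is constant.
  The two-point Cauchy-Schwarz inequality says that \<open>1 / (G x - G y) - 1 / ((x - y) G' y)\<close> is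
  monotone in \<open>x\<close>, so every difference quotient of \<open>G\<close> is at most the derivative at both ends
  of the interval.
\<close>

lemma pick_kernel_constant:
  fixes K :: "real \<Rightarrow> real \<Rightarrow> real"
  assumes nn: "\<And>x. 0 \<le> K x x" and cs: "\<And>x y. (K x y)\<^sup>2 \<le> K x x * K y y"
    and id: "\<And>x y. K x y * (x - y) = G x - G y" and cont: "\<And>y. isCont (\<lambda>x. K x y) y"
  shows "K l m = K m m"
proof -
  have dG: "DERIV G x :> K x x" for x
    unfolding CARAT_DERIV using id cont by (intro exI[of _ "\<lambda>z. K z x"]) auto
  have sym: "K x y = K y x" for x y
  proof (cases "x = y")
    case False
    have "K x y * (x - y) = K y x * (x - y)" using id[of x y] id[of y x] by (simp add: algebra_simps)
    then show ?thesis using False by simp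
  qed simp
  have le: "K x y \<le> K y y" if "x \<noteq> y" for x y
  proof (cases "y < x")
    case True
    then show ?thesis by (rule pick_kernel_le[OF nn cs id cont])
  next
    case False
    \<comment> \<open>The reflection \<open>x \<mapsto> - x\<close> turns the kernel into one of the
      same kind, with \<open>- G (- x)\<close> in place of \<open>G\<close>, and exchanges the two
      sides of \<open>y\<close>.\<close>
    have c': "isCont (\<lambda>x. K (- x) (- y)) y" for y
      by (rule isCont_o2[of _ uminus]) (use cont in auto)
    have "K (- (- x)) (- (- y)) \<le> K (- (- y)) (- (- y))"
    proof (rule pick_kernel_le[of "\<lambda>x y. K (- x) (- y)" "\<lambda>x. - G (- x)" "- y" "- x"])
      show "K (- x) (- y) * (x - y) = - G (- x) - - G (- y)" for x y
        using id[of "- x" "- y"] by (simp add: algebra_simps)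
    qed (use nn cs c' False that in auto)
    then show ?thesis by simp
  qed
  \<comment> \<open>The derivative of \<open>t \<mapsto> K t m\<close> is
    \<open>(K t t - K t m) / (t - m)\<close>, and the upper bound just proved, taken at the endpoint
    \<open>t\<close>, makes it nonnegative. The claim is stated for arbitrary kernels so that it
    also applies to the reflected one.\<close>
  have ge: "K m m \<le> K l m" if "m < l" and nn: "\<And>x. 0 \<le> K x x" and dG: "\<And>x. DERIV G x :> K x x"
    and id: "\<And>x y. K x y * (x - y) = G x - G y" and cont: "\<And>y. isCont (\<lambda>x. K x y) y"
    and le: "\<And>x y. x \<noteq> y \<Longrightarrow> K y x \<le> K y y"
    for K :: "real \<Rightarrow> real \<Rightarrow> real" and G l m
  proof -
    have dK: "DERIV (\<lambda>t. K t m) t :> (K t t - K t m) / (t - m)" if t: "m < t" for t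
    proof -
      have eq: "K x m = (G x - G m) / (x - m)" if "x \<noteq> m" for x
        using id[of x m] that by (simp add: field_simps)
      have "DERIV (\<lambda>x. (G x - G m) / (x - m)) t :> (K t t * (t - m) - (G t - G m)) / ((t - m) * (t - m))"
        using t by (auto intro!: derivative_eq_intros dG)
      moreover have "(K t t * (t - m) - (G t - G m)) / ((t - m) * (t - m)) = (K t t - K t m) / (t - m)"
        unfolding id[symmetric] left_diff_distrib[symmetric] using t by simp
      ultimately have "DERIV (\<lambda>x. (G x - G m) / (x - m)) t :> (K t t - K t m) / (t - m)"
        by simp
      moreover have "\<forall>\<^sub>F x in nhds t. (G x - G m) / (x - m) = K x m"
        using eventually_nhds_in_open[of "{m<..}" t] t by (auto elim!: eventually_mono simp: eq)
      ultimately show ?thesis by (subst (asm) DERIV_cong_ev[OF refl _ refl]) 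
    qed
    have "continuous_on {m..l} (\<lambda>t. K t m)"
    proof (intro continuous_at_imp_continuous_on ballI)
      fix x assume "x \<in> {m..l}"
      then show "isCont (\<lambda>t. K t m) x"
        by (cases "x = m") (use cont DERIV_isCont[OF dK[of x]] in auto)
    qed
    then show ?thesis
    proof (rule DERIV_nonneg_imp_increasing_open[rotated 2, of m l "\<lambda>t. K t m"])
      fix x assume "m < x" "x < l"
      then show "\<exists>y. DERIV (\<lambda>t. K t m) x :> y \<and> 0 \<le> y"
        using dK[of x] le[of m x] by (intro exI[of _ "(K x x - K x m) / (x - m)"]) auto
    qed (use that in auto)
  qed
  consider "l = m" | "m < l" | "l < m" by linarith
  then show ?thesis
  proof cases
    case 2
    have "K m m \<le> K l m" by (rule ge[OF 2 nn dG id cont]) (use le sym in metis)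
    then show ?thesis using le[of l m] 2 by simp
  next
    case 3
    have c': "isCont (\<lambda>x. K (- x) (- y)) y" for y
      by (rule isCont_o2[of _ uminus]) (use cont in auto)
    have dG': "DERIV (\<lambda>x. - G (- x)) x :> K (- x) (- x)" for x
    proof -
      have "DERIV uminus x :> (-1 :: real)" by (auto intro!: derivative_eq_intros)
      from DERIV_minus[OF DERIV_chain2[OF dG[of "- x"] this]] show ?thesis by simp
    qed
    have "K (- (- m)) (- (- m)) \<le> K (- (- l)) (- (- m))"
    proof (rule ge[of "- m" "- l" "\<lambda>x y. K (- x) (- y)" "\<lambda>x. - G (- x)"])
      show "K (- x) (- y) * (x - y) = - G (- x) - - G (- y)" for x y
        using id[of "- x" "- y"] by (simp add: algebra_simps)
      show "K (- y) (- x) \<le> K (- y) (- y)" if "x \<noteq> y" for x y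
        using le[of "- x" "- y"] that sym[of "- x" "- y"] by simp
    qed (use nn dG' c' 3 in auto)
    then show ?thesis using le[of l m] 3 by simp
  qed simp
qed

section \<open>Limits and continuity in the spectral parameter\<close>

lemma rip_tendsto:
  assumes ul: "uniform_limit {0..1} f g F" and f: "\<And>i. continuous_on {0..1} (f i)"
    and g: "continuous_on {0..1} g" and p: "continuous_on {0..1} p"
  shows "((\<lambda>i. rip (f i) p) \<longlongrightarrow> rip g p) F"
proof (rule tendstoI)
  fix e :: real assume e: "0 < e"
  let ?B = "prim (\<lambda>t. \<bar>p t\<bar>) 1"
  have B: "0 \<le> ?B" by (intro prim_nonneg continuous_intros p) auto
  have "\<forall>\<^sub>F i in F. \<forall>x\<in>{0..1}. dist (f i x) (g x) < e / (?B + 1)"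
    using e B by (intro uniform_limitD[OF ul]) auto
  then show "\<forall>\<^sub>F i in F. dist (rip (f i) p) (rip g p) < e"
  proof eventually_elim
    case (elim i)
    have "rip (f i) p - rip g p = rip (\<lambda>x. f i x + (-1) * g x) p"
      using rip_add_left[OF f g p, of i "-1"] by simp
    also have "norm \<dots> \<le> prim (\<lambda>t. e / (?B + 1) * \<bar>p t\<bar>) 1"
      unfolding rip_def
    proof (rule norm_prim_le)
      fix t :: real assume "t \<in> {0..1}"
      then have "\<bar>f i t - g t\<bar> \<le> e / (?B + 1)" using elim by (auto simp: dist_real_def less_imp_le)
      then show "norm ((f i t + - 1 * g t) * p t) \<le> e / (?B + 1) * \<bar>p t\<bar>"
        using mult_right_mono[of _ _ "\<bar>p t\<bar>"] by (force simp: abs_mult)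
    qed (use B in \<open>auto intro!: continuous_intros f g p\<close>)
    also have "\<dots> = e / (?B + 1) * ?B" by (rule prim_mult_left)
    also have "\<dots> < e" using e B by (simp add: field_simps)
    finally show ?case by (simp add: dist_real_def)
  qed
qed

context sl_problem
begin

lemma res_zero:
  assumes "res \<nu> P Z" "\<And>x. x \<in> {0..1} \<Longrightarrow> fst Z x = 0" "snd Z = 0"
  shows "\<And>x. x \<in> {0..1} \<Longrightarrow> fst P x = 0" "snd P = 0"
proof -
  obtain v where v: "sol q \<nu> (fst P) (fst Z) v" "snd Z = mm (fst Z) v" "snd P = - nn (fst Z) v - \<nu> * snd Z"
    using assms(1) unfolding res_def by blast
  have uz: "e = 0" if "(f has_vector_derivative e) (at x within {0..1})" "\<And>x. x \<in> {0..1} \<Longrightarrow> f x = 0" "x \<in> {0..1}"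
    for f :: "real \<Rightarrow> real" and e x
  proof -
    have "((\<lambda>_. 0) has_vector_derivative e) (at x within {0..1})"
      by (rule has_vector_derivative_transform[OF that(3) _ that(1)]) (use that(2) in auto)
    from vector_derivative_unique_within_closed_interval[OF _ _ this[folded box_real(2)] has_vector_derivative_const] that(3)
    show ?thesis by simp
  qed
  have v0: "v x = 0" if "x \<in> {0..1}" for x
    using uz[of "fst Z", OF _ assms(2) that] v(1) that unfolding sol_def by blast
  have "(q x - \<nu>) * fst Z x - fst P x = 0" if "x \<in> {0..1}" for x
    using uz[of v, OF _ v0 that] v(1) that unfolding sol_def by blast
  then show "\<And>x. x \<in> {0..1} \<Longrightarrow> fst P x = 0" using assms(2) by simp
  show "snd P = 0" using v(3) assms(2)[of 1] assms(3) v0[of 1] by simp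
qed

lemma isCont_frm_Y: "cpair P \<Longrightarrow> isCont (\<lambda>l. frm P (Y l 0)) \<nu>"
  by (rule isCont_shifted_powser[where f = "\<lambda>l. frm P (Y l 0)" and e = "\<lambda>n. frm P (Y \<nu> n)"]) (rule frm_Y_sums)

lemma isCont_snd_Y: "isCont (\<lambda>l. snd (Y l 0)) \<nu>"
  by (rule isCont_shifted_powser[where f = "\<lambda>l. snd (Y l 0)" and e = "\<lambda>n. snd (Y \<nu> n)"]) (rule snd_Y_sums)

lemma isCont_w: "isCont (\<lambda>l. w l 0) \<nu>"
  by (rule isCont_shifted_powser[where f = "\<lambda>l. w l 0" and e = "\<lambda>n. w \<nu> n"]) (rule w_sums)

text \<open>The difference of the solutions for \<open>l\<close> and \<open>\<nu>\<close> solves the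
  equation at \<open>\<nu>\<close> with source \<open>(l - \<nu>) * u l\<close>, so a single
  constant from \<open>sol_bound\<close>, that of \<open>\<nu>\<close>, controls it.\<close>

lemma zero_initial_continuous_in_parameter:
  assumes g: "continuous_on {0..1} g"
    and uv: "\<And>l. sol q l g (u l) (v l)" "\<And>l. u l 0 = 0" "\<And>l. v l 0 = 0"
  shows "uniform_limit {0..1} u (u \<nu>) (at \<nu>)" "uniform_limit {0..1} v (v \<nu>) (at \<nu>)"
proof -
  obtain M where M: "0 \<le> M" and bd:
    "\<And>g u v x. sol q \<nu> g u v \<Longrightarrow> continuous_on {0..1} g \<Longrightarrow> u 0 = 0 \<Longrightarrow> v 0 = 0 \<Longrightarrow> x \<in> {0..1} \<Longrightarrow>
       \<bar>u x\<bar> \<le> M * prim (\<lambda>t. \<bar>g t\<bar>) x \<and> \<bar>v x\<bar> \<le> M * prim (\<lambda>t. \<bar>g t\<bar>) x"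
    using sol_bound[OF q] by blast
  have cu: "continuous_on {0..1} (u l)" for l using sol_continuous(1)[OF uv(1)] .
  define I where "I l = prim (\<lambda>t. \<bar>u l t\<bar>) 1" for l
  have I0: "0 \<le> I l" for l unfolding I_def by (intro prim_nonneg continuous_intros cu) auto
  have d: "\<bar>u l x - u \<nu> x\<bar> \<le> M * \<bar>l - \<nu>\<bar> * I l \<and> \<bar>v l x - v \<nu> x\<bar> \<le> M * \<bar>l - \<nu>\<bar> * I l" if x: "x \<in> {0..1}" for l x
  proof -
    have s: "sol q \<nu> (\<lambda>x. (l - \<nu>) * u l x) (\<lambda>x. u l x + (-1) * u \<nu> x) (\<lambda>x. v l x + (-1) * v \<nu> x)"
      using sol_lincomb[OF sol_shift[OF uv(1)[of l], of \<nu>] uv(1)[of \<nu>], of "-1"] by simp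
    have "prim (\<lambda>t. \<bar>(l - \<nu>) * u l t\<bar>) x = \<bar>l - \<nu>\<bar> * prim (\<lambda>t. \<bar>u l t\<bar>) x"
      by (simp add: abs_mult prim_mult_left)
    also have "\<dots> \<le> \<bar>l - \<nu>\<bar> * I l"
      unfolding I_def using x by (intro mult_left_mono prim_mono continuous_intros cu) auto
    finally have "M * prim (\<lambda>t. \<bar>(l - \<nu>) * u l t\<bar>) x \<le> M * (\<bar>l - \<nu>\<bar> * I l)"
      using M by (rule mult_left_mono)
    then show ?thesis
      using bd[OF s _ _ _ x] uv cu by (force intro!: continuous_intros simp: mult.assoc)
  qed
  \<comment> \<open>The source still contains the unknown \<open>u l\<close>; for \<open>l\<close>
    close to \<open>\<nu>\<close> its contribution is at most half of \<open>I l\<close> and is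
    absorbed on the left.\<close>
  have Il: "I l \<le> 2 * I \<nu>" if l: "M * \<bar>l - \<nu>\<bar> \<le> 1 / 2" for l
  proof -
    have "I l \<le> prim (\<lambda>t. \<bar>u \<nu> t\<bar> + M * \<bar>l - \<nu>\<bar> * I l * t ^ 0) 1"
      unfolding I_def[of l] using d[of _ l] by (intro prim_le continuous_intros cu) (force simp: I_def[symmetric])+
    also have "\<dots> = I \<nu> + M * \<bar>l - \<nu>\<bar> * I l"
      using prim_power[of 1 0] by (subst prim_add) (auto intro!: continuous_intros cu simp: I_def prim_mult_left simp del: power_0)
    also have "\<dots> \<le> I \<nu> + 1 / 2 * I l"
      using l I0[of l] by (intro add_left_mono mult_right_mono) auto
    finally show ?thesis by simp
  qed
  have ev: "\<forall>\<^sub>F l in at \<nu>. \<forall>x\<in>{0..1}. dist (u l x) (u \<nu> x) < e \<and> dist (v l x) (v \<nu> x) < e" if e: "0 < e" for e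
  proof -
    have "((\<lambda>l. M * \<bar>l - \<nu>\<bar>) \<longlongrightarrow> M * \<bar>\<nu> - \<nu>\<bar>) (at \<nu>)"
      by (intro tendsto_intros)
    then have "((\<lambda>l. M * \<bar>l - \<nu>\<bar>) \<longlongrightarrow> 0) (at \<nu>)" by simp
    from order_tendstoD(2)[OF this, of "min (1/2) (e / (2 * I \<nu> + 1))"]
    have "\<forall>\<^sub>F l in at \<nu>. M * \<bar>l - \<nu>\<bar> < min (1/2) (e / (2 * I \<nu> + 1))"
      using e I0[of \<nu>] by simp
    then show ?thesis
    proof eventually_elim
      case (elim l)
      have "M * \<bar>l - \<nu>\<bar> * I l \<le> M * \<bar>l - \<nu>\<bar> * (2 * I \<nu>)"
        using elim M Il[of l] by (intro mult_left_mono) auto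
      also have "\<dots> \<le> M * \<bar>l - \<nu>\<bar> * (2 * I \<nu> + 1)"
        using M by (intro mult_left_mono) auto
      also have "\<dots> < e" using elim I0[of \<nu>] by (simp add: field_simps)
      finally show ?case using d[of _ l] by (force simp: dist_real_def)
    qed
  qed
  show "uniform_limit {0..1} u (u \<nu>) (at \<nu>)" "uniform_limit {0..1} v (v \<nu>) (at \<nu>)"
    by (rule uniform_limitI, drule ev, erule eventually_mono, blast)+
qed

lemma frm_cong:
  "(\<And>x. x \<in> {0..1} \<Longrightarrow> fst P x = fst P' x) \<Longrightarrow> snd P = snd P' \<Longrightarrow> frm P R = frm P' R"
  unfolding frm_def using rip_cong[of "fst P" "fst P'" "fst R" "fst R"] by simp

lemma frm_tendsto:
  assumes "uniform_limit {0..1} (\<lambda>i. fst (P i)) (fst Q) F" "((\<lambda>i. snd (P i)) \<longlongrightarrow> snd Q) F"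
    "\<And>i. cpair (P i)" "cpair Q" "cpair R"
  shows "((\<lambda>i. frm (P i) R) \<longlongrightarrow> frm Q R) F"
  unfolding frm_def using assms
  by (intro tendsto_diff tendsto_mult tendsto_const rip_tendsto) (auto simp: cpair_def)

lemma w_nonzero_near:
  assumes "\<And>n. n < r \<Longrightarrow> w l n = 0" "w l r \<noteq> 0"
  shows "\<forall>\<^sub>F t in at l. w t 0 \<noteq> 0"
proof -
  obtain g where g: "\<And>h. w (l + h) 0 = h ^ r * g h" "isCont g 0" "g 0 = w l r"
    by (rule powser_factor[where f = "\<lambda>h. w (l + h) 0" and r = r and e = "w l", OF w_sums])
      (use assms in auto)
  have "\<forall>\<^sub>F h in at 0. g h \<noteq> 0"
    using g(2,3) assms(2) by (intro tendsto_imp_eventually_ne[of g "g 0"]) (auto simp: isCont_def)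
  then have "\<forall>\<^sub>F h in at 0. w (l + h) 0 \<noteq> 0"
    using eventually_neq_at_within[of 0 0 UNIV] by eventually_elim (simp add: g(1))
  then show ?thesis by (subst at_to_0) (simp add: eventually_filtermap add.commute)
qed

text \<open>Numerator and denominator are both divisible by the \<open>r\<close>-th power of the
  increment, and the cofactor of the denominator does not vanish at \<open>l\<close>.\<close>

lemma quotient_limit:
  assumes P: "cpair P" and w: "\<And>n. n < r \<Longrightarrow> w l n = 0" "w l r \<noteq> 0"
    and z: "\<And>n. n < r \<Longrightarrow> frm P (Y l n) = 0"
  shows "\<exists>L. ((\<lambda>t. frm P (Y t 0) / w t 0) \<longlongrightarrow> L) (at l)"
proof -
  obtain g where g: "\<And>h. w (l + h) 0 = h ^ r * g h" "isCont g 0" "g 0 = w l r"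
    by (rule powser_factor[where f = "\<lambda>h. w (l + h) 0" and r = r and e = "w l", OF w_sums])
      (use w in auto)
  obtain f where f: "\<And>h. frm P (Y (l + h) 0) = h ^ r * f h" "isCont f 0"
    by (rule powser_factor[where f = "\<lambda>h. frm P (Y (l + h) 0)" and r = r and e = "\<lambda>n. frm P (Y l n)", OF frm_Y_sums[OF P]])
      (use z in auto)
  have "((\<lambda>h. f h / g h) \<longlongrightarrow> f 0 / g 0) (at 0)"
    using g f w by (intro tendsto_divide) (auto simp: isCont_def)
  moreover have "\<forall>\<^sub>F h in at 0. f h / g h = frm P (Y (h + l) 0) / w (h + l) 0"
    using eventually_neq_at_within[of 0 0 UNIV]
  proof eventually_elim
    case (elim h)
    then show ?case using g(1)[of h] f(1)[of h] by (simp add: add.commute[of h l])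
  qed
  ultimately have "((\<lambda>h. frm P (Y (h + l) 0) / w (h + l) 0) \<longlongrightarrow> f 0 / g 0) (at 0)"
    by (rule Lim_transform_eventually)
  then show ?thesis by (subst at_to_0) (auto simp: filterlim_filtermap)
qed

text \<open>
  A vector \<open>W\<close> orthogonal to all root vectors has an entire resolvent orbit \<open>U \<lambda>\<close>. As \<open>U \<lambda>\<close> is
  orthogonal to the neutral vector \<open>Y \<kappa> 0\<close>, the form is positive semidefinite on the orbit and
  \<open>frm (U \<lambda>) (U \<nu>)\<close> is a kernel as in \<open>pick_kernel_constant\<close>, so the orbit is constant.
\<close>

lemma root_vectors_complete:
  assumes triple: "w \<kappa> 0 = 0" "w \<kappa> 1 = 0" "w \<kappa> 2 = 0" "w \<kappa> 3 \<noteq> 0"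
    and simple: "\<And>l. w l 0 = 0 \<Longrightarrow> l \<noteq> \<kappa> \<Longrightarrow> w l 1 \<noteq> 0"
    and W: "cpair W" and W0: "\<And>l. w l 0 = 0 \<Longrightarrow> frm W (Y l 0) = 0"
    and W12: "frm W (Y \<kappa> 1) = 0" "frm W (Y \<kappa> 2) = 0"
  shows "\<And>x. x \<in> {0..1} \<Longrightarrow> fst W x = 0" "snd W = 0"
proof -
  have cW: "continuous_on {0..1} (fst W)" using W by (simp add: cpair_def)
  have "\<exists>u v. sol q l (fst W) u v \<and> u 0 = 0 \<and> v 0 = 0" for l
    using sol_exists[OF q cW] by blast
  then obtain u v where uv: "\<And>l. sol q l (fst W) (u l) (v l)" "\<And>l. u l 0 = 0" "\<And>l. v l 0 = 0"
    by metis
  \<comment> \<open>\<open>P l\<close> solves all but the scalar equation, where it errs by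
    \<open>N l\<close>. Adding \<open>e l\<close> times \<open>Y l 0\<close>, whose own error is
    \<open>- w l 0\<close>, repairs this as soon as \<open>e l * w l 0 = - N l\<close>.\<close>
  define P where "P l = (u l, mm (u l) (v l))" for l
  define N where "N l = snd W + nn (u l) (v l) + l * mm (u l) (v l)" for l
  have cP: "cpair (P l)" for l using sol_continuous(1)[OF uv(1)] by (simp add: cpair_def P_def)
  have resP: "res l (fst W, snd W - N l) (P l)" for l
    unfolding res_def using cW uv by (auto simp: cpair_def P_def N_def intro!: exI[of _ "v l"])
  \<comment> \<open>This ties \<open>N\<close> to \<open>frm W (Y l 0)\<close>, which vanishes at
    the zeros of \<open>w\<close> at least to their order; hence \<open>N / w\<close> has a limit
    everywhere.\<close>
  have Nm: "N l * snd (Y l 0) = snd (P l) * w l 0 - frm W (Y l 0)" for l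
  proof -
    have "frm (fst W, snd W - N l) (Y l 0) = frm W (Y l 0) + N l * snd (Y l 0)"
      by (simp add: frm_def algebra_simps)
    then show ?thesis using res_symmetric[OF resP[of l] res_Y_0[of l]] by simp
  qed
  have ul: "uniform_limit {0..1} u (u l) (at l)" "uniform_limit {0..1} v (v l) (at l)" for l
    by (rule zero_initial_continuous_in_parameter[OF cW uv])+
  have u1: "((\<lambda>t. u t 1) \<longlongrightarrow> u l 1) (at l)" and v1: "((\<lambda>t. v t 1) \<longlongrightarrow> v l 1) (at l)" for l
    using tendsto_uniform_limitI[OF ul(1)] tendsto_uniform_limitI[OF ul(2)] by auto
  have contN: "isCont N l" for l
    unfolding isCont_def N_def by (intro tendsto_intros u1 v1)
  have contPs: "isCont (\<lambda>t. snd (P t)) l" for l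
    unfolding isCont_def P_def using u1 v1 by (auto intro!: tendsto_intros)
  have contP: "isCont (\<lambda>t. frm (P t) R) l" if "cpair R" for R l
    unfolding isCont_def
  proof (rule frm_tendsto[OF _ _ cP cP that])
    show "uniform_limit {0..1} (\<lambda>t. fst (P t)) (fst (P l)) (at l)" using ul(1) by (simp add: P_def)
    show "((\<lambda>t. snd (P t)) \<longlongrightarrow> snd (P l)) (at l)" using contPs by (simp add: isCont_def)
  qed
  have N0: "N l = 0" if "w l 0 = 0" for l
    using Nm[of l] that W0[OF that] snd_Y_0_nonzero[OF that] by simp
  have near: "\<forall>\<^sub>F t in at l. w t 0 \<noteq> 0" for l
  proof -
    consider "w l 0 \<noteq> 0" | "l = \<kappa>" | "w l 0 = 0" "l \<noteq> \<kappa>" by blast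
    then show ?thesis
    proof cases
      case 1
      then show ?thesis by (intro w_nonzero_near[of 0]) auto
    next
      case 2
      show ?thesis
      proof (rule w_nonzero_near[of 3])
        show "w l n = 0" if "n < 3" for n
          using that triple 2 by (auto simp: eval_nat_numeral less_Suc_eq)
      qed (use 2 triple in simp)
    next
      case 3
      then show ?thesis using simple[of l] by (intro w_nonzero_near[of 1]) auto
    qed
  qed
  have lim: "\<exists>L. ((\<lambda>t. - N t / w t 0) \<longlongrightarrow> L) (at l)" for l
  proof (cases "w l 0 = 0")
    case False
    have "((\<lambda>t. - N t / w t 0) \<longlongrightarrow> - N l / w l 0) (at l)"
      using contN[of l] isCont_w[of l] False by (intro tendsto_intros) (auto simp: isCont_def)
    then show ?thesis by blast
  next
    case True
    have "\<exists>L. ((\<lambda>t. frm W (Y t 0) / w t 0) \<longlongrightarrow> L) (at l)"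
    proof (cases "l = \<kappa>")
      case True
      show ?thesis
      proof (rule quotient_limit[OF W, of 3])
        show "w l n = 0" if "n < 3" for n
          using that triple True by (auto simp: eval_nat_numeral less_Suc_eq)
        show "frm W (Y l n) = 0" if "n < 3" for n
          using that W0[OF triple(1)] W12 True by (auto simp: eval_nat_numeral less_Suc_eq)
      qed (use True triple in simp)
    next
      case False
      then show ?thesis using simple[of l] W0[of l] True by (intro quotient_limit[OF W, of 1]) auto
    qed
    then obtain L where L: "((\<lambda>t. frm W (Y t 0) / w t 0) \<longlongrightarrow> L) (at l)" by blast
    have nz: "snd (Y l 0) \<noteq> 0" by (rule snd_Y_0_nonzero[OF True])
    have Yl: "((\<lambda>t. snd (Y t 0)) \<longlongrightarrow> snd (Y l 0)) (at l)"
      using isCont_snd_Y by (simp add: isCont_def)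
    have "((\<lambda>t. (frm W (Y t 0) / w t 0 - snd (P t)) / snd (Y t 0)) \<longlongrightarrow> (L - snd (P l)) / snd (Y l 0)) (at l)"
      using contPs[of l] nz by (intro tendsto_divide tendsto_diff L Yl) (auto simp: isCont_def)
    moreover have "\<forall>\<^sub>F t in at l. (frm W (Y t 0) / w t 0 - snd (P t)) / snd (Y t 0) = - N t / w t 0"
      using near tendsto_imp_eventually_ne[OF Yl nz]
    proof eventually_elim
      case (elim t)
      then have "N t = (snd (P t) * w t 0 - frm W (Y t 0)) / snd (Y t 0)"
        using Nm[of t] by (simp add: field_simps)
      then show ?case using elim by (simp add: diff_divide_distrib)
    qed
    ultimately show ?thesis by (blast intro: Lim_transform_eventually)
  qed
  \<comment> \<open>The continuous extension of \<open>- N / w\<close> across the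
    eigenvalues.\<close>
  define e where "e l = (if w l 0 = 0 then Lim (at l) (\<lambda>t. - N t / w t 0) else - N l / w l 0)" for l
  have ew: "e l * w l 0 = - N l" for l
    using N0 by (simp add: e_def)
  have conte: "isCont e l" for l
  proof -
    obtain L where L: "((\<lambda>t. - N t / w t 0) \<longlongrightarrow> L) (at l)" using lim by blast
    have eL: "e l = L"
    proof (cases "w l 0 = 0")
      case True
      then show ?thesis using tendsto_Lim[OF _ L] by (simp add: e_def)
    next
      case False
      have "((\<lambda>t. - N t / w t 0) \<longlongrightarrow> - N l / w l 0) (at l)"
        using contN[of l] isCont_w[of l] False by (intro tendsto_intros) (auto simp: isCont_def)
      then show ?thesis using tendsto_unique[OF _ L] False by (simp add: e_def)
    qed
    have "\<forall>\<^sub>F t in at l. - N t / w t 0 = e t"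
      using near by eventually_elim (simp add: e_def)
    with L show ?thesis unfolding isCont_def eL by (rule Lim_transform_eventually)
  qed
  define U where "U l = comb (P l) (e l) (Y l 0)" for l
  have resU: "res l W (U l)" for l
  proof -
    have "comb (fst W, snd W - N l) (e l) ((\<lambda>_. 0), - w l 0) = W"
      using ew[of l] by (simp add: comb_def)
    then show ?thesis using res_comb[OF resP[of l] res_Y_0[of l], of "e l"] by (simp add: U_def)
  qed
  have cU: "cpair (U l)" for l using res_cpair(2)[OF resU] .
  have contU: "isCont (\<lambda>t. frm (U t) R) l" if R: "cpair R" for R l
  proof -
    have "isCont (\<lambda>t. frm (Y t 0) R) l" using isCont_frm_Y[OF R] by (simp add: frm_commute[of R])
    then show ?thesis unfolding U_def using contP[OF R] conte by (simp add: frm_comb_left cP R)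
  qed
  \<comment> \<open>At \<open>l = \<kappa>\<close> the eigenvector equation of
    \<open>Y \<kappa> 0\<close> gives no information; there \<open>Y \<kappa> 0\<close> is used as
    the image of \<open>Y \<kappa> 1\<close> instead.\<close>
  have U0: "frm (U l) (Y \<kappa> 0) = 0" for l
  proof (cases "l = \<kappa>")
    case True
    then show ?thesis
      using res_symmetric[OF resU[of l] res_Y_Suc[of \<kappa> 0]] W12 triple cU
      by (simp add: frm_comb_right)
  next
    case False
    then show ?thesis
      using res_symmetric[OF resU[of l] res_Y_0[of \<kappa>]] W0[OF triple(1)] triple by simp
  qed
  let ?m = "snd (Y \<kappa> 0)"
  have m: "?m \<noteq> 0" by (rule snd_Y_0_nonzero[OF triple(1)])
  have Y00: "frm (Y \<kappa> 0) (Y \<kappa> 0) = 0" by (rule gram_triple(1)[OF triple(1-3)])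
  \<comment> \<open>The vector \<open>Y \<kappa> 0\<close> is neutral and orthogonal to the orbit,
    so subtracting multiples of it leaves the form unchanged. The multiple is chosen to clear the
    scalar component, the only place where the form is negative.\<close>
  define \<tau> where "\<tau> l = snd (U l) / ?m" for l
  define Q where "Q l = comb (U l) (- \<tau> l) (Y \<kappa> 0)" for l
  have cQ: "cpair (Q l)" for l unfolding Q_def by (intro cpair_comb cU cpair_Y)
  have K: "frm (U l) (U n) = \<sigma> * rip (fst (Q l)) (fst (Q n))" for l n
  proof -
    have "snd (Q l) = 0" for l using m by (simp add: Q_def comb_def \<tau>_def)
    then have "\<sigma> * rip (fst (Q l)) (fst (Q n)) = frm (Q l) (Q n)" by (simp add: frm_def)
    also have "\<dots> = frm (U l) (U n)"
    proof -
      have "frm (Q l) (Y \<kappa> 0) = 0" using U0 Y00 cU by (simp add: Q_def frm_comb_left)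
      then have "frm (Q l) (Q n) = frm (Q l) (U n)"
        using cQ[of l] cU by (simp add: Q_def[of n] frm_comb_right)
      also have "\<dots> = frm (U l) (U n)"
        using U0[of n] cU by (simp add: Q_def frm_comb_left frm_commute[of "Y \<kappa> 0" "U n"])
      finally show ?thesis .
    qed
    finally show ?thesis by simp
  qed
  have cont: "isCont (\<lambda>x. frm (U x) (U y)) y" for y using contU cU by blast
  have const: "frm (U l) (U n) = frm (U n) (U n)" for l n
  proof (rule pick_kernel_constant[where K = "\<lambda>l n. frm (U l) (U n)" and G = "\<lambda>l. frm (U l) W"])
    show "0 \<le> frm (U x) (U x)" for x
      unfolding K using \<sigma>_pos rip_nonneg[of "fst (Q x)"] cQ[of x] by (simp add: cpair_def)
    show "(frm (U x) (U y))\<^sup>2 \<le> frm (U x) (U x) * frm (U y) (U y)" for x y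
    proof -
      have "(rip (fst (Q x)) (fst (Q y)))\<^sup>2 \<le> rip (fst (Q x)) (fst (Q x)) * rip (fst (Q y)) (fst (Q y))"
        using cQ by (intro rip_Cauchy_Schwarz) (auto simp: cpair_def)
      then have "\<sigma>\<^sup>2 * (rip (fst (Q x)) (fst (Q y)))\<^sup>2 \<le> \<sigma>\<^sup>2 * (rip (fst (Q x)) (fst (Q x)) * rip (fst (Q y)) (fst (Q y)))"
        by (rule mult_left_mono) simp
      then show ?thesis unfolding K by (simp only: power_mult_distrib power2_eq_square mult_ac)
    qed
    show "frm (U x) (U y) * (x - y) = frm (U x) W - frm (U y) W" for x y
      using res_symmetric[OF resU[of x] resU[of y]] frm_commute[of W "U y"] by (simp add: algebra_simps)
  qed (rule cont)
  \<comment> \<open>Any two distinct parameters different from \<kappa> would do.\<close>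
  define l n where "l = \<kappa> + 1" and "n = \<kappa> + 2"
  have ln: "l \<noteq> \<kappa>" "n \<noteq> \<kappa>" "l \<noteq> n" by (simp_all add: l_def n_def)
  have cq: "continuous_on {0..1} (fst (Q l))" "continuous_on {0..1} (fst (Q n))" using cQ by (auto simp: cpair_def)
  have Qeq: "fst (Q l) x = fst (Q n) x" if x: "x \<in> {0..1}" for x
  proof -
    let ?d = "\<lambda>x. fst (Q l) x + (-1) * fst (Q n) x"
    have cd: "continuous_on {0..1} ?d" by (intro continuous_intros cq)
    have "\<sigma> * rip ?d ?d = frm (U l) (U l) - frm (U l) (U n) - (frm (U n) (U l) - frm (U n) (U n))"
      unfolding K rip_add_left[OF cq cd] rip_add_right[OF cq cq(1)] rip_add_right[OF cq cq(2)]
      by (simp add: algebra_simps)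
    also have "\<dots> = 0"
      using const[of l n] const[of n l] by simp
    finally have "rip ?d ?d = 0" using \<sigma>_pos by simp
    from rip_eq_0D[OF cd this x] show ?thesis by simp
  qed
  have U2: "frm (U l) (Y \<kappa> 2) = 0" if "l \<noteq> \<kappa>" for l
  proof -
    have 1: "frm (U l) (Y \<kappa> 1) = 0"
      using res_symmetric[OF resU[of l] res_Y_Suc[of \<kappa> 0]] W12 triple cU U0 that
      by (simp add: frm_comb_right)
    then show ?thesis
      using res_symmetric[OF resU[of l] res_Y_Suc[of \<kappa> 1]] W12 triple cU that
      by (simp add: frm_comb_right numeral_2_eq_2)
  qed
  \<comment> \<open>The orbit could still move along \<open>Y \<kappa> 0\<close>, which the form on
    the orbit does not see. Pairing with \<open>Y \<kappa> 2\<close>, which is not orthogonal to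
    \<open>Y \<kappa> 0\<close>, excludes this.\<close>
  define D where "D = comb (U l) (-1) (U n)"
  have sD: "snd D = (\<tau> l - \<tau> n) * ?m" using m by (simp add: D_def comb_def \<tau>_def field_simps)
  have fD: "fst D x = (\<tau> l - \<tau> n) * fst (Y \<kappa> 0) x" if "x \<in> {0..1}" for x
    using Qeq[OF that] by (simp add: Q_def D_def comb_def algebra_simps)
  have "frm D (Y \<kappa> 2) = frm (comb ((\<lambda>_. 0), 0) (\<tau> l - \<tau> n) (Y \<kappa> 0)) (Y \<kappa> 2)"
    by (rule frm_cong) (simp_all add: fD sD comb_def)
  also have "\<dots> = (\<tau> l - \<tau> n) * (- w \<kappa> 3 * ?m)"
    by (simp add: frm_comb_left gram_triple(3)[OF triple(1-3)])
  finally have "(\<tau> l - \<tau> n) * (- w \<kappa> 3 * ?m) = frm D (Y \<kappa> 2)" by simp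
  also have "\<dots> = 0" using U2[of l] U2[of n] ln cU by (simp add: D_def frm_comb_left)
  finally have \<tau>: "\<tau> l - \<tau> n = 0" using m triple(4) by simp
  \<comment> \<open>Subtracting the relations at \<open>l\<close> and \<open>n\<close> leaves
    \<open>(l - n)\<close> times \<open>U l\<close> as the image of \<open>D\<close>. As
    \<open>D\<close> is zero, so is \<open>U l\<close>, and then so is its image
    \<open>W\<close>.\<close>
  have "res n (comb (comb W (l - n) (U l)) (-1) W) D"
    unfolding D_def by (intro res_comb res_shift resU)
  from res_zero[OF this] fD sD \<tau>
  have "(l - n) * fst (U l) x = 0" "(l - n) * snd (U l) = 0" if "x \<in> {0..1}" for x
    using that by (simp_all add: comb_def)
  then have "\<And>x. x \<in> {0..1} \<Longrightarrow> fst (U l) x = 0" "snd (U l) = 0" using ln by force+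
  from res_zero[OF resU[of l] this]
  show "\<And>x. x \<in> {0..1} \<Longrightarrow> fst W x = 0" "snd W = 0" by auto
qed

end

section \<open>Minimality\<close>

lemma integrable_on_open_unit_interval:
  fixes g :: "real \<Rightarrow> real"
  assumes "continuous_on {0..1} g"
  shows "integrable (lebesgue_on {0<..<1}) g" "(LINT x|lebesgue_on {0<..<1}. g x) = prim g 1"
proof -
  have "g absolutely_integrable_on {0..1}"
    using absolutely_integrable_continuous[of 0 1 g] assms by simp
  then have "set_integrable lebesgue {0<..<1} g"
    by (rule set_integrable_subset) auto
  then show i: "integrable (lebesgue_on {0<..<1}) g"
    by (simp add: integrable_restrict_space set_integrable_def)
  show "(LINT x|lebesgue_on {0<..<1}. g x) = prim g 1"
    using lebesgue_integral_eq_integral[OF i] by (simp add: prim_def integral_open_interval_real)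
qed

lemma in_L2_continuous:
  assumes "continuous_on {0..1} f"
  shows "in_L2 f"
  unfolding in_L2_def
proof
  show "f \<in> borel_measurable (lebesgue_on {0<..<1})"
    by (rule continuous_imp_measurable_on_sets_lebesgue[OF continuous_on_subset[OF assms]]) auto
  show "integrable (lebesgue_on {0<..<1}) (\<lambda>x. (cmod (f x))\<^sup>2)"
    by (intro integrable_on_open_unit_interval continuous_intros assms)
qed

lemma L2_norm_continuous:
  assumes "continuous_on {0..1} f"
  shows "L2_norm f = sqrt (rip (\<lambda>x. cmod (f x)) (\<lambda>x. cmod (f x)))"
proof -
  have "continuous_on {0..1} (\<lambda>x. (cmod (f x))\<^sup>2)" by (intro continuous_intros assms)
  then show ?thesis
    by (simp add: L2_norm_def integrable_on_open_unit_interval(2) rip_def power2_eq_square)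
qed

text \<open>Pairing with \<open>u\<close> is bounded by Cauchy-Schwarz, kills the span of the other
  functions and not \<open>f i\<close>; so \<open>f i\<close> has positive distance from that
  span.\<close>

lemma minimal_systemI_biorthogonal:
  fixes f :: "'i \<Rightarrow> real \<Rightarrow> complex"
  assumes cont: "\<And>i. i \<in> I \<Longrightarrow> continuous_on {0..1} (f i)"
    and real: "\<And>i x. i \<in> I \<Longrightarrow> x \<in> {0..1} \<Longrightarrow> f i x = of_real (\<phi> i x)"
    and dual: "\<And>i. i \<in> I \<Longrightarrow> \<exists>u. continuous_on {0..1} u \<and> rip (\<phi> i) u \<noteq> 0 \<and>
        (\<forall>j\<in>I. j \<noteq> i \<longrightarrow> rip (\<phi> j) u = 0)"
  shows "minimal_system I f"
  unfolding minimal_system_def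
proof (intro conjI ballI notI)
  show "in_L2 (f i)" if "i \<in> I" for i using in_L2_continuous[OF cont[OF that]] .
  fix i assume i: "i \<in> I" and cl: "f i \<in> closed_lin_span (I - {i}) f"
  obtain u where u: "continuous_on {0..1} u" "rip (\<phi> i) u \<noteq> 0" "\<And>j. j \<in> I \<Longrightarrow> j \<noteq> i \<Longrightarrow> rip (\<phi> j) u = 0"
    using dual[OF i] by blast
  have cip: "prim (\<lambda>t. f j t * of_real (u t)) 1 = of_real (rip (\<phi> j) u)" if j: "j \<in> I" for j
  proof -
    have "continuous_on {0..1} (\<lambda>t. Re (f j t))" by (intro continuous_intros cont j)
    then have c: "continuous_on {0..1} (\<phi> j)"
      by (rule continuous_on_eq) (simp add: real[OF j])
    have "prim (\<lambda>t. f j t * of_real (u t)) 1 = prim (\<lambda>t. of_real (\<phi> j t * u t)) 1"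
      using real[OF j] by (intro prim_cong) auto
    also have "\<dots> = of_real (rip (\<phi> j) u)"
      unfolding rip_def by (intro prim_of_real continuous_intros c u) auto
    finally show ?thesis .
  qed
  let ?U = "rip (\<lambda>x. \<bar>u x\<bar>) (\<lambda>x. \<bar>u x\<bar>)"
  have U0: "0 \<le> ?U" by (intro rip_nonneg continuous_intros u)
  let ?\<epsilon> = "\<bar>rip (\<phi> i) u\<bar> / (sqrt ?U + 1)"
  have "0 < ?\<epsilon>" using u(2) U0 by (intro divide_pos_pos) (auto simp: add_nonneg_pos)
  with cl obtain g where g: "g \<in> lin_span (I - {i}) f" "L2_norm (\<lambda>x. f i x - g x) < ?\<epsilon>"
    unfolding closed_lin_span_def by blast
  then obtain J r where J: "finite J" "J \<subseteq> I - {i}" and g_eq: "g = (\<lambda>x. \<Sum>j\<in>J. r j * f j x)"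
    unfolding lin_span_def by blast
  have cg: "continuous_on {0..1} g"
    unfolding g_eq using J by (intro continuous_intros cont) auto
  let ?h = "\<lambda>x. f i x - g x"
  have ch: "continuous_on {0..1} ?h" by (intro continuous_intros cg cont i)
  have N0: "0 \<le> L2_norm ?h"
    unfolding L2_norm_continuous[OF ch]
    by (intro real_sqrt_ge_zero rip_nonneg continuous_on_norm ch)
  have "prim (\<lambda>t. g t * of_real (u t)) 1 = (\<Sum>j\<in>J. r j * prim (\<lambda>t. f j t * of_real (u t)) 1)"
  proof -
    have "prim (\<lambda>t. g t * of_real (u t)) 1 = integral {0..1} (\<lambda>t. \<Sum>j\<in>J. r j * (f j t * of_real (u t)))"
      by (simp add: g_eq prim_def sum_distrib_right mult.assoc)
    also have "\<dots> = (\<Sum>j\<in>J. integral {0..1} (\<lambda>t. r j * (f j t * of_real (u t))))"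
      using J by (intro integral_sum integrable_continuous_real continuous_intros cont u) auto
    finally show ?thesis by (simp add: prim_def)
  qed
  also have "\<dots> = 0"
  proof (intro sum.neutral ballI)
    fix j assume "j \<in> J"
    then have "j \<in> I" "j \<noteq> i" using J by auto
    then show "r j * prim (\<lambda>t. f j t * of_real (u t)) 1 = 0" by (simp add: cip u(3))
  qed
  finally have "prim (\<lambda>t. ?h t * of_real (u t)) 1 = of_real (rip (\<phi> i) u)"
    using cip[OF i]
    by (simp add: left_diff_distrib prim_diff continuous_intros cont i cg u)
  then have "\<bar>rip (\<phi> i) u\<bar> = norm (prim (\<lambda>t. ?h t * of_real (u t)) 1)" by simp
  also have "\<dots> \<le> rip (\<lambda>t. cmod (?h t)) (\<lambda>t. \<bar>u t\<bar>)"
    unfolding rip_def by (rule norm_prim_le) (auto intro!: continuous_intros ch u cg cont i simp: norm_mult)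
  also have "\<dots> \<le> L2_norm ?h * sqrt ?U"
  proof -
    have "(rip (\<lambda>t. cmod (?h t)) (\<lambda>t. \<bar>u t\<bar>))\<^sup>2 \<le> (L2_norm ?h * sqrt ?U)\<^sup>2"
    proof -
      have c: "continuous_on {0..1} (\<lambda>t. cmod (?h t))" "continuous_on {0..1} (\<lambda>t. \<bar>u t\<bar>)"
        by (intro continuous_intros ch u)+
      show ?thesis using rip_Cauchy_Schwarz[OF c] rip_nonneg[OF c(1)] U0
        by (simp add: L2_norm_continuous[OF ch] power_mult_distrib)
    qed
    then show ?thesis
      by (rule power2_le_imp_le) (use U0 N0 in simp)
  qed
  also have "\<dots> \<le> L2_norm ?h * (sqrt ?U + 1)"
    using N0 by (intro mult_left_mono) auto
  also have "\<dots> < \<bar>rip (\<phi> i) u\<bar>"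
    using g(2) U0 by (simp add: pos_less_divide_eq add_nonneg_pos)
  finally show False by simp
qed

text \<open>
  A minimising sequence for the distance of \<open>\<phi> j\<close> to the span of the other \<open>\<phi> i\<close> replaces the
  orthogonal projection.
\<close>

lemma minimizing_sequence:
  fixes f :: "'i \<Rightarrow> real \<Rightarrow> complex"
  assumes cont: "\<And>i. i \<in> I \<Longrightarrow> continuous_on {0..1} (f i)"
    and real: "\<And>i x. i \<in> I \<Longrightarrow> x \<in> {0..1} \<Longrightarrow> f i x = of_real (\<phi> i x)"
    and min: "minimal_system I f" and j: "j \<in> I"
  obtains r :: "nat \<Rightarrow> real \<Rightarrow> real" and \<Delta> where "0 < \<Delta>" "\<And>n. continuous_on {0..1} (r n)"
    "\<And>i. i \<in> I \<Longrightarrow> i \<noteq> j \<Longrightarrow> (\<lambda>n. rip (r n) (\<phi> i)) \<longlonglongrightarrow> 0"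
    "(\<lambda>n. rip (r n) (\<phi> j)) \<longlonglongrightarrow> \<Delta>"
    "\<And>e. 0 < e \<Longrightarrow> \<exists>N. \<forall>m\<ge>N. \<forall>n\<ge>N. rip (\<lambda>x. r m x - r n x) (\<lambda>x. r m x - r n x) < e"
proof -
  have c\<phi>: "continuous_on {0..1} (\<phi> i)" if i: "i \<in> I" for i
  proof -
    have "continuous_on {0..1} (\<lambda>t. Re (f i t))" by (intro continuous_intros cont i)
    then show ?thesis by (rule continuous_on_eq) (simp add: real[OF i])
  qed
  \<comment> \<open>Real combinations are also complex ones, so the positive distance supplied by
    minimality remains a lower bound for them.\<close>
  define S where "S = {s. \<exists>J r. finite J \<and> J \<subseteq> I - {j} \<and> s = (\<lambda>x. \<Sum>i\<in>J. r i * \<phi> i x)}"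
  have cS: "continuous_on {0..1} s" if "s \<in> S" for s
    using that unfolding S_def by (auto intro!: continuous_intros c\<phi>)
  have SE: thesis
    if "s \<in> S" "\<And>J r. finite J \<Longrightarrow> J \<subseteq> I - {j} \<Longrightarrow> s = (\<lambda>x. \<Sum>i\<in>J. r i * \<phi> i x) \<Longrightarrow> thesis" for s thesis
    using that(1) unfolding S_def mem_Collect_eq by (elim exE conjE) (rule that(2))
  have S0: "(\<lambda>x. 0) \<in> S" unfolding S_def by (intro CollectI exI[of _ "{}"]) simp
  have SI: "\<phi> i \<in> S" if "i \<in> I" "i \<noteq> j" for i
    unfolding S_def using that by (intro CollectI exI[of _ "{i}"] exI[of _ "\<lambda>_. 1"]) auto
  have Sadd: "(\<lambda>x. s x + t * s' x) \<in> S" if s: "s \<in> S" and s': "s' \<in> S" for s s' t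
  proof -
    obtain J r where J: "finite J" "J \<subseteq> I - {j}" "s = (\<lambda>x. \<Sum>i\<in>J. r i * \<phi> i x)"
      by (rule SE[OF s])
    obtain J' r' where J': "finite J'" "J' \<subseteq> I - {j}" "s' = (\<lambda>x. \<Sum>i\<in>J'. r' i * \<phi> i x)"
      by (rule SE[OF s'])
    have "s x + t * s' x = (\<Sum>i\<in>J \<union> J'. ((if i \<in> J then r i else 0) + t * (if i \<in> J' then r' i else 0)) * \<phi> i x)" for x
    proof -
      have "s x = (\<Sum>i\<in>J \<union> J'. (if i \<in> J then r i else 0) * \<phi> i x)"
        unfolding J(3) using J(1) J'(1) by (intro sum.mono_neutral_cong_left) auto
      moreover have "s' x = (\<Sum>i\<in>J \<union> J'. (if i \<in> J' then r' i else 0) * \<phi> i x)"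
        unfolding J'(3) using J(1) J'(1) by (intro sum.mono_neutral_cong_left) auto
      ultimately show ?thesis
        by (simp only: sum_distrib_left sum.distrib[symmetric]) (simp only: distrib_right mult.assoc)
    qed
    then show ?thesis unfolding S_def using J(1,2) J'(1,2)
      by (intro CollectI exI[of _ "J \<union> J'"] exI conjI) auto
  qed
  obtain \<epsilon> where \<epsilon>: "0 < \<epsilon>" "\<And>g. g \<in> lin_span (I - {j}) f \<Longrightarrow> \<epsilon> \<le> L2_norm (\<lambda>x. f j x - g x)"
    using min j unfolding minimal_system_def closed_lin_span_def by (auto simp: not_less)
  define X where "X = {(\<lambda>x. \<phi> j x + (-1) * s x) | s. s \<in> S}"
  have XE: thesis if "r \<in> X" "\<And>s. s \<in> S \<Longrightarrow> r = (\<lambda>x. \<phi> j x + (-1) * s x) \<Longrightarrow> thesis" for r thesis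
    using that(1) unfolding X_def mem_Collect_eq by (elim exE conjE) (rule that(2))
  let ?Q = "\<lambda>r :: real \<Rightarrow> real. rip r r"
  have cX: "continuous_on {0..1} r" if r: "r \<in> X" for r
  proof -
    obtain s where s: "s \<in> S" "r = (\<lambda>x. \<phi> j x + (-1) * s x)" by (rule XE[OF r])
    show ?thesis unfolding s(2) by (intro continuous_intros c\<phi>[OF j] cS[OF s(1)])
  qed
  have lower: "\<epsilon>\<^sup>2 \<le> ?Q r" if r: "r \<in> X" for r
  proof -
    obtain s where s: "s \<in> S" "r = (\<lambda>x. \<phi> j x + (-1) * s x)" by (rule XE[OF r])
    obtain J p where J: "finite J" "J \<subseteq> I - {j}" "s = (\<lambda>x. \<Sum>i\<in>J. p i * \<phi> i x)"
      by (rule SE[OF s(1)])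
    have r_eq: "r = (\<lambda>x. \<phi> j x + (-1) * (\<Sum>i\<in>J. p i * \<phi> i x))" unfolding s(2) J(3) ..
    define g where "g x = (\<Sum>i\<in>J. complex_of_real (p i) * f i x)" for x
    have "g \<in> lin_span (I - {j}) f"
      unfolding lin_span_def mem_Collect_eq
      by (rule exI[of _ J], rule exI[of _ "\<lambda>i. complex_of_real (p i)"]) (use J g_def in \<open>simp add: fun_eq_iff\<close>)
    then have "\<epsilon> \<le> L2_norm (\<lambda>x. f j x - g x)" by (rule \<epsilon>(2))
    also have "\<dots> = sqrt (rip (\<lambda>x. cmod (f j x - g x)) (\<lambda>x. cmod (f j x - g x)))"
      unfolding g_def using J by (intro L2_norm_continuous continuous_intros cont j) auto
    also have "rip (\<lambda>x. cmod (f j x - g x)) (\<lambda>x. cmod (f j x - g x)) = ?Q r"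
    proof -
      have "cmod (f j x - g x) = \<bar>r x\<bar>" if x: "x \<in> {0..1}" for x
      proof -
        have "g x = (\<Sum>i\<in>J. complex_of_real (p i) * of_real (\<phi> i x))"
          unfolding g_def using J x real by (intro sum.cong) auto
        then have "f j x - g x = of_real (r x)" using real[OF j x] by (simp add: r_eq)
        then show ?thesis by (simp del: of_real_diff)
      qed
      then show ?thesis unfolding rip_def by (intro prim_cong) auto
    qed
    finally have "\<epsilon>\<^sup>2 \<le> (sqrt (?Q r))\<^sup>2" using \<epsilon>(1) by (intro power_mono) auto
    then show ?thesis using rip_nonneg[OF cX[OF r]] by simp
  qed
  define \<Delta> where "\<Delta> = Inf (?Q ` X)"
  have X0: "X \<noteq> {}" using S0 unfolding X_def by blast
  have bdd: "bdd_below (?Q ` X)" using lower by (intro bdd_belowI2)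
  have \<Delta>le: "\<Delta> \<le> ?Q r" if "r \<in> X" for r
    unfolding \<Delta>_def using that bdd by (intro cInf_lower) auto
  have "\<epsilon>\<^sup>2 \<le> \<Delta>" unfolding \<Delta>_def using X0 lower by (intro cINF_greatest) auto
  then have \<Delta>pos: "0 < \<Delta>" using \<epsilon>(1) by (meson less_le_trans zero_less_power)
  have "\<exists>r\<in>X. ?Q r < \<Delta> + 1 / real (Suc n)" for n
    using cINF_less_iff[OF X0 bdd, of "\<Delta> + 1 / real (Suc n)"] by (simp add: \<Delta>_def)
  then obtain r where rX: "\<And>n. r n \<in> X" and rn: "\<And>n. ?Q (r n) < \<Delta> + 1 / real (Suc n)"
    by metis
  have cr: "continuous_on {0..1} (r n)" for n using cX[OF rX] .
  have to0: "(\<lambda>n. 1 / real (Suc n) * C) \<longlonglongrightarrow> 0" for C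
    using tendsto_mult[OF LIMSEQ_Suc[OF lim_1_over_n] tendsto_const[of C]] by simp
  have Xadd: "(\<lambda>x. r x + t * s x) \<in> X" if r: "r \<in> X" and s: "s \<in> S" for r s t
  proof -
    obtain s' where s': "s' \<in> S" "r = (\<lambda>x. \<phi> j x + (-1) * s' x)" by (rule XE[OF r])
    then show ?thesis unfolding X_def using Sadd[OF s'(1) s, of "- t"]
      by (intro CollectI exI[of _ "\<lambda>x. s' x + - t * s x"]) auto
  qed
  \<comment> \<open>\<open>r n\<close> minimises up to \<open>1 / Suc n\<close>, so moving along
    \<open>s\<close> can lower its square norm by no more than that; the discriminant of this
    quadratic in the step length bounds the pairing.\<close>
  have orth: "(rip (r n) s)\<^sup>2 \<le> 1 / real (Suc n) * ?Q s" if s: "s \<in> S" for n s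
  proof -
    have "0 \<le> (?Q (r n) - \<Delta>) + 2 * t * rip (r n) s + t\<^sup>2 * ?Q s" for t
      using \<Delta>le[OF Xadd[OF rX s], of n t] rip_add_mult_self[OF cr cS[OF s], of n t] by simp
    then have "(rip (r n) s)\<^sup>2 \<le> (?Q (r n) - \<Delta>) * ?Q s"
      by (rule quadratic_nonneg_discriminant[OF _ rip_nonneg[OF cS[OF s]]])
    also have "\<dots> \<le> 1 / real (Suc n) * ?Q s"
      using rn[of n] by (intro mult_right_mono rip_nonneg cS s) auto
    finally show ?thesis .
  qed
  have sq0: "a \<longlonglongrightarrow> 0" if "\<And>n. (a n)\<^sup>2 \<le> 1 / real (Suc n) * C" for a :: "nat \<Rightarrow> real" and C
  proof -
    have "(\<lambda>n. (a n)\<^sup>2) \<longlonglongrightarrow> 0"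
      by (rule tendsto_sandwich[OF _ _ tendsto_const to0[of C]]) (use that in auto)
    then show ?thesis by simp
  qed
  have cauchy: "?Q (\<lambda>x. r m x - r n x) \<le> 2 / real (Suc m) + 2 / real (Suc n)" for m n
  proof -
    \<comment> \<open>The midpoint of \<open>r m\<close> and \<open>r n\<close> is again admissible,
      so the parallelogram law bounds their distance by their excess over the infimum.\<close>
    have mid: "(\<lambda>x. r m x + (-1/2) * (r m x + (-1) * r n x)) \<in> X"
    proof -
      obtain s where s: "s \<in> S" "r m = (\<lambda>x. \<phi> j x + (-1) * s x)" by (rule XE[OF rX])
      obtain s' where s': "s' \<in> S" "r n = (\<lambda>x. \<phi> j x + (-1) * s' x)" by (rule XE[OF rX])
      have "(\<lambda>x. r m x + (-1/2) * (s' x + (-1) * s x)) \<in> X"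
        by (intro Xadd Sadd rX s s')
      then show ?thesis unfolding s(2) s'(2) by simp
    qed
    let ?d = "\<lambda>x. r m x + (-1) * r n x"
    have cd: "continuous_on {0..1} ?d" by (intro continuous_intros cr)
    have 1: "\<Delta> \<le> ?Q (r m) + 2 * (-1/2) * rip (r m) ?d + (-1/2)\<^sup>2 * ?Q ?d"
      using \<Delta>le[OF mid] rip_add_mult_self[OF cr cd, of m "-1/2"] by simp
    have 2: "?Q ?d = ?Q (r m) + 2 * (-1) * rip (r m) (r n) + (-1)\<^sup>2 * ?Q (r n)"
      by (rule rip_add_mult_self[OF cr cr])
    have 3: "rip (r m) ?d = ?Q (r m) + (-1) * rip (r m) (r n)"
      by (rule rip_add_right[OF cr cr cr])
    have "?Q ?d \<le> 2 * ?Q (r m) + 2 * ?Q (r n) - 4 * \<Delta>"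
      using 1 2 3 by (simp add: power2_eq_square algebra_simps)
    also have "\<dots> \<le> 2 / real (Suc m) + 2 / real (Suc n)"
      using rn[of m] rn[of n] by simp
    finally show ?thesis by simp
  qed
  show ?thesis
  proof (rule that[OF \<Delta>pos cr])
    show "(\<lambda>n. rip (r n) (\<phi> i)) \<longlonglongrightarrow> 0" if "i \<in> I" "i \<noteq> j" for i
      by (rule sq0[of _ "?Q (\<phi> i)"]) (rule orth[OF SI[OF that]])
    show "(\<lambda>n. rip (r n) (\<phi> j)) \<longlonglongrightarrow> \<Delta>"
    proof -
      have "\<forall>n. \<exists>s. s \<in> S \<and> r n = (\<lambda>x. \<phi> j x + (-1) * s x)"
        by (rule allI) (rule XE[OF rX], intro exI conjI)
      from choice[OF this] obtain s where "\<forall>n. s n \<in> S \<and> r n = (\<lambda>x. \<phi> j x + (-1) * s n x)"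
        by (elim exE)
      then have s: "\<And>n. s n \<in> S" "\<And>n. r n = (\<lambda>x. \<phi> j x + (-1) * s n x)"
        by (simp_all only:)
      have Qs: "?Q (s n) \<le> 2 * (\<Delta> + 1) + 2 * ?Q (\<phi> j)" for n
      proof -
        have c: "continuous_on {0..1} (s n)" "continuous_on {0..1} (\<phi> j)" using cS s c\<phi> j by auto
        have "?Q (r n) = ?Q (\<phi> j) + 2 * (-1) * rip (\<phi> j) (s n) + (-1)\<^sup>2 * ?Q (s n)"
          unfolding s(2)[of n] by (rule rip_add_mult_self[OF c(2,1)])
        moreover have "0 \<le> ?Q (\<lambda>x. s n x + (-2) * \<phi> j x)"
          using c by (intro rip_nonneg continuous_intros)
        then have "0 \<le> ?Q (s n) + 2 * (-2) * rip (s n) (\<phi> j) + (-2)\<^sup>2 * ?Q (\<phi> j)"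
          by (simp only: rip_add_mult_self[OF c])
        moreover have "1 / real (Suc n) \<le> 1" by simp
        then have "?Q (r n) \<le> \<Delta> + 1" using rn[of n] by linarith
        ultimately show ?thesis by (simp add: rip_commute[of "s n" "\<phi> j"])
      qed
      \<comment> \<open>The \<open>s n\<close> vary with \<open>n\<close> but are bounded in norm,
        which is enough for near-orthogonality. As \<open>\<phi> j = r n + s n\<close>, the pairing
        with \<open>\<phi> j\<close> has the same limit as \<open>?Q (r n)\<close>.\<close>
      have "(\<lambda>n. rip (r n) (s n)) \<longlonglongrightarrow> 0"
      proof (rule sq0[of _ "2 * (\<Delta> + 1) + 2 * ?Q (\<phi> j)"])
        fix n
        have "(rip (r n) (s n))\<^sup>2 \<le> 1 / real (Suc n) * ?Q (s n)" by (rule orth[OF s(1)])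
        also have "\<dots> \<le> 1 / real (Suc n) * (2 * (\<Delta> + 1) + 2 * ?Q (\<phi> j))"
          by (intro mult_left_mono Qs) simp
        finally show "(rip (r n) (s n))\<^sup>2 \<le> 1 / real (Suc n) * (2 * (\<Delta> + 1) + 2 * ?Q (\<phi> j))" .
      qed
      moreover have "(\<lambda>n. ?Q (r n)) \<longlonglongrightarrow> \<Delta>"
      proof (rule tendsto_sandwich[OF _ _ tendsto_const])
        show "(\<lambda>n. \<Delta> + 1 / real (Suc n)) \<longlonglongrightarrow> \<Delta>"
          using tendsto_add[OF tendsto_const to0[of 1], of \<Delta>] by simp
      qed (use \<Delta>le[OF rX] rn in \<open>auto intro!: always_eventually less_imp_le\<close>)
      ultimately have "(\<lambda>n. ?Q (r n) + rip (r n) (s n)) \<longlonglongrightarrow> \<Delta> + 0" by (intro tendsto_add)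
      moreover have "?Q (r n) + rip (r n) (s n) = rip (r n) (\<phi> j)" for n
      proof -
        have "rip (r n) (r n) = rip (r n) (\<phi> j) + (-1) * rip (r n) (s n)"
          by (subst (2) s(2)) (rule rip_add_right[OF c\<phi>[OF j] cS[OF s(1)] cr])
        then show ?thesis by simp
      qed
      ultimately show ?thesis by simp
    qed
    show "\<exists>N. \<forall>m\<ge>N. \<forall>n\<ge>N. ?Q (\<lambda>x. r m x - r n x) < e" if e: "0 < e" for e
    proof -
      obtain N where N: "inverse (real (Suc N)) < e / 4" using reals_Archimedean[of "e / 4"] e by auto
      have "2 / real (Suc m) < e / 2" if "N \<le> m" for m
      proof -
        have "1 / real (Suc m) \<le> 1 / real (Suc N)" using that by (intro divide_left_mono) auto
        then show ?thesis using N by (simp add: inverse_eq_divide)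
      qed
      then have "2 / real (Suc m) + 2 / real (Suc n) < e" if "N \<le> m" "N \<le> n" for m n
        using that by (metis add_strict_mono field_sum_of_halves)
      then show ?thesis using cauchy by (meson le_less_trans)
    qed
  qed
qed

context sl_problem
begin

text \<open>The scalar component depends on the values at \<open>1\<close> only and is not
  controlled by the mean square. High powers of \<open>x\<close> concentrate at \<open>1\<close>,
  and exponents from \<open>2\<close> on make both initial values zero, so the condition at
  \<open>0\<close> holds.\<close>

lemma concentrated_domain_vector:
  assumes \<epsilon>: "0 < \<epsilon>"
  shows "\<exists>R V. res l R V \<and> snd V = 1 \<and> rip (fst V) (fst V) < \<epsilon>"
proof -
  \<comment> \<open>The coefficients must not grow with the exponent. For
    \<open>c \<noteq> 0\<close> the two powers cancel at \<open>1\<close>, while their derivatives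
    there differ by one for every exponent, so that \<open>mm\<close> is \<open>1\<close>
    throughout.\<close>
  define p r where "p = (if c = 0 then 1 / a else 1 / c)" and "r = (if c = 0 then 0 else - 1 / c)"
  have "a \<noteq> 0" if "c = 0" using that \<sigma>_pos by auto
  then have pr: "a * (p + r) - c * ((t + 1) * p + (t + 2) * r) = 1" for t
    by (simp add: p_def r_def field_simps)
  define B where "B = \<bar>p\<bar> + \<bar>r\<bar>"
  obtain n :: nat where "B\<^sup>2 / \<epsilon> < real n" using reals_Archimedean2 by blast
  then have "B\<^sup>2 < real n * \<epsilon>" using \<epsilon> by (simp add: pos_divide_less_eq)
  also have "\<dots> \<le> (1 + real (2 * n)) * \<epsilon>" using \<epsilon> by (intro mult_right_mono) auto
  finally have n: "B\<^sup>2 / (1 + real (2 * n)) < \<epsilon>" by (simp add: divide_less_eq mult.commute add_pos_nonneg)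
  define u where "u x = p * x ^ Suc (Suc n) + r * x ^ Suc (Suc (Suc n))" for x :: real
  define v where "v x = p * (real (Suc (Suc n)) * x ^ Suc n) + r * (real (Suc (Suc (Suc n))) * x ^ Suc (Suc n))" for x :: real
  define z where "z x = p * (real (Suc (Suc n)) * (real (Suc n) * x ^ n)) + r * (real (Suc (Suc (Suc n))) * (real (Suc (Suc n)) * x ^ Suc n))" for x :: real
  define g where "g x = (q x - l) * u x - z x" for x
  have cont: "continuous_on {0..1} u" "continuous_on {0..1} z"
    unfolding u_def z_def by (intro continuous_intros)+
  have "(u has_real_derivative v x) (at x within {0..1})" "(v has_real_derivative z x) (at x within {0..1})" for x
  proof -
    have pw: "((\<lambda>x. x ^ Suc k) has_real_derivative real (Suc k) * x ^ k) (at x within {0..1})" for k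
      using DERIV_pow[of "Suc k" x] by simp
    show "(u has_real_derivative v x) (at x within {0..1})" "(v has_real_derivative z x) (at x within {0..1})"
      unfolding u_def v_def z_def by (intro DERIV_add DERIV_cmult pw)+
  qed
  then have sol: "sol q l g u v"
    unfolding sol_def g_def by (simp add: has_real_derivative_iff_has_vector_derivative)
  have mm: "mm u v = 1"
    using pr[of "real n + 1"] by (simp add: u_def v_def algebra_simps)
  have "res l (g, - nn u v - l * mm u v) (u, mm u v)"
    unfolding res_def cpair_def using sol
    by (auto simp: g_def u_def v_def intro!: exI[of _ v] continuous_intros q cont)
  moreover have "rip u u < \<epsilon>"
  proof -
    have ub: "\<bar>u x\<bar> \<le> B * x ^ n" if x: "x \<in> {0..1}" for x
    proof -
      have "\<bar>u x\<bar> \<le> \<bar>p\<bar> * x ^ Suc (Suc n) + \<bar>r\<bar> * x ^ Suc (Suc (Suc n))"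
        unfolding u_def using x by (intro order_trans[OF abs_triangle_ineq]) (simp add: abs_mult)
      also have "\<dots> \<le> \<bar>p\<bar> * x ^ n + \<bar>r\<bar> * x ^ n"
        using x by (intro add_mono mult_left_mono power_decreasing) auto
      finally show ?thesis by (simp add: B_def algebra_simps)
    qed
    have "rip u u \<le> prim (\<lambda>t. B\<^sup>2 * t ^ (2 * n)) 1"
      unfolding rip_def
    proof (rule prim_le)
      fix t :: real assume t: "t \<in> {0..1}"
      have "u t * u t = \<bar>u t\<bar> * \<bar>u t\<bar>" by simp
      also have "\<dots> \<le> (B * t ^ n) * (B * t ^ n)" using ub[OF t] by (intro mult_mono) auto
      finally show "u t * u t \<le> B\<^sup>2 * t ^ (2 * n)"
        by (simp add: power2_eq_square power_mult power_mult_distrib mult_ac)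
    qed (auto intro!: continuous_intros cont)
    also have "\<dots> = B\<^sup>2 / (1 + real (2 * n))"
      using prim_power[of 1 "2 * n"] by (simp add: prim_mult_left)
    also note n
    finally show ?thesis .
  qed
  ultimately show ?thesis using mm by force
qed

text \<open>
  In the proof, the sequence \<open>r\<close> is corrected by multiples of \<open>V\<close> and of the eigenvector at \<open>\<mu>\<close>
  into a sequence \<open>Z\<close> of pairs that becomes orthogonal to all root vectors, although its second
  component is a nonzero constant. The images of \<open>Z\<close> under the resolvent converge uniformly, and
  their limit vanishes by \<open>root_vectors_complete\<close>.
\<close>

lemma no_annihilating_sequence:
  assumes triple: "w \<kappa> 0 = 0" "w \<kappa> 1 = 0" "w \<kappa> 2 = 0" "w \<kappa> 3 \<noteq> 0"
    and simple: "\<And>l. w l 0 = 0 \<Longrightarrow> l \<noteq> \<kappa> \<Longrightarrow> w l 1 \<noteq> 0"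
    and V: "cpair V" "snd V = 0" "frm V (Y \<kappa> 0) \<noteq> 0"
    and V0: "\<And>l. w l 0 = 0 \<Longrightarrow> l \<noteq> \<kappa> \<Longrightarrow> frm V (Y l 0) = 0"
    and V12: "frm V (comb (Y \<kappa> 1) C (Y \<kappa> 0)) = 0" "frm V (comb (comb (Y \<kappa> 2) C (Y \<kappa> 1)) D (Y \<kappa> 0)) = 0"
    and \<mu>: "w \<mu> 0 = 0" "\<mu> \<noteq> \<kappa>"
    and \<Delta>: "0 < \<Delta>" and cr: "\<And>n. continuous_on {0..1} (r n)"
    and r0: "\<And>l. w l 0 = 0 \<Longrightarrow> l \<noteq> \<kappa> \<Longrightarrow> l \<noteq> \<mu> \<Longrightarrow> (\<lambda>n. rip (r n) (fst (Y l 0))) \<longlonglongrightarrow> 0"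
    and r1: "(\<lambda>n. rip (r n) (fst (comb (Y \<kappa> 1) C (Y \<kappa> 0)))) \<longlonglongrightarrow> 0"
    and r2: "(\<lambda>n. rip (r n) (fst (comb (comb (Y \<kappa> 2) C (Y \<kappa> 1)) D (Y \<kappa> 0)))) \<longlonglongrightarrow> 0"
    and r\<mu>: "(\<lambda>n. rip (r n) (fst (Y \<mu> 0))) \<longlonglongrightarrow> \<Delta>"
    and cauchy: "\<And>e. 0 < e \<Longrightarrow> \<exists>N. \<forall>m\<ge>N. \<forall>n\<ge>N. rip (\<lambda>x. r m x - r n x) (\<lambda>x. r m x - r n x) < e"
  shows False
proof -
  let ?R1 = "comb (Y \<kappa> 1) C (Y \<kappa> 0)" and ?R2 = "comb (comb (Y \<kappa> 2) C (Y \<kappa> 1)) D (Y \<kappa> 0)"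
  have cdiff: "continuous_on {0..1} (\<lambda>x. r m x - r n x)" for m n by (intro continuous_intros cr)
  \<comment> \<open>\<open>Y \<kappa> 0\<close> belongs to the function left out of the system, so
    the limit of this pairing is not prescribed; it exists because \<open>r\<close> is Cauchy in
    mean square.\<close>
  have "Cauchy (\<lambda>n. rip (r n) (fst (Y \<kappa> 0)))"
  proof (rule metric_CauchyI)
    fix e :: real assume e: "0 < e"
    let ?p = "fst (Y \<kappa> 0)"
    have cp: "continuous_on {0..1} ?p" using cpair_Y[of \<kappa> 0] by (simp add: cpair_def)
    have pp: "0 \<le> rip ?p ?p" by (rule rip_nonneg[OF cp])
    obtain N where N: "\<forall>m\<ge>N. \<forall>n\<ge>N. rip (\<lambda>x. r m x - r n x) (\<lambda>x. r m x - r n x) < e\<^sup>2 / (rip ?p ?p + 1)"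
      using cauchy[of "e\<^sup>2 / (rip ?p ?p + 1)"] e pp by auto
    have "dist (rip (r m) ?p) (rip (r n) ?p) < e" if "N \<le> m" "N \<le> n" for m n
    proof -
      let ?d = "\<lambda>x. r m x - r n x"
      have "rip (r m) ?p - rip (r n) ?p = rip ?d ?p"
        using rip_add_left[OF cr cr cp, of m "-1" n] by simp
      moreover have "(rip ?d ?p)\<^sup>2 < e\<^sup>2"
      proof -
        have "(rip ?d ?p)\<^sup>2 \<le> rip ?d ?d * rip ?p ?p" by (rule rip_Cauchy_Schwarz[OF cdiff cp])
        also have "\<dots> \<le> rip ?d ?d * (rip ?p ?p + 1)" by (intro mult_left_mono rip_nonneg cdiff) simp
        also have "\<dots> < e\<^sup>2" using N that pp by (simp add: pos_less_divide_eq)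
        finally show ?thesis .
      qed
      ultimately show ?thesis using e power_less_imp_less_base[of "\<bar>rip ?d ?p\<bar>" 2 e] by (simp add: dist_real_def)
    qed
    then show "\<exists>M. \<forall>m\<ge>M. \<forall>n\<ge>M. dist (rip (r m) ?p) (rip (r n) ?p) < e" by blast
  qed
  then obtain L where L: "(\<lambda>n. rip (r n) (fst (Y \<kappa> 0))) \<longlonglongrightarrow> L"
    using Cauchy_convergent convergent_def by blast
  \<comment> \<open>Removes the limit \<open>L\<close> at \<open>Y \<kappa> 0\<close>. Since
    \<open>V\<close> annihilates the remaining root vectors and has no scalar component, nothing
    else is disturbed.\<close>
  define \<alpha> where "\<alpha> = \<sigma> * L / frm V (Y \<kappa> 0)"
  have m: "snd (Y \<mu> 0) \<noteq> 0" by (rule snd_Y_0_nonzero[OF \<mu>(1)])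
  have fm: "frm (Y \<mu> 0) (Y \<mu> 0) \<noteq> 0" using frm_simple[OF \<mu>(1)] m simple[OF \<mu>] by simp
  \<comment> \<open>Removes the limit at \<open>Y \<mu> 0\<close>. The scalar component of that
    vector is nonzero, and this is where the constant scalar component of \<open>Z n\<close> comes
    from.\<close>
  define \<eta> where "\<eta> = \<sigma> * \<Delta> / frm (Y \<mu> 0) (Y \<mu> 0)"
  have \<eta>: "\<eta> \<noteq> 0" using \<sigma>_pos \<Delta> fm by (simp add: \<eta>_def)
  define S where "S n = comb (r n, 0) (- \<alpha>) V" for n
  define Z where "Z n = comb (S n) (- \<eta>) (Y \<mu> 0)" for n
  have cr': "cpair (r n, 0)" for n using cr by (simp add: cpair_def)
  have cS: "cpair (S n)" for n unfolding S_def by (intro cpair_comb cr' V)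
  have cZ: "cpair (Z n)" for n unfolding Z_def by (intro cpair_comb cS cpair_Y)
  have frm_r: "frm (r n, 0) P = \<sigma> * rip (r n) (fst P)" for n P by (simp add: frm_def)
  have frm_S: "frm (S n) P = \<sigma> * rip (r n) (fst P) - \<alpha> * frm V P" if "cpair P" for n P
    using that by (simp add: S_def frm_comb_left cr' V frm_r)
  have frm_Z: "frm (Z n) P = frm (S n) P - \<eta> * frm (Y \<mu> 0) P" if "cpair P" for n P
    using that by (simp add: Z_def frm_comb_left cS)
  have S0: "(\<lambda>n. frm (S n) P) \<longlonglongrightarrow> 0" if "cpair P" "(\<lambda>n. rip (r n) (fst P)) \<longlonglongrightarrow> 0" "frm V P = 0" for P
    using tendsto_mult_left[OF that(2), of \<sigma>] by (simp add: frm_S that)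
  have SY: "(\<lambda>n. frm (S n) (Y \<kappa> 0)) \<longlonglongrightarrow> 0"
  proof -
    have "(\<lambda>n. \<sigma> * rip (r n) (fst (Y \<kappa> 0)) - \<alpha> * frm V (Y \<kappa> 0)) \<longlonglongrightarrow> \<sigma> * L - \<alpha> * frm V (Y \<kappa> 0)"
      by (intro tendsto_intros L)
    then show ?thesis using V(3) by (simp add: frm_S \<alpha>_def)
  qed
  have SY1: "(\<lambda>n. frm (S n) (Y \<kappa> 1)) \<longlonglongrightarrow> 0"
    using tendsto_diff[OF S0[OF _ r1 V12(1)] tendsto_mult_left[OF SY, of C]] by (simp add: frm_comb_right cS cpair_comb)
  have SY2: "(\<lambda>n. frm (S n) (Y \<kappa> 2)) \<longlonglongrightarrow> 0"
    using tendsto_diff[OF tendsto_diff[OF S0[OF _ r2 V12(2)] tendsto_mult_left[OF SY, of D]] tendsto_mult_left[OF SY1, of C]]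
    by (simp add: frm_comb_right cS cpair_comb)
  have Z0: "(\<lambda>n. frm (Z n) (Y l 0)) \<longlonglongrightarrow> 0" if l: "w l 0 = 0" for l
  proof -
    consider "l = \<kappa>" | "l = \<mu>" | "l \<noteq> \<kappa>" "l \<noteq> \<mu>" by blast
    then show ?thesis
    proof cases
      case 1
      then show ?thesis using SY frm_distinct(1)[OF \<mu>(1) triple(1) \<mu>(2)] by (simp add: frm_Z)
    next
      case 2
      have "(\<lambda>n. \<sigma> * rip (r n) (fst (Y \<mu> 0)) - \<eta> * frm (Y \<mu> 0) (Y \<mu> 0)) \<longlonglongrightarrow> \<sigma> * \<Delta> - \<eta> * frm (Y \<mu> 0) (Y \<mu> 0)"
        by (intro tendsto_intros r\<mu>)
      then show ?thesis using 2 fm V0[OF \<mu>] by (simp add: frm_Z frm_S \<eta>_def)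
    next
      case 3
      then show ?thesis
        using S0[OF _ r0[OF l 3] V0[OF l 3(1)]] frm_distinct(1)[OF \<mu>(1) l] by (simp add: frm_Z)
    qed
  qed
  have Z1: "(\<lambda>n. frm (Z n) (Y \<kappa> 1)) \<longlonglongrightarrow> 0" and Z2: "(\<lambda>n. frm (Z n) (Y \<kappa> 2)) \<longlonglongrightarrow> 0"
    using SY1 SY2 frm_distinct(2,3)[OF \<mu>(1) triple(1) \<mu>(2)] triple by (simp_all add: frm_Z)
  \<comment> \<open>A parameter off the spectrum, at which the resolvent applies to every
    \<open>Z n\<close>.\<close>
  obtain l where l: "w l 0 \<noteq> 0"
  proof -
    have "\<forall>\<^sub>F t in at \<kappa>. w t 0 \<noteq> 0"
      by (rule w_nonzero_near[of 3]) (use triple in \<open>auto simp: eval_nat_numeral less_Suc_eq\<close>)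
    from eventually_happens'[OF _ this] show ?thesis using that by auto
  qed
  have cZ': "continuous_on {0..1} (fst (Z n))" for n using cZ by (simp add: cpair_def)
  have "\<exists>u v. sol q l (fst (Z n)) u v \<and> u 0 = 0 \<and> v 0 = 0" for n
    using sol_exists[OF q cZ'] by blast
  then obtain u v where uv: "\<And>n. sol q l (fst (Z n)) (u n) (v n)" "\<And>n. u n 0 = 0" "\<And>n. v n 0 = 0"
    by metis
  have cu: "continuous_on {0..1} (u n)" for n using sol_continuous(1)[OF uv(1)] .
  obtain M where M: "0 \<le> M" and bd:
    "\<And>g u v x. sol q l g u v \<Longrightarrow> continuous_on {0..1} g \<Longrightarrow> u 0 = 0 \<Longrightarrow> v 0 = 0 \<Longrightarrow> x \<in> {0..1} \<Longrightarrow>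
       \<bar>u x\<bar> \<le> M * prim (\<lambda>t. \<bar>g t\<bar>) x \<and> \<bar>v x\<bar> \<le> M * prim (\<lambda>t. \<bar>g t\<bar>) x"
    using sol_bound[OF q] by blast
  have Zdiff: "fst (Z m) x - fst (Z n) x = r m x - r n x" for m n x by (simp add: Z_def S_def comb_def)
  \<comment> \<open>The source enters the bound through its integral alone, which Cauchy-Schwarz
    estimates by the mean square; so mean-square Cauchy sources give uniformly Cauchy
    solutions.\<close>
  have close: "\<exists>N. \<forall>x\<in>{0..1}. \<forall>m\<ge>N. \<forall>n\<ge>N. dist (u m x) (u n x) < e \<and> dist (v m x) (v n x) < e"
    if e: "0 < e" for e
  proof -
    obtain N where N: "\<forall>m\<ge>N. \<forall>n\<ge>N. rip (\<lambda>x. r m x - r n x) (\<lambda>x. r m x - r n x) < (e / (M + 1))\<^sup>2"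
      using cauchy[of "(e / (M + 1))\<^sup>2"] e M by auto
    have "\<bar>u m x - u n x\<bar> < e \<and> \<bar>v m x - v n x\<bar> < e" if x: "x \<in> {0..1}" and mn: "N \<le> m" "N \<le> n" for m n x
    proof -
      let ?d = "\<lambda>x. r m x - r n x"
      have s: "sol q l ?d (\<lambda>x. u m x + (-1) * u n x) (\<lambda>x. v m x + (-1) * v n x)"
        using sol_lincomb[OF uv(1)[of m] uv(1)[of n], of "-1"] Zdiff[of m _ n] by simp
      have ca: "continuous_on {0..1} (\<lambda>t. \<bar>?d t\<bar>)" by (intro continuous_intros cr)
      have "(rip (\<lambda>t. \<bar>?d t\<bar>) (\<lambda>_. 1))\<^sup>2 \<le> rip (\<lambda>t. \<bar>?d t\<bar>) (\<lambda>t. \<bar>?d t\<bar>) * rip (\<lambda>_. 1) (\<lambda>_. 1)"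
        by (rule rip_Cauchy_Schwarz[OF ca continuous_on_const])
      also have "\<dots> = rip ?d ?d" using prim_power[of 1 0] by (simp add: rip_def)
      also have "\<dots> < (e / (M + 1))\<^sup>2" using N mn by blast
      finally have "rip (\<lambda>t. \<bar>?d t\<bar>) (\<lambda>_. 1) < e / (M + 1)"
        by (rule power_less_imp_less_base) (use e M in auto)
      moreover have "prim (\<lambda>t. \<bar>?d t\<bar>) x \<le> rip (\<lambda>t. \<bar>?d t\<bar>) (\<lambda>_. 1)"
        using prim_mono[OF ca, of x 1] x by (simp add: rip_def)
      ultimately have "prim (\<lambda>t. \<bar>?d t\<bar>) x < e / (M + 1)" by linarith
      then have "M * prim (\<lambda>t. \<bar>?d t\<bar>) x \<le> M * (e / (M + 1))"
        using M by (intro mult_left_mono) auto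
      also have "\<dots> < e" using M e by (simp add: field_simps)
      finally show ?thesis using bd[OF s cdiff _ _ x] uv by auto
    qed
    then show ?thesis unfolding dist_real_def by (intro exI[of _ N] ballI allI impI)
  qed
  have "uniformly_convergent_on {0..1} u"
    unfolding uniformly_convergent_eq_Cauchy uniformly_Cauchy_on_def using close by blast
  then obtain u' where u': "uniform_limit {0..1} u u' sequentially"
    unfolding uniformly_convergent_on_def by blast
  have cu': "continuous_on {0..1} u'"
    by (rule uniform_limit_theorem[OF _ u']) (use cu in auto)
  have "Cauchy (\<lambda>n. v n 1)" unfolding Cauchy_def using close by force
  then obtain v1 where v1: "(\<lambda>n. v n 1) \<longlonglongrightarrow> v1" using Cauchy_convergent convergent_def by blast
  have u1: "(\<lambda>n. u n 1) \<longlonglongrightarrow> u' 1" by (rule tendsto_uniform_limitI[OF u']) simp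
  define e where "e n = - (snd (Z n) + nn (u n) (v n) + l * mm (u n) (v n)) / w l 0" for n
  define W where "W n = comb (u n, mm (u n) (v n)) (e n) (Y l 0)" for n
  have snd_Z: "snd (Z n) = - \<eta> * snd (Y \<mu> 0)" for n by (simp add: Z_def S_def comb_def V)
  have resW: "res l (Z n) (W n)" for n
  proof -
    have "res l (fst (Z n), - nn (u n) (v n) - l * mm (u n) (v n)) (u n, mm (u n) (v n))"
      unfolding res_def using cZ' uv by (auto simp: cpair_def intro!: exI[of _ "v n"])
    from res_comb[OF this res_Y_0[of l], of "e n"]
    have "res l (comb (fst (Z n), - nn (u n) (v n) - l * mm (u n) (v n)) (e n) (\<lambda>_. 0, - w l 0)) (W n)"
      unfolding W_def .
    moreover have "comb (fst (Z n), - nn (u n) (v n) - l * mm (u n) (v n)) (e n) (\<lambda>_. 0, - w l 0) = Z n"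
      using l by (simp add: comb_def e_def prod_eq_iff)
    ultimately show ?thesis by simp
  qed
  have cW: "cpair (W n)" for n using res_cpair(2)[OF resW] .
  define e' where "e' = - (- \<eta> * snd (Y \<mu> 0) + (b * u' 1 - d * v1) + l * (a * u' 1 - c * v1)) / w l 0"
  have ee: "e \<longlonglongrightarrow> e'"
    unfolding e_def e'_def snd_Z by (intro tendsto_intros u1 v1 l)
  define W' where "W' = comb (u', a * u' 1 - c * v1) e' (Y l 0)"
  have cW': "cpair W'" unfolding W'_def by (intro cpair_comb cpair_Y) (simp add: cpair_def cu')
  have lim: "(\<lambda>n. frm (W n) R) \<longlonglongrightarrow> frm W' R" if R: "cpair R" for R
  proof -
    have cp: "cpair (u n, mm (u n) (v n))" "cpair (u', a * u' 1 - c * v1)" for n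
      using cu cu' by (simp_all add: cpair_def)
    have "(\<lambda>n. frm (u n, mm (u n) (v n)) R) \<longlonglongrightarrow> frm (u', a * u' 1 - c * v1) R"
      using u' u1 v1 by (intro frm_tendsto cp R) (auto intro!: tendsto_intros)
    then have "(\<lambda>n. frm (u n, mm (u n) (v n)) R + e n * frm (Y l 0) R) \<longlonglongrightarrow> frm (u', a * u' 1 - c * v1) R + e' * frm (Y l 0) R"
      by (intro tendsto_intros ee)
    then show ?thesis
      unfolding W_def W'_def using cp R by (simp add: frm_comb_left)
  qed
  have W0: "frm W' (Y t 0) = 0" if t: "w t 0 = 0" for t
  proof -
    have "frm (Z n) (Y t 0) = (t - l) * frm (W n) (Y t 0)" for n
      using res_symmetric[OF resW[of n] res_Y_0[of t]] t by simp
    then have "(\<lambda>n. (t - l) * frm (W n) (Y t 0)) \<longlonglongrightarrow> 0" using Z0[OF t] by simp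
    from LIMSEQ_unique[OF this tendsto_mult_left[OF lim]] show ?thesis using l t by auto
  qed
  \<comment> \<open>\<open>Y \<kappa> i\<close> is the image of its successor, so orthogonality in
    the limit climbs the chain.\<close>
  have step: "frm W' (Y \<kappa> (Suc i)) = 0"
    if "(\<lambda>n. frm (Z n) (Y \<kappa> (Suc i))) \<longlonglongrightarrow> 0" "frm W' (Y \<kappa> i) = 0" "w \<kappa> (Suc i) = 0" for i
  proof -
    have "frm (Z n) (Y \<kappa> (Suc i)) - frm (W n) (Y \<kappa> i) = (\<kappa> - l) * frm (W n) (Y \<kappa> (Suc i))" for n
      using res_symmetric[OF resW[of n] res_Y_Suc[of \<kappa> i]] that(3) by (simp add: frm_comb_right cW)
    moreover have "(\<lambda>n. frm (Z n) (Y \<kappa> (Suc i)) - frm (W n) (Y \<kappa> i)) \<longlonglongrightarrow> 0 - 0"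
      using that(1) lim[of "Y \<kappa> i"] that(2) by (intro tendsto_diff) auto
    ultimately have "(\<lambda>n. (\<kappa> - l) * frm (W n) (Y \<kappa> (Suc i))) \<longlonglongrightarrow> 0" by simp
    from LIMSEQ_unique[OF this tendsto_mult_left[OF lim]] show ?thesis using l triple by auto
  qed
  have W1: "frm W' (Y \<kappa> 1) = 0" using step[of 0] Z1 W0[OF triple(1)] triple by simp
  have W2: "frm W' (Y \<kappa> 2) = 0" using step[of 1] Z2 W1 triple by (simp add: numeral_2_eq_2)
  note W'0 = root_vectors_complete[OF triple simple cW' W0 W1 W2]
  have frmW'0: "frm W' R = 0" for R
    using frm_cong[of W' "((\<lambda>_. 0), 0)" R] W'0 by simp
  define \<zeta> where "\<zeta> = \<bar>\<eta> * snd (Y \<mu> 0)\<bar>"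
  have \<zeta>: "0 < \<zeta>" using \<eta> m by (simp add: \<zeta>_def)
  obtain N where N: "\<forall>m\<ge>N. \<forall>n\<ge>N. rip (\<lambda>x. r m x - r n x) (\<lambda>x. r m x - r n x) < 1"
    using cauchy[of 1] by auto
  define B where "B = rip (fst (Z N)) (fst (Z N))"
  have B: "0 \<le> B" unfolding B_def by (rule rip_nonneg[OF cZ'])
  \<comment> \<open>Chosen so that \<open>T\<close> pairs with \<open>fst (Z N)\<close> and with
    \<open>r n - r N\<close> to at most \<open>\<zeta> / (3 * \<sigma>)\<close> each; together with
    the last third from \<open>ev1\<close> this falls short of \<open>\<zeta>\<close>.\<close>
  define \<epsilon> where "\<epsilon> = (\<zeta> / (3 * \<sigma>))\<^sup>2 / (B + 1)"
  have \<epsilon>: "0 < \<epsilon>" using \<zeta> \<sigma>_pos B by (simp add: \<epsilon>_def)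
  obtain R T where RT: "res l R T" "snd T = 1" "rip (fst T) (fst T) < \<epsilon>"
    using concentrated_domain_vector[OF \<epsilon>, of l] by blast
  have cT: "cpair T" "cpair R" using res_cpair[OF RT(1)] by auto
  then have cT': "continuous_on {0..1} (fst T)" by (simp add: cpair_def)
  \<comment> \<open>By symmetry at the common parameter \<open>l\<close>, \<open>T\<close> transfers
    the vanishing limit of \<open>W n\<close> back to \<open>Z n\<close>. But \<open>T\<close> is
    nearly \<open>0\<close> in mean square and has scalar component \<open>1\<close>, so it reads
    off the scalar component of \<open>Z n\<close>, which stays away from \<open>0\<close>.\<close>
  have "frm (Z n) T = frm (W n) R" for n using res_symmetric[OF resW RT(1)] by simp
  then have "(\<lambda>n. frm (Z n) T) \<longlonglongrightarrow> 0" using lim[OF cT(2)] frmW'0 by simp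
  then have ev1: "\<forall>\<^sub>F n in sequentially. \<bar>frm (Z n) T\<bar> < \<zeta> / 3"
    using \<zeta> by (auto dest!: tendstoD[of _ _ _ "\<zeta> / 3"] simp: dist_real_def)
  have ripT: "\<bar>rip (fst (Z n)) (fst T)\<bar> \<le> 2 * (\<zeta> / (3 * \<sigma>))" if n: "N \<le> n" for n
  proof -
    have small: "\<bar>rip f (fst T)\<bar> \<le> \<zeta> / (3 * \<sigma>)" if f: "continuous_on {0..1} f" and fB: "rip f f \<le> B + 1" for f
    proof -
      have "(rip f (fst T))\<^sup>2 \<le> rip f f * rip (fst T) (fst T)" by (rule rip_Cauchy_Schwarz[OF f cT'])
      also have "\<dots> \<le> (B + 1) * \<epsilon>"
        using fB RT(3) B by (intro mult_mono rip_nonneg cT') auto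
      also have "\<dots> = (\<zeta> / (3 * \<sigma>))\<^sup>2" using B by (simp add: \<epsilon>_def)
      finally show ?thesis using \<zeta> \<sigma>_pos by (simp add: abs_le_square_iff[symmetric])
    qed
    have "rip (fst (Z n)) (fst T) = rip (\<lambda>x. fst (Z N) x + 1 * (r n x - r N x)) (fst T)"
      by (intro rip_cong) (simp_all flip: Zdiff)
    also have "\<dots> = rip (fst (Z N)) (fst T) + 1 * rip (\<lambda>x. r n x - r N x) (fst T)"
      by (rule rip_add_left[OF cZ' cdiff cT'])
    finally show ?thesis
      using small[OF cZ', of N] small[OF cdiff, of n N] N[rule_format, OF n order_refl] B
      unfolding B_def by linarith
  qed
  have "\<forall>\<^sub>F n in sequentially. False"
    using ev1 eventually_ge_at_top[of N]
  proof eventually_elim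
    case (elim n)
    have eq: "frm (Z n) T = \<sigma> * rip (fst (Z n)) (fst T) + \<eta> * snd (Y \<mu> 0)"
      by (simp add: frm_def RT snd_Z)
    have "\<zeta> = \<bar>frm (Z n) T - \<sigma> * rip (fst (Z n)) (fst T)\<bar>" by (simp add: eq \<zeta>_def)
    also have "\<dots> \<le> \<bar>frm (Z n) T\<bar> + \<sigma> * \<bar>rip (fst (Z n)) (fst T)\<bar>"
      using \<sigma>_pos abs_triangle_ineq4[of "frm (Z n) T" "\<sigma> * rip (fst (Z n)) (fst T)"]
      by (simp add: abs_mult)
    also have "\<dots> < \<zeta> / 3 + \<sigma> * (2 * (\<zeta> / (3 * \<sigma>)))"
      using elim ripT[of n] \<sigma>_pos by (intro add_less_le_mono mult_left_mono) auto
    also have "\<dots> = \<zeta>" using \<sigma>_pos by (simp add: field_simps)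
    finally show False by simp
  qed
  then show False by simp
qed

text \<open>The criterion in Taylor coefficients of \<omega>, where the numerical factors of the
  theorem disappear. All of it is linear algebra on the chain at \<kappa>, except that the necessity
  of the condition needs \<open>no_annihilating_sequence\<close>.\<close>

lemma minimality_criterion:
  fixes \<mu> :: "nat \<Rightarrow> real" and k :: nat and C D :: real
  defines "\<kappa> \<equiv> \<mu> k"
  defines "R \<equiv> \<lambda>n. if n = k + 1 then comb (Y \<kappa> 1) C (Y \<kappa> 0)
      else if n = k + 2 then comb (comb (Y \<kappa> 2) C (Y \<kappa> 1)) D (Y \<kappa> 0) else Y (\<mu> n) 0"
  assumes triple: "w \<kappa> 0 = 0" "w \<kappa> 1 = 0" "w \<kappa> 2 = 0" "w \<kappa> 3 \<noteq> 0"
    and simple: "\<And>l. w l 0 = 0 \<Longrightarrow> l \<noteq> \<kappa> \<Longrightarrow> w l 1 \<noteq> 0"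
    and zeros: "\<And>l. w l 0 = 0 \<longleftrightarrow> l \<in> range \<mu>"
    and eq\<kappa>: "\<And>n. \<mu> n = \<kappa> \<longleftrightarrow> n \<in> {k, k + 1, k + 2}"
    and inj: "\<And>m n. \<mu> m = \<mu> n \<Longrightarrow> \<mu> m \<noteq> \<kappa> \<Longrightarrow> m = n"
    and f: "\<And>n x. x \<in> {0..1} \<Longrightarrow> f n x = complex_of_real (fst (R n) x)"
  shows "minimal_system {n. n \<noteq> k} f \<longleftrightarrow>
    D \<noteq> C\<^sup>2 + w \<kappa> 4 / w \<kappa> 3 * (C + w \<kappa> 4 / w \<kappa> 3) - w \<kappa> 5 / w \<kappa> 3"
proof -
  note One_nat_def [simp del]
  let ?m = "\<lambda>i. snd (Y \<kappa> i)"
  have m0: "?m 0 \<noteq> 0" by (rule snd_Y_0_nonzero[OF triple(1)])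
  define p where "p = w \<kappa> 4 / w \<kappa> 3"
  define s where "s = w \<kappa> 5 / w \<kappa> 3"
  define T where "T = D - (C\<^sup>2 + p * (C + p) - s)"
  have w45: "w \<kappa> 4 = p * w \<kappa> 3" "w \<kappa> 5 = s * w \<kappa> 3" using triple(4) by (simp_all add: p_def s_def)
  note gram = gram_triple[OF triple(1-3)]
  have g: "frm (Y \<kappa> 0) (Y \<kappa> 0) = 0" "frm (Y \<kappa> 0) (Y \<kappa> 1) = 0" "frm (Y \<kappa> 1) (Y \<kappa> 0) = 0"
    "frm (Y \<kappa> 0) (Y \<kappa> 2) = - w \<kappa> 3 * ?m 0" "frm (Y \<kappa> 2) (Y \<kappa> 0) = - w \<kappa> 3 * ?m 0"
    "frm (Y \<kappa> 1) (Y \<kappa> 1) = - w \<kappa> 3 * ?m 0"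
    "frm (Y \<kappa> 1) (Y \<kappa> 2) = - w \<kappa> 3 * (p * ?m 0 + ?m 1)" "frm (Y \<kappa> 2) (Y \<kappa> 1) = - w \<kappa> 3 * (p * ?m 0 + ?m 1)"
    "frm (Y \<kappa> 2) (Y \<kappa> 2) = - w \<kappa> 3 * (s * ?m 0 + p * ?m 1 + ?m 2)"
    using gram frm_commute[of "Y \<kappa> 1" "Y \<kappa> 0"] frm_commute[of "Y \<kappa> 2" "Y \<kappa> 0"] frm_commute[of "Y \<kappa> 2" "Y \<kappa> 1"]
    by (simp_all add: w45 algebra_simps)
  let ?R1 = "comb (Y \<kappa> 1) C (Y \<kappa> 0)" and ?R2 = "comb (comb (Y \<kappa> 2) C (Y \<kappa> 1)) D (Y \<kappa> 0)"
  have R1: "R (k + 1) = ?R1" and R2: "R (k + 2) = ?R2" by (simp_all add: R_def)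
  have Rn: "R n = Y (\<mu> n) 0" if "n \<noteq> k + 1" "n \<noteq> k + 2" for n using that by (simp add: R_def)
  have cR: "cpair (R n)" for n by (auto simp: R_def)
  have cfR: "continuous_on {0..1} (fst (R n))" for n using cR by (simp add: cpair_def)
  have w\<mu>: "w (\<mu> n) 0 = 0" for n using zeros by blast
  have cont_f: "continuous_on {0..1} (f n)" for n
    by (rule continuous_on_eq[of _ "\<lambda>x. complex_of_real (fst (R n) x)"])
      (auto intro!: continuous_intros cfR simp: f)
  \<comment> \<open>With coefficient \<open>1\<close> at \<open>Y \<kappa> 2\<close>, orthogonality
    to \<open>?R1\<close> and \<open>?R2\<close> is a triangular system: the first equation
    determines \<open>\<beta>'\<close>, the second then \<open>\<alpha>'\<close>.\<close>
  define \<beta>' where "\<beta>' = - (p + C + ?m 1 / ?m 0)"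
  define \<alpha>' where "\<alpha>' = - (\<beta>' * (p * ?m 0 + ?m 1 + C * ?m 0) + (s * ?m 0 + p * ?m 1 + ?m 2)
      + C * (p * ?m 0 + ?m 1) + D * ?m 0) / ?m 0"
  define V where "V = comb (comb (Y \<kappa> 2) \<beta>' (Y \<kappa> 1)) \<alpha>' (Y \<kappa> 0)"
  have cV: "cpair V" unfolding V_def by (intro cpair_comb cpair_Y)
  have \<beta>'m: "\<beta>' * ?m 0 + C * ?m 0 + p * ?m 0 + ?m 1 = 0"
    using m0 by (simp add: \<beta>'_def algebra_simps)
  have \<alpha>'m: "\<alpha>' * ?m 0 = - (\<beta>' * (p * ?m 0 + ?m 1 + C * ?m 0) + (s * ?m 0 + p * ?m 1 + ?m 2)
      + C * (p * ?m 0 + ?m 1) + D * ?m 0)"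
    using m0 by (simp add: \<alpha>'_def)
  have VY0: "frm V (Y \<kappa> 0) \<noteq> 0"
    using m0 triple(4) by (simp add: V_def frm_comb_left cpair_comb g)
  have VR1: "frm V ?R1 = 0"
  proof -
    have "frm V ?R1 = - w \<kappa> 3 * (\<beta>' * ?m 0 + C * ?m 0 + p * ?m 0 + ?m 1)"
      by (simp add: V_def frm_comb_left frm_comb_right cpair_comb g algebra_simps)
    then show ?thesis by (simp add: \<beta>'m)
  qed
  have VR2: "frm V ?R2 = 0"
  proof -
    have "frm V ?R2 = - w \<kappa> 3 * (\<alpha>' * ?m 0 + (\<beta>' * (p * ?m 0 + ?m 1 + C * ?m 0) + (s * ?m 0 + p * ?m 1 + ?m 2)
      + C * (p * ?m 0 + ?m 1) + D * ?m 0))"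
      by (simp add: V_def frm_comb_left frm_comb_right cpair_comb g algebra_simps)
    then show ?thesis by (simp add: \<alpha>'m)
  qed
  have Vl: "frm V (Y l 0) = 0" if "w l 0 = 0" "l \<noteq> \<kappa>" for l
    using frm_distinct[OF that(1) triple(1) that(2)] triple
    by (simp add: V_def frm_comb_left cpair_comb frm_commute[of "Y \<kappa> _" "Y l 0"])
  \<comment> \<open>Inserting \<open>\<alpha>'\<close> cancels \<open>?m 2\<close>, inserting
    \<open>\<beta>'\<close> cancels \<open>?m 1\<close>; what remains is the criterion.\<close>
  have sndV: "snd V = - (?m 0 * T)"
  proof -
    have b: "\<beta>' = - (p + C) - ?m 1 / ?m 0" by (simp add: \<beta>'_def)
    have "snd V = ?m 2 + \<beta>' * ?m 1 + \<alpha>' * ?m 0" by (simp add: V_def comb_def)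
    also have "\<dots> = - (?m 0 * (\<beta>' * (p + C) + s + C * p + D)) - p * ?m 1 - C * ?m 1"
      unfolding \<alpha>'m by (simp add: algebra_simps)
    also have "\<dots> = - (?m 0 * T)"
      unfolding b T_def using m0 by (simp add: field_simps power2_eq_square)
    finally show ?thesis .
  qed
  \<comment> \<open>The Gram matrix of the chain is anti-triangular: \<open>Y \<kappa> 0\<close> is
    dual to the second associated vector, and \<open>Y \<kappa> 1\<close>, corrected by the same
    \<open>\<beta>'\<close> as in \<open>V\<close>, to the first. Every other eigenvector is dual to
    itself.\<close>
  have dual: "\<exists>U. cpair U \<and> frm U (R i) \<noteq> 0 \<and> (\<forall>n. n \<noteq> k \<longrightarrow> n \<noteq> i \<longrightarrow> frm U (R n) = 0)" if i: "i \<noteq> k" for i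
  proof -
    consider "i = k + 1" | "i = k + 2" | "\<mu> i \<noteq> \<kappa>" using i eq\<kappa>[of i] by auto
    then show ?thesis
    proof cases
      case 1
      let ?U = "comb (Y \<kappa> 1) \<beta>' (Y \<kappa> 0)"
      have "frm ?U ?R2 = - w \<kappa> 3 * (\<beta>' * ?m 0 + C * ?m 0 + p * ?m 0 + ?m 1)"
        by (simp add: frm_comb_left frm_comb_right cpair_comb g algebra_simps)
      then have 2: "frm ?U ?R2 = 0" by (simp add: \<beta>'m)
      have nz1: "frm ?U ?R1 \<noteq> 0" using m0 triple(4) by (simp add: frm_comb_left frm_comb_right cpair_comb g)
      have "frm ?U (R n) = 0" if n: "n \<noteq> k" "n \<noteq> i" for n
      proof (cases "n = k + 2")
        case False
        then have "\<mu> n \<noteq> \<kappa>" using n 1 eq\<kappa>[of n] by auto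
        then show ?thesis
          using frm_distinct[OF w\<mu> triple(1)] triple Rn[of n] n 1 False
          by (simp add: frm_commute[of _ "Y (\<mu> n) 0"] frm_comb_right)
      next
        case True
        then show ?thesis using 2 R2 by simp
      qed
      then show ?thesis using nz1 1 R1 by (intro exI[of _ ?U]) auto
    next
      case 2
      have "frm (Y \<kappa> 0) (R n) = 0" if n: "n \<noteq> k" "n \<noteq> i" for n
      proof (cases "n = k + 1")
        case False
        then have "\<mu> n \<noteq> \<kappa>" using n 2 eq\<kappa>[of n] by auto
        then show ?thesis
          using frm_distinct[OF w\<mu> triple(1)] Rn[of n] n 2 False by (simp add: frm_commute[of _ "Y (\<mu> n) 0"])
      next
        case True
        then show ?thesis using R1 by (simp add: frm_comb_right g)
      qed
      moreover have "frm (Y \<kappa> 0) ?R2 \<noteq> 0"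
        using m0 triple(4) by (simp add: frm_comb_right cpair_comb g)
      ultimately show ?thesis using 2 R2 by (intro exI[of _ "Y \<kappa> 0"]) auto
    next
      case 3
      have i': "i \<noteq> k + 1" "i \<noteq> k + 2" using 3 eq\<kappa>[of i] by auto
      have "frm (Y (\<mu> i) 0) (R i) \<noteq> 0"
        using frm_simple[OF w\<mu>[of i]] simple[OF w\<mu> 3] snd_Y_0_nonzero[OF w\<mu>[of i]] Rn[OF i'] by simp
      moreover have "frm (Y (\<mu> i) 0) (R n) = 0" if n: "n \<noteq> k" "n \<noteq> i" for n
      proof -
        have \<kappa>0: "frm (Y (\<mu> i) 0) (Y \<kappa> 0) = 0" "frm (Y (\<mu> i) 0) (Y \<kappa> 1) = 0" "frm (Y (\<mu> i) 0) (Y \<kappa> 2) = 0"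
          using frm_distinct[OF w\<mu> triple(1) 3] triple by auto
        consider "n = k + 1" | "n = k + 2" | "n \<noteq> k + 1" "n \<noteq> k + 2" by blast
        then show ?thesis
        proof cases
          case 1
          then show ?thesis using R1 by (simp add: frm_comb_right \<kappa>0)
        next
          case 2
          then show ?thesis using R2 by (simp add: frm_comb_right cpair_comb \<kappa>0)
        next
          case 3
          have "\<mu> i \<noteq> \<mu> n" using inj[of i n] \<open>\<mu> i \<noteq> \<kappa>\<close> n by auto
          then show ?thesis using frm_distinct(1)[OF w\<mu> w\<mu>] Rn[OF 3] by simp
        qed
      qed
      ultimately show ?thesis by (intro exI[of _ "Y (\<mu> i) 0"]) auto
    qed
  qed
  have VR: "frm V (R n) = 0" if "n \<noteq> k" for n
  proof -
    consider "n = k + 1" | "n = k + 2" | "n \<noteq> k + 1" "n \<noteq> k + 2" by blast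
    then show ?thesis
    proof cases
      case 3
      then show ?thesis using Vl[OF w\<mu>, of n] eq\<kappa>[of n] that Rn[OF 3] by auto
    qed (use VR1 VR2 R1 R2 in simp_all)
  qed
  have "minimal_system {n. n \<noteq> k} f" if T: "T \<noteq> 0"
  proof (rule minimal_systemI_biorthogonal[where \<phi> = "\<lambda>n. fst (R n)"])
    fix i assume "i \<in> {n. n \<noteq> k}"
    then obtain U where U: "cpair U" "frm U (R i) \<noteq> 0" "\<And>n. n \<noteq> k \<Longrightarrow> n \<noteq> i \<Longrightarrow> frm U (R n) = 0" and i: "i \<noteq> k"
      using dual[of i] by blast
    have sV: "snd V \<noteq> 0" using sndV T m0 by simp
    define U' where "U' = comb U (- (snd U / snd V)) V"
    have cU': "cpair U'" unfolding U'_def by (intro cpair_comb U cV)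
    have "snd U' = 0" using sV by (simp add: U'_def comb_def)
    then have "\<sigma> * rip (fst (R n)) (fst U') = frm U' (R n)" for n by (simp add: frm_def rip_commute)
    moreover have "frm U' (R n) = frm U (R n)" if "n \<noteq> k" for n
      unfolding U'_def using VR[OF that] by (simp add: frm_comb_left U cV cR)
    ultimately have *: "\<sigma> * rip (fst (R n)) (fst U') = frm U (R n)" if "n \<noteq> k" for n using that by simp
    show "\<exists>u. continuous_on {0..1} u \<and> rip (fst (R i)) u \<noteq> 0 \<and> (\<forall>j\<in>{n. n \<noteq> k}. j \<noteq> i \<longrightarrow> rip (fst (R j)) u = 0)"
    proof (intro exI conjI ballI impI)
      show "continuous_on {0..1} (fst U')" using cU' by (simp add: cpair_def)
      show "rip (fst (R i)) (fst U') \<noteq> 0" using *[OF i] U(2) by auto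
      fix j assume "j \<in> {n. n \<noteq> k}" "j \<noteq> i"
      then show "rip (fst (R j)) (fst U') = 0" using *[of j] U(3)[of j] \<sigma>_pos by auto
    qed
  qed (use cont_f f in auto)
  moreover have "T \<noteq> 0" if min: "minimal_system {n. n \<noteq> k} f"
  proof
    assume T: "T = 0"
    \<comment> \<open>An index outside the triple; its simple eigenvalue supplies the vector to be
      isolated.\<close>
    define j where "j = k + 3"
    have j: "j \<in> {n. n \<noteq> k}" "j \<noteq> k + 1" "j \<noteq> k + 2" "\<mu> j \<noteq> \<kappa>" using eq\<kappa>[of j] by (auto simp: j_def)
    obtain r :: "nat \<Rightarrow> real \<Rightarrow> real" and \<Delta> where r: "0 < \<Delta>" "\<And>n. continuous_on {0..1} (r n)"
      "\<And>i. i \<in> {n. n \<noteq> k} \<Longrightarrow> i \<noteq> j \<Longrightarrow> (\<lambda>n. rip (r n) (fst (R i))) \<longlonglongrightarrow> 0"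
      "(\<lambda>n. rip (r n) (fst (R j))) \<longlonglongrightarrow> \<Delta>"
      "\<And>e. 0 < e \<Longrightarrow> \<exists>N. \<forall>m\<ge>N. \<forall>n\<ge>N. rip (\<lambda>x. r m x - r n x) (\<lambda>x. r m x - r n x) < e"
      by (rule minimizing_sequence[OF cont_f f min j(1)]) blast+
    show False
    proof (rule no_annihilating_sequence[OF triple simple cV _ VY0 Vl VR1 VR2 w\<mu> j(4) r(1,2) _ _ _ _ r(5)])
      show "snd V = 0" using sndV T by simp
      show "(\<lambda>n. rip (r n) (fst (Y l 0))) \<longlonglongrightarrow> 0" if l: "w l 0 = 0" "l \<noteq> \<kappa>" "l \<noteq> \<mu> j" for l
      proof -
        obtain i where i: "l = \<mu> i" using l(1) zeros by blast
        then have "i \<noteq> k" "i \<noteq> k + 1" "i \<noteq> k + 2" "i \<noteq> j" using l eq\<kappa>[of i] by auto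
        then show ?thesis using r(3)[of i] Rn[of i] i by simp
      qed
      show "(\<lambda>n. rip (r n) (fst ?R1)) \<longlonglongrightarrow> 0" "(\<lambda>n. rip (r n) (fst ?R2)) \<longlonglongrightarrow> 0"
        using r(3)[of "k + 1"] r(3)[of "k + 2"] j R1 R2 by auto
      show "(\<lambda>n. rip (r n) (fst (Y (\<mu> j) 0))) \<longlonglongrightarrow> \<Delta>" using r(4) Rn[OF j(2,3)] by simp
    qed
  qed
  ultimately show ?thesis by (auto simp: T_def p_def s_def)
qed

end

section \<open>Translation to the characteristic function and its eigenvalue sequence\<close>

theorem theorem6p3:
  fixes q :: "real \<Rightarrow> real" and \<beta> a b c d C D :: real
    and y :: "real \<Rightarrow> complex \<Rightarrow> complex"
    and \<omega> :: "complex \<Rightarrow> complex"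
    and lam :: "nat \<Rightarrow> complex" and k :: nat
  assumes "continuous_on {0..1} q"
    and "0 \<le> \<beta>" and "\<beta> < pi"
    and "a * d - b * c < 0"
    and "sl_family q \<beta> y"
    and "\<omega> = char_fun a b c d y"
    and "eigenvalue_sequence \<omega> lam"
    and "\<forall>z. \<omega> z = 0 \<longrightarrow> z \<in> \<real>"
    and "lam (k + 1) = lam k" and "lam (k + 2) = lam k"
    and "zorder \<omega> (lam k) = 3"
    and "\<forall>z. \<omega> z = 0 \<and> z \<noteq> lam k \<longrightarrow> zorder \<omega> z = 1"
  shows "minimal_system {n. n \<noteq> k} (root_function y lam k C D) \<longleftrightarrow>
    complex_of_real D \<noteq>
      (complex_of_real C)\<^sup>2
      + (deriv ^^ 4) \<omega> (lam k) / (4 * (deriv ^^ 3) \<omega> (lam k))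
        * (complex_of_real C + (deriv ^^ 4) \<omega> (lam k) / (4 * (deriv ^^ 3) \<omega> (lam k)))
      - (deriv ^^ 5) \<omega> (lam k) / (20 * (deriv ^^ 3) \<omega> (lam k))"
proof -
  interpret sl_problem q \<beta> a b c d y
    using assms by unfold_locales auto
  have \<omega>: "\<omega> = char_fun a b c d y" by fact
  define \<mu> where "\<mu> n = Re (lam n)" for n
  define \<kappa> where "\<kappa> = \<mu> k"
  have count: "finite {n. lam n = z}" "int (card {n. lam n = z}) = (if \<omega> z = 0 then zorder \<omega> z else 0)" for z
    using assms(7) unfolding eigenvalue_sequence_def by auto
  have zero: "\<omega> z = 0" if "lam n = z" for n z
  proof (rule ccontr)
    assume "\<omega> z \<noteq> 0"
    then have "{n. lam n = z} = {}" using count[of z] by simp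
    with that show False by blast
  qed
  have lam: "lam n = of_real (\<mu> n)" for n
    using assms(8) zero[OF refl, of n] by (simp add: \<mu>_def complex_is_Real_iff complex_eq_iff)
  have \<omega>0: "\<omega> (of_real l) = 0 \<longleftrightarrow> w l 0 = 0" for l using \<omega>_real[of l] \<omega> by simp
  \<comment> \<open>A nonreal point is no zero, so \<omega> is not identically zero and its orders
    can be read off its coefficients.\<close>
  have nz: "\<omega> \<i> \<noteq> 0"
    using assms(8) by (auto simp: complex_is_Real_iff)
  have z3: "zorder \<omega> (of_real \<kappa>) = int 3" using assms(11) lam[of k] by (simp add: \<kappa>_def)
  note triple = \<omega>_zorder[folded \<omega>, OF nz z3]
  have triple': "w \<kappa> 0 = 0" "w \<kappa> 1 = 0" "w \<kappa> 2 = 0" "w \<kappa> 3 \<noteq> 0"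
    using triple(1)[of 0] triple(1)[of 1] triple(1)[of 2] triple(2) by simp_all
  have z1: "zorder \<omega> (of_real l) = int 1" if "w l 0 = 0" "l \<noteq> \<kappa>" for l
    using assms(12) that \<omega>0[of l] lam[of k] by (simp add: \<kappa>_def)
  have simple: "w l 1 \<noteq> 0" if "w l 0 = 0" "l \<noteq> \<kappa>" for l
    using \<omega>_zorder(2)[folded \<omega>, OF nz z1[OF that]] .
  have lam_eq: "{n. lam n = of_real l} = {n. \<mu> n = l}" for l by (simp add: lam)
  \<comment> \<open>Order three allows exactly three indices, and \<open>k\<close>,
    \<open>k + 1\<close>, \<open>k + 2\<close> already use them up.\<close>
  have eq\<kappa>: "\<mu> n = \<kappa> \<longleftrightarrow> n \<in> {k, k + 1, k + 2}" for n
  proof -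
    have "int (card {n. \<mu> n = \<kappa>}) = 3"
      using count(2)[of "of_real \<kappa>"] z3 \<omega>0 triple' by (simp add: lam_eq)
    then have "card {n. \<mu> n = \<kappa>} = 3" by linarith
    moreover have "{k, k + 1, k + 2} \<subseteq> {n. \<mu> n = \<kappa>}" using assms(9,10) by (simp add: \<mu>_def \<kappa>_def)
    moreover have "finite {n. \<mu> n = \<kappa>}" using count(1)[of "of_real \<kappa>"] by (simp add: lam_eq)
    moreover have "card {k, k + 1, k + 2} = 3" by simp
    ultimately have "{k, k + 1, k + 2} = {n. \<mu> n = \<kappa>}" by (intro card_subset_eq) simp_all
    then show ?thesis by blast
  qed
  have zeros: "w l 0 = 0 \<longleftrightarrow> l \<in> range \<mu>" for l
  proof
    assume l: "w l 0 = 0"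
    then have "0 < zorder \<omega> (of_real l)" using z1[of l] z3 by (cases "l = \<kappa>") auto
    then have "card {n. \<mu> n = l} \<noteq> 0" using count(2)[of "of_real l"] \<omega>0[of l] l by (simp add: lam_eq)
    then have "{n. \<mu> n = l} \<noteq> {}" by (metis card.empty)
    then show "l \<in> range \<mu>" by blast
  next
    assume "l \<in> range \<mu>"
    then show "w l 0 = 0" using zero[OF lam] \<omega>0 by auto
  qed
  have inj: "m = n" if "\<mu> m = \<mu> n" "\<mu> m \<noteq> \<kappa>" for m n
  proof -
    have w0: "w (\<mu> m) 0 = 0" using zeros by blast
    have "int (card {i. \<mu> i = \<mu> m}) = 1"
      using count(2)[of "of_real (\<mu> m)"] z1[OF w0 that(2)] \<omega>0 w0 by (simp add: lam_eq)
    then have "card {i. \<mu> i = \<mu> m} = 1" by linarith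
    then obtain e where "{i. \<mu> i = \<mu> m} = {e}" by (auto simp: card_1_singleton_iff)
    then show ?thesis using that by (metis (mono_tags, lifting) mem_Collect_eq singletonD)
  qed
  let ?R = "\<lambda>n. if n = k + 1 then comb (Y \<kappa> 1) C (Y \<kappa> 0)
      else if n = k + 2 then comb (comb (Y \<kappa> 2) C (Y \<kappa> 1)) D (Y \<kappa> 0) else Y (\<mu> n) 0"
  have f: "root_function y lam k C D n x = complex_of_real (fst (?R n) x)" if x: "x \<in> {0..1}" for n x
    using y_higher_deriv[OF x, of 0] y_higher_deriv[OF x, of 1 \<kappa>] y_higher_deriv[OF x, of 2 \<kappa>]
    by (simp add: root_function_def assoc1_tilde_def assoc2_tilde_def comb_def Y_def lam \<kappa>_def[symmetric] lam[of k])
  have "minimal_system {n. n \<noteq> k} (root_function y lam k C D) \<longleftrightarrow>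
    D \<noteq> C\<^sup>2 + w \<kappa> 4 / w \<kappa> 3 * (C + w \<kappa> 4 / w \<kappa> 3) - w \<kappa> 5 / w \<kappa> 3"
    unfolding \<kappa>_def
    by (rule minimality_criterion) (fold \<kappa>_def, use triple' simple zeros eq\<kappa> inj f in auto)
  also have "\<dots> \<longleftrightarrow> complex_of_real D \<noteq> of_real (C\<^sup>2 + w \<kappa> 4 / w \<kappa> 3 * (C + w \<kappa> 4 / w \<kappa> 3) - w \<kappa> 5 / w \<kappa> 3)"
    by (simp only: of_real_eq_iff)
  also have "complex_of_real (C\<^sup>2 + w \<kappa> 4 / w \<kappa> 3 * (C + w \<kappa> 4 / w \<kappa> 3) - w \<kappa> 5 / w \<kappa> 3) =
      (complex_of_real C)\<^sup>2
      + (deriv ^^ 4) \<omega> (lam k) / (4 * (deriv ^^ 3) \<omega> (lam k))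
        * (complex_of_real C + (deriv ^^ 4) \<omega> (lam k) / (4 * (deriv ^^ 3) \<omega> (lam k)))
      - (deriv ^^ 5) \<omega> (lam k) / (20 * (deriv ^^ 3) \<omega> (lam k))"
  proof -
    \<comment> \<open>The quotients of factorials \<open>4! / 3! = 4\<close> and
      \<open>5! / 3! = 20\<close> are the constants of the theorem.\<close>
    have d: "(deriv ^^ n) \<omega> (lam k) = fact n * of_real (w \<kappa> n)" for n
      unfolding lam \<kappa>_def[symmetric] \<omega> by (rule \<omega>_higher_deriv)
    have "(deriv ^^ 4) \<omega> (lam k) / (4 * (deriv ^^ 3) \<omega> (lam k)) = of_real (w \<kappa> 4 / w \<kappa> 3)"
      "(deriv ^^ 5) \<omega> (lam k) / (20 * (deriv ^^ 3) \<omega> (lam k)) = of_real (w \<kappa> 5 / w \<kappa> 3)"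
      by (simp_all add: d fact_numeral)
    then show ?thesis by simp
  qed
  finally show ?thesis .
qed

end
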